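(* Let $A$ be a Nakayama algebra over a field $k$, let $m$ be a positive integer, and let $S_a,S_b$ be simple $A$-modules. Then: (1) if $a\in\operatorname{Im}\gamma^m$, then $S_b$ is a subfactor of $E^m(S_a)$ if and only if $\psi^m(b)=\psi^m(a)$; (2) if the projective dimension of $S_a$ is at least $2m$ (possibly infinite), then $\Omega^{2m}(S_a)\cong E^m(S_{\gamma^m(a)})$.
   Context: Fix a field $k$; all modules are finite dimensional right modules. Let $\Delta_n$ ($n\ge 1$) be the cyclic quiver with vertices $1,\dots,n$ and arrows $x_a\colon a\to a+1$ for $1\le a\le n-1$ and $x_n\colon n\to 1$. A Nakayama algebra of order $n$ is a finite dimensional algebra $A$ isomorphic to the quotient of the path algebra $k\Delta_n$ by an ideal generated by a finite set of nontrivial paths (arrows are allowed in this set). For a vertex $a$, let $e_a$ be the idempotent, $S_a$ the simple module, $P_a=e_aA$ the indecomposable projective module and $I_a$ the indecomposable injective module (injective envelope of $S_a$) at $a$; paths are composed so that $e_aA$ is spanned by the paths starting at $a$. Put $p_a=\dim_k P_a$ and $q_a=\dim_k I_a$. Let $\tau(a)=a+1$ for $1\le a\le n-1$ and $\tau(n)=1$. Define maps on the vertex set by $\gamma(a)=\tau^{p_a}(a)$ and $\psi(a)=\tau^{-q_a}(a)$; $\gamma^m,\psi^m$ are their $m$-fold iterates. Let $e=\sum_{a\in\operatorname{Im}\gamma}e_a$ and $\epsilon(A)=eAe$, which is again a Nakayama algebra, with vertex set $\operatorname{Im}\gamma$; $\epsilon(A)=A$ if and only if $A$ is selfinjective. There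 are exact functors $F=(-)e\colon \operatorname{mod}A\to\operatorname{mod}\epsilon(A)$ and $G=(-)\otimes_{eAe}eA\colon\operatorname{mod}\epsilon(A)\to\operatorname{mod}A$, where $\operatorname{mod}$ denotes the category of finite dimensional modules. Iterating, put $\epsilon^m(A)=\epsilon(\epsilon^{m-1}(A))$ (with $\epsilon^0(A)=A$); this sequence stabilizes at a selfinjective algebra, and $\epsilon^m(A)$ has vertex set $\operatorname{Im}\gamma^m$. Composing the functors at each step gives exact functors $F_m\colon\operatorname{mod}A\to\operatorname{mod}\epsilon^m(A)$ and $G_m\colon\operatorname{mod}\epsilon^m(A)\to\operatorname{mod}A$. For each vertex $a$ of $A$ put $E^m(S_a)=G_mF_m(S_a)$. $\Omega^i(M)$ denotes the $i$-th syzygy of $M$ in a minimal projective resolution. A simple module is a subfactor of $M$ if it is a composition factor of $M$. *)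

theory Defs
  imports Complex_Main "HOL-Library.Poly_Mapping" "HOL-Library.Extended_Nat"
begin

text \<open>The type \<open>'x \<Rightarrow>\<^sub>0 'k\<close> of finitely supported functions is the free \<open>k\<close>-vector space on \<open>'x\<close>,
  with basis the vectors \<open>Poly_Mapping.single x 1\<close>.\<close>

definition scale_pm :: "'k::field \<Rightarrow> ('x \<Rightarrow>\<^sub>0 'k) \<Rightarrow> ('x \<Rightarrow>\<^sub>0 'k)" where
  "scale_pm c = Poly_Mapping.map (\<lambda>t. c * t)"

lemma lookup_scale_pm: "Poly_Mapping.lookup (scale_pm c v) x = c * Poly_Mapping.lookup v x"
  by (auto simp: scale_pm_def Poly_Mapping.map.rep_eq when_def)

interpretation pm: vector_space "scale_pm :: 'k::field \<Rightarrow> ('x \<Rightarrow>\<^sub>0 'k) \<Rightarrow> ('x \<Rightarrow>\<^sub>0 'k)"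
  by unfold_locales (auto intro!: poly_mapping_eqI simp: lookup_scale_pm lookup_add algebra_simps)


section \<open>The path algebra of the cyclic quiver\<close>

text \<open>The successor of \<open>a\<close> in the cyclic order that a finite set \<open>V\<close> of natural numbers inherits
  from the usual order. For \<open>V = {1..n}\<close> this is the permutation \<open>\<tau>\<close>; for the vertex set
  \<open>V \<subseteq> {1..n}\<close> of a corner algebra it is the next vertex of \<open>V\<close> on the cycle.\<close>

definition cyc_succ :: "nat set \<Rightarrow> nat \<Rightarrow> nat" where
  "cyc_succ V a = (if \<exists>b\<in>V. a < b then Min {b\<in>V. a < b} else Min V)"

lemma cyc_succ_interval:
  assumes "1 \<le> a" "a \<le> n"
  shows "cyc_succ {1..n} a = (if a < n then a + 1 else 1)"
proof (cases "a < n")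
  case True
  then have "Min {b\<in>{1..n}. a < b} = a + 1"
    by (intro Min_eqI) auto
  moreover have "\<exists>b\<in>{1..n}. a < b" using True by auto
  ultimately show ?thesis using True by (simp add: cyc_succ_def)
next
  case False
  moreover have "Min {1..n} = 1" using assms by (intro Min_eqI) auto
  ultimately show ?thesis by (auto simp: cyc_succ_def)
qed

text \<open>A path of \<open>\<Delta>\<^sub>n\<close> is determined by its starting vertex \<open>s\<close> and its length \<open>l\<close>, and is encoded
  as the pair \<open>(s, l)\<close>; it ends at \<open>\<tau>\<^sup>l(s)\<close>. The product of \<open>p\<close> and \<open>q\<close> is ``first \<open>p\<close>, then \<open>q\<close>''.\<close>

type_synonym path = "nat \<times> nat"

definition path_end :: "nat \<Rightarrow> path \<Rightarrow> nat" where
  "path_end n p = (cyc_succ {1..n} ^^ snd p) (fst p)"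

definition path_algebra :: "nat \<Rightarrow> (path \<Rightarrow>\<^sub>0 'k::field) set" where
  "path_algebra n = {x. \<forall>p\<in>Poly_Mapping.keys x. fst p \<in> {1..n}}"

definition path_mult :: "nat \<Rightarrow> (path \<Rightarrow>\<^sub>0 'k::field) \<Rightarrow> (path \<Rightarrow>\<^sub>0 'k) \<Rightarrow> (path \<Rightarrow>\<^sub>0 'k)" where
  "path_mult n x y =
     (\<Sum>p\<in>Poly_Mapping.keys x. \<Sum>q\<in>Poly_Mapping.keys y.
        if path_end n p = fst q
        then Poly_Mapping.single (fst p, snd p + snd q) (Poly_Mapping.lookup x p * Poly_Mapping.lookup y q) else 0)"

definition path_alg_ideal :: "nat \<Rightarrow> (path \<Rightarrow>\<^sub>0 'k::field) set \<Rightarrow> bool" where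
  "path_alg_ideal n I \<longleftrightarrow> pm.subspace I \<and> I \<subseteq> path_algebra n \<and>
     (\<forall>x\<in>I. \<forall>y\<in>path_algebra n. path_mult n x y \<in> I \<and> path_mult n y x \<in> I)"

definition ideal_generated_by :: "nat \<Rightarrow> path set \<Rightarrow> (path \<Rightarrow>\<^sub>0 'k::field) set" where
  "ideal_generated_by n R =
     \<Inter>{I. path_alg_ideal n I \<and> (\<lambda>p. Poly_Mapping.single p 1) ` R \<subseteq> I}"


section \<open>Nakayama algebras\<close>

text \<open>A \<open>k\<close>-algebra with a finite set of vertices and an idempotent for each vertex. The elements form
  a subset of an ambient (not necessarily unital) \<open>k\<close>-algebra \<open>'a\<close>, so that corner algebras \<open>eAe\<close> are
  objects of the same type. The unit is the sum of the vertex idempotents; it need not be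
  a unit of \<open>'a\<close>.\<close>

record ('k, 'a) vertex_algebra =
  smul :: "'k \<Rightarrow> 'a \<Rightarrow> 'a"
  elems :: "'a set"
  vert :: "nat set"
  idem :: "nat \<Rightarrow> 'a"

definition alg_one :: "('k, 'a::ring) vertex_algebra \<Rightarrow> 'a" where
  "alg_one A = (\<Sum>a\<in>vert A. idem A a)"

text \<open>\<open>\<phi>\<close> exhibits \<open>A\<close> as isomorphic to \<open>k\<Delta>\<^sub>n\<close> modulo the ideal generated by \<open>R\<close>:
  it is an algebra homomorphism from \<open>k\<Delta>\<^sub>n\<close> onto \<open>A\<close> whose kernel is that ideal.\<close>

definition nakayama_algebra :: "nat \<Rightarrow> ('k::field, 'a::ring) vertex_algebra \<Rightarrow> bool" where
  "nakayama_algebra n A \<longleftrightarrow>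
     n \<ge> 1 \<and> vert A = {1..n} \<and>
     vector_space (smul A) \<and>
     (\<forall>c x y. smul A c (x * y) = smul A c x * y \<and> smul A c (x * y) = x * smul A c y) \<and>
     (\<exists>B. finite B \<and> elems A \<subseteq> module.span (smul A) B) \<and>
     (\<exists>R \<phi>. finite R \<and> R \<subseteq> {(s, l). s \<in> {1..n} \<and> l \<ge> 1} \<and>
        Vector_Spaces.linear scale_pm (smul A) \<phi> \<and>
        (\<forall>x\<in>path_algebra n. \<forall>y\<in>path_algebra n. \<phi> (path_mult n x y) = \<phi> x * \<phi> y) \<and>
        (\<forall>a\<in>{1..n}. \<phi> (Poly_Mapping.single (a, 0) 1) = idem A a) \<and>
        \<phi> ` path_algebra n = elems A \<and>
        {x\<in>path_algebra n. \<phi> x = 0} = ideal_generated_by n R)"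

definition proj_dimension_at :: "('k::field, 'a::ring) vertex_algebra \<Rightarrow> nat \<Rightarrow> nat" where
  "proj_dimension_at A a = vector_space.dim (smul A) {idem A a * x | x. x \<in> elems A}"

definition gamma :: "('k::field, 'a::ring) vertex_algebra \<Rightarrow> nat \<Rightarrow> nat" where
  "gamma A a = (cyc_succ (vert A) ^^ proj_dimension_at A a) a"

text \<open>The corner algebra \<open>\<epsilon>(A) = eAe\<close> with vertex set \<open>Im \<gamma>\<close>; thus \<open>alg_one (eps A)\<close> is \<open>e\<close>,
  and \<open>\<epsilon>\<^sup>m(A)\<close> is \<open>(eps ^^ m) A\<close>.\<close>

definition eps :: "('k::field, 'a::ring) vertex_algebra \<Rightarrow> ('k, 'a) vertex_algebra" where
  "eps A = (let e = (\<Sum>a\<in>gamma A ` vert A. idem A a) in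
     A\<lparr>elems := {e * x * e | x. x \<in> elems A}, vert := gamma A ` vert A\<rparr>)"

lemma alg_one_eps: "alg_one (eps A) = (\<Sum>a\<in>gamma A ` vert A. idem A a)"
  by (simp add: alg_one_def eps_def Let_def)


section \<open>Finite dimensional right modules\<close>

text \<open>The underlying vector spaces are the finite dimensional subspaces of a fixed vector space of
  countable dimension; every finite dimensional module is isomorphic to one of this form.
  Only the values of \<open>mact\<close> on \<open>mcar M \<times> elems A\<close> matter.\<close>

type_synonym 'k uvec = "nat \<Rightarrow>\<^sub>0 'k"

record (overloaded) ('k::zero, 'a) rmod =
  mcar :: "(nat \<Rightarrow>\<^sub>0 'k) set"
  mact :: "(nat \<Rightarrow>\<^sub>0 'k) \<Rightarrow> 'a \<Rightarrow> (nat \<Rightarrow>\<^sub>0 'k)"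

definition right_module :: "('k::field, 'a::ring) vertex_algebra \<Rightarrow> ('k, 'a) rmod \<Rightarrow> bool" where
  "right_module A M \<longleftrightarrow>
     pm.subspace (mcar M) \<and> (\<exists>B. finite B \<and> mcar M \<subseteq> pm.span B) \<and>
     (\<forall>v\<in>mcar M. \<forall>x\<in>elems A. mact M v x \<in> mcar M) \<and>
     (\<forall>v\<in>mcar M. \<forall>w\<in>mcar M. \<forall>x\<in>elems A. mact M (v + w) x = mact M v x + mact M w x) \<and>
     (\<forall>v\<in>mcar M. \<forall>x\<in>elems A. \<forall>y\<in>elems A. mact M v (x + y) = mact M v x + mact M v y) \<and>
     (\<forall>c. \<forall>v\<in>mcar M. \<forall>x\<in>elems A. mact M (scale_pm c v) x = scale_pm c (mact M v x) \<and>
        mact M v (smul A c x) = scale_pm c (mact M v x)) \<and>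
     (\<forall>v\<in>mcar M. \<forall>x\<in>elems A. \<forall>y\<in>elems A. mact M (mact M v x) y = mact M v (x * y)) \<and>
     (\<forall>v\<in>mcar M. mact M v (alg_one A) = v)"

definition submodule :: "('k::field, 'a::ring) vertex_algebra \<Rightarrow> 'k uvec set \<Rightarrow> ('k, 'a) rmod \<Rightarrow> bool" where
  "submodule A L M \<longleftrightarrow> L \<subseteq> mcar M \<and> pm.subspace L \<and> (\<forall>v\<in>L. \<forall>x\<in>elems A. mact M v x \<in> L)"

definition mod_hom :: "('k::field, 'a::ring) vertex_algebra \<Rightarrow> ('k, 'a) rmod \<Rightarrow> ('k, 'a) rmod
    \<Rightarrow> ('k uvec \<Rightarrow> 'k uvec) \<Rightarrow> bool" where
  "mod_hom A M N f \<longleftrightarrow>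
     (\<forall>v\<in>mcar M. f v \<in> mcar N) \<and>
     (\<forall>v\<in>mcar M. \<forall>w\<in>mcar M. f (v + w) = f v + f w) \<and>
     (\<forall>c. \<forall>v\<in>mcar M. f (scale_pm c v) = scale_pm c (f v)) \<and>
     (\<forall>v\<in>mcar M. \<forall>x\<in>elems A. f (mact M v x) = mact N (f v) x)"

definition mod_ker :: "('k::field, 'a) rmod \<Rightarrow> ('k uvec \<Rightarrow> 'k uvec) \<Rightarrow> 'k uvec set" where
  "mod_ker M f = {v\<in>mcar M. f v = 0}"

definition mod_iso :: "('k::field, 'a::ring) vertex_algebra \<Rightarrow> ('k, 'a) rmod \<Rightarrow> ('k, 'a) rmod \<Rightarrow> bool" where
  "mod_iso A M N \<longleftrightarrow> (\<exists>f. mod_hom A M N f \<and> bij_betw f (mcar M) (mcar N))"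

definition simple_module :: "('k::field, 'a::ring) vertex_algebra \<Rightarrow> ('k, 'a) rmod \<Rightarrow> bool" where
  "simple_module A M \<longleftrightarrow> right_module A M \<and> mcar M \<noteq> {0} \<and>
     (\<forall>L. submodule A L M \<longrightarrow> L = {0} \<or> L = mcar M)"

text \<open>\<open>S\<^sub>a\<close> is the simple module (unique up to isomorphism) that is not annihilated by \<open>e\<^sub>a\<close>.\<close>

definition simple_at :: "('k::field, 'a::ring) vertex_algebra \<Rightarrow> nat \<Rightarrow> ('k, 'a) rmod" where
  "simple_at A a = (SOME S. simple_module A S \<and> (\<exists>v\<in>mcar S. mact S v (idem A a) \<noteq> 0))"

text \<open>\<open>Q\<close> is isomorphic to the subquotient \<open>L'/L\<close> of \<open>M\<close>.\<close>

definition is_subquotient :: "('k::field, 'a::ring) vertex_algebra \<Rightarrow> ('k, 'a) rmod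
    \<Rightarrow> 'k uvec set \<Rightarrow> 'k uvec set \<Rightarrow> ('k, 'a) rmod \<Rightarrow> bool" where
  "is_subquotient A M L L' Q \<longleftrightarrow>
     (\<exists>f. mod_hom A (M\<lparr>mcar := L'\<rparr>) Q f \<and> f ` L' = mcar Q \<and> mod_ker (M\<lparr>mcar := L'\<rparr>) f = L)"

definition composition_series :: "('k::field, 'a::ring) vertex_algebra \<Rightarrow> ('k, 'a) rmod
    \<Rightarrow> nat \<Rightarrow> (nat \<Rightarrow> 'k uvec set) \<Rightarrow> bool" where
  "composition_series A M l L \<longleftrightarrow>
     L 0 = {0} \<and> L l = mcar M \<and> (\<forall>i\<le>l. submodule A (L i) M) \<and>
     (\<forall>i<l. L i \<subseteq> L (Suc i) \<and>
        (\<exists>T. simple_module A T \<and> is_subquotient A M (L i) (L (Suc i)) T))"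

definition composition_factor :: "('k::field, 'a::ring) vertex_algebra \<Rightarrow> ('k, 'a) rmod \<Rightarrow> ('k, 'a) rmod \<Rightarrow> bool" where
  "composition_factor A S M \<longleftrightarrow>
     (\<exists>l L. composition_series A M l L \<and> (\<exists>i<l. is_subquotient A M (L i) (L (Suc i)) S))"


section \<open>Injective envelopes and the map \<open>\<psi>\<close>\<close>

definition injective_module :: "('k::field, 'a::ring) vertex_algebra \<Rightarrow> ('k, 'a) rmod \<Rightarrow> bool" where
  "injective_module A I \<longleftrightarrow> right_module A I \<and>
     (\<forall>M N f g. right_module A M \<longrightarrow> right_module A N \<longrightarrow> mod_hom A M N f \<longrightarrow> inj_on f (mcar M) \<longrightarrow>
        mod_hom A M I g \<longrightarrow> (\<exists>h. mod_hom A N I h \<and> (\<forall>v\<in>mcar M. h (f v) = g v)))"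

definition is_injective_envelope :: "('k::field, 'a::ring) vertex_algebra \<Rightarrow> ('k, 'a) rmod \<Rightarrow> ('k, 'a) rmod \<Rightarrow> bool" where
  "is_injective_envelope A M I \<longleftrightarrow> injective_module A I \<and>
     (\<exists>f. mod_hom A M I f \<and> inj_on f (mcar M) \<and>
        (\<forall>L. submodule A L I \<longrightarrow> L \<noteq> {0} \<longrightarrow> L \<inter> f ` mcar M \<noteq> {0}))"

definition injective_at :: "('k::field, 'a::ring) vertex_algebra \<Rightarrow> nat \<Rightarrow> ('k, 'a) rmod" where
  "injective_at A a = (SOME I. is_injective_envelope A (simple_at A a) I)"

definition inj_dimension_at :: "('k::field, 'a::ring) vertex_algebra \<Rightarrow> nat \<Rightarrow> nat" where
  "inj_dimension_at A a = pm.dim (mcar (injective_at A a))"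

definition psi :: "('k::field, 'a::ring) vertex_algebra \<Rightarrow> nat \<Rightarrow> nat" where
  "psi A a = (inv_into (vert A) (cyc_succ (vert A)) ^^ inj_dimension_at A a) a"


section \<open>Minimal projective resolutions\<close>

definition projective_module :: "('k::field, 'a::ring) vertex_algebra \<Rightarrow> ('k, 'a) rmod \<Rightarrow> bool" where
  "projective_module A P \<longleftrightarrow> right_module A P \<and>
     (\<forall>M N f g. right_module A M \<longrightarrow> right_module A N \<longrightarrow> mod_hom A M N f \<longrightarrow> f ` mcar M = mcar N \<longrightarrow>
        mod_hom A P N g \<longrightarrow> (\<exists>h. mod_hom A P M h \<and> (\<forall>v\<in>mcar P. f (h v) = g v)))"

text \<open>An exact sequence \<open>\<dots> \<rightarrow> P 2 \<rightarrow> P 1 \<rightarrow> P 0 \<rightarrow> M \<rightarrow> 0\<close>, where \<open>d 0\<close> is the augmentation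
  \<open>P 0 \<rightarrow> M\<close> and \<open>d (Suc i)\<close> maps \<open>P (Suc i)\<close> to \<open>P i\<close>.\<close>

definition projective_resolution :: "('k::field, 'a::ring) vertex_algebra \<Rightarrow> ('k, 'a) rmod
    \<Rightarrow> (nat \<Rightarrow> ('k, 'a) rmod) \<Rightarrow> (nat \<Rightarrow> 'k uvec \<Rightarrow> 'k uvec) \<Rightarrow> bool" where
  "projective_resolution A M P d \<longleftrightarrow>
     (\<forall>i. projective_module A (P i)) \<and>
     mod_hom A (P 0) M (d 0) \<and> d 0 ` mcar (P 0) = mcar M \<and>
     (\<forall>i. mod_hom A (P (Suc i)) (P i) (d (Suc i)) \<and>
        d (Suc i) ` mcar (P (Suc i)) = mod_ker (P i) (d i))"

definition superfluous :: "('k::field, 'a::ring) vertex_algebra \<Rightarrow> 'k uvec set \<Rightarrow> ('k, 'a) rmod \<Rightarrow> bool" where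
  "superfluous A K P \<longleftrightarrow>
     (\<forall>L. submodule A L P \<longrightarrow> {x + y | x y. x \<in> L \<and> y \<in> K} = mcar P \<longrightarrow> L = mcar P)"

text \<open>Minimality: each \<open>d i\<close> is a projective cover of its image.\<close>

definition minimal_projective_resolution :: "('k::field, 'a::ring) vertex_algebra \<Rightarrow> ('k, 'a) rmod
    \<Rightarrow> (nat \<Rightarrow> ('k, 'a) rmod) \<Rightarrow> (nat \<Rightarrow> 'k uvec \<Rightarrow> 'k uvec) \<Rightarrow> bool" where
  "minimal_projective_resolution A M P d \<longleftrightarrow>
     projective_resolution A M P d \<and> (\<forall>i. superfluous A (mod_ker (P i) (d i)) (P i))"

fun syzygy :: "('k::field, 'a::ring) vertex_algebra \<Rightarrow> nat \<Rightarrow> ('k, 'a) rmod \<Rightarrow> ('k, 'a) rmod" where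
  "syzygy A 0 M = M"
| "syzygy A (Suc i) M =
     (let (P, d) = (SOME (P, d). minimal_projective_resolution A M P d)
      in (P i)\<lparr>mcar := mod_ker (P i) (d i)\<rparr>)"

text \<open>The infimum of the empty set in \<^typ>\<open>enat\<close> is \<open>\<infinity>\<close>.\<close>

definition proj_dim :: "('k::field, 'a::ring) vertex_algebra \<Rightarrow> ('k, 'a) rmod \<Rightarrow> enat" where
  "proj_dim A M =
     Inf {enat l | l. \<exists>P d. projective_resolution A M P d \<and> (\<forall>i>l. mcar (P i) = {0})}"


section \<open>The functors \<open>F\<close>, \<open>G\<close> and the modules \<open>E\<^sup>m(S)\<close>\<close>

definition functor_F :: "('k::field, 'a::ring) vertex_algebra \<Rightarrow> ('k, 'a) rmod \<Rightarrow> ('k, 'a) rmod" where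
  "functor_F A M = M\<lparr>mcar := (\<lambda>v. mact M v (alg_one (eps A))) ` mcar M\<rparr>"

text \<open>\<open>T\<close> is isomorphic to \<open>N \<otimes>\<^bsub>eAe\<^esub> eA\<close>. The tensor product is the free \<open>k\<close>-vector space on
  \<open>N \<times> eA\<close> modulo the subspace spanned by the usual relations, with \<open>A\<close> acting on the second
  factor; \<open>\<pi>\<close> is the quotient map, sending the basis vector \<open>(v, x)\<close> to \<open>v \<otimes> x\<close>.\<close>

definition tensor_relations :: "('k::field, 'a::ring) vertex_algebra \<Rightarrow> ('k, 'a) rmod
    \<Rightarrow> (('k uvec \<times> 'a) \<Rightarrow>\<^sub>0 'k) set" where
  "tensor_relations A N =
     (let eA = {alg_one (eps A) * x | x. x \<in> elems A};
          t = (\<lambda>v x. Poly_Mapping.single (v, x) 1)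
      in {t (v + w) x - t v x - t w x | v w x. v \<in> mcar N \<and> w \<in> mcar N \<and> x \<in> eA}
       \<union> {t v (x + y) - t v x - t v y | v x y. v \<in> mcar N \<and> x \<in> eA \<and> y \<in> eA}
       \<union> {t (scale_pm c v) x - scale_pm c (t v x) | c v x. v \<in> mcar N \<and> x \<in> eA}
       \<union> {t v (smul A c x) - scale_pm c (t v x) | c v x. v \<in> mcar N \<and> x \<in> eA}
       \<union> {t (mact N v b) x - t v (b * x) | v b x. v \<in> mcar N \<and> b \<in> elems (eps A) \<and> x \<in> eA})"

definition is_tensor_product :: "('k::field, 'a::ring) vertex_algebra \<Rightarrow> ('k, 'a) rmod \<Rightarrow> ('k, 'a) rmod \<Rightarrow> bool" where
  "is_tensor_product A N T \<longleftrightarrow> right_module A T \<and>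
     (let eA = {alg_one (eps A) * x | x. x \<in> elems A};
          Free = {z. Poly_Mapping.keys z \<subseteq> mcar N \<times> eA}
      in \<exists>\<pi>. Vector_Spaces.linear scale_pm scale_pm \<pi> \<and>
           \<pi> ` Free = mcar T \<and>
           {z\<in>Free. \<pi> z = 0} = pm.span (tensor_relations A N) \<and>
           (\<forall>v\<in>mcar N. \<forall>x\<in>eA. \<forall>y\<in>elems A.
              mact T (\<pi> (Poly_Mapping.single (v, x) 1)) y = \<pi> (Poly_Mapping.single (v, x * y) 1)))"

definition functor_G :: "('k::field, 'a::ring) vertex_algebra \<Rightarrow> ('k, 'a) rmod \<Rightarrow> ('k, 'a) rmod" where
  "functor_G A N = (SOME T. is_tensor_product A N T)"

primrec functor_F_iter :: "nat \<Rightarrow> ('k::field, 'a::ring) vertex_algebra \<Rightarrow> ('k, 'a) rmod \<Rightarrow> ('k, 'a) rmod" where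
  "functor_F_iter 0 A M = M"
| "functor_F_iter (Suc m) A M = functor_F ((eps ^^ m) A) (functor_F_iter m A M)"

primrec functor_G_iter :: "nat \<Rightarrow> ('k::field, 'a::ring) vertex_algebra \<Rightarrow> ('k, 'a) rmod \<Rightarrow> ('k, 'a) rmod" where
  "functor_G_iter 0 A N = N"
| "functor_G_iter (Suc m) A N = functor_G_iter m A (functor_G ((eps ^^ m) A) N)"

definition E_iter :: "nat \<Rightarrow> ('k::field, 'a::ring) vertex_algebra \<Rightarrow> nat \<Rightarrow> ('k, 'a) rmod" where
  "E_iter m A a = functor_G_iter m A (functor_F_iter m A (simple_at A a))"

end

theory Submission
  imports Defs
begin

text \<open>The ideal generated by paths is monomial, so \<open>A\<close> has a basis of paths \<open>u s l\<close> with \<open>l < p s\<close>. Lifting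
  vertices to natural numbers turns \<open>\<gamma>\<close> into the monotone map \<open>f i = i + p i\<close>, and all modules that occur are
  interval modules \<open>J x y\<close> on the positions \<open>x \<le> i < y\<close> with \<open>y \<le> f x\<close>. The projective module at \<open>x\<close> is
  \<open>J x (f x)\<close>, so \<open>\<Omega>\<^sup>2(J a (a + 1)) = J (f a) (f (a + 1))\<close>, and by iteration the \<open>2m\<close>-th syzygy of \<open>S\<^sub>a\<close> is the interval
  between \<open>f\<^sup>m a\<close> and \<open>f\<^sup>m (a + 1)\<close>. On the other side \<open>E\<^sup>m(S\<^sub>x)\<close> is the interval from \<open>x\<close> to the next
  vertex of \<open>Im \<gamma>\<^sup>m\<close>, which is the same one. Finally \<open>\<psi>\<close> lifts to the right adjoint of \<open>f\<close>, so \<open>\<psi>\<^sup>m\<close> is constant exactly on the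
  intervals between consecutive values of \<open>f\<^sup>m\<close>.\<close>

text \<open>On the cycle itself there is no linear order for which \<open>gamma\<close> could be
  monotone. On lifts, monotonicity of \<open>f\<close> is the inequality
  \<open>p i \<le> Suc (p (Suc i))\<close>, and \<open>f\<close> commutes with translation by
  \<open>n\<close>; these two facts carry the combinatorics, for instance that no value of
  \<open>f ^^ m\<close>, up to multiples of \<open>n\<close>, lies strictly between two consecutive
  ones. The step by two syzygies comes from covering twice: the kernel of \<open>J a (f a)\<close>
  over \<open>J a (a + 1)\<close> is \<open>J (a + 1) (f a)\<close>, whose cover
  \<open>J (a + 1) (f (a + 1))\<close> has kernel \<open>J (f a) (f (a + 1))\<close>. The bound on
  the projective dimension keeps these intervals nonempty up to step \<open>2 * m\<close>. Corners
  are described inside \<open>A\<close>: positions are never renumbered, so \<open>F\<close> deletes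
  the positions outside the smaller vertex set and \<open>G\<close> fills them in again. Simple
  modules, injective envelopes, syzygies and tensor products are defined through arbitrary choices;
  hence uniqueness of minimal resolutions, injective envelopes and tensor products is part of the
  proof.\<close>

abbreviation sng :: "'x \<Rightarrow> ('x \<Rightarrow>\<^sub>0 'k::field)" where
  "sng x \<equiv> Poly_Mapping.single x 1"

abbreviation supp :: "('x \<Rightarrow>\<^sub>0 'k::zero) \<Rightarrow> 'x set" where
  "supp \<equiv> Poly_Mapping.keys"

abbreviation pm_linear :: "(('x \<Rightarrow>\<^sub>0 'k::field) \<Rightarrow> ('y \<Rightarrow>\<^sub>0 'k)) \<Rightarrow> bool" where
  "pm_linear \<equiv> Vector_Spaces.linear scale_pm scale_pm"

abbreviation lkp :: "('x \<Rightarrow>\<^sub>0 'k::zero) \<Rightarrow> 'x \<Rightarrow> 'k" where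
  "lkp \<equiv> Poly_Mapping.lookup"

section \<open>Linear algebra of finitely supported functions\<close>

lemma scale_pm_single [simp]: "scale_pm c (Poly_Mapping.single x d) = Poly_Mapping.single x (c * d)"
  by (rule poly_mapping_eqI) (simp add: lookup_scale_pm lookup_single when_def)

lemma sng_eq_iff [simp]: "sng x = (sng y :: 'x \<Rightarrow>\<^sub>0 'k::field) \<longleftrightarrow> x = y"
proof
  assume "sng x = (sng y :: 'x \<Rightarrow>\<^sub>0 'k)"
  then have "supp (sng x :: 'x \<Rightarrow>\<^sub>0 'k) = supp (sng y :: 'x \<Rightarrow>\<^sub>0 'k)" by simp
  then show "x = y" by simp
qed simp

lemma sng_nonzero [simp]: "sng x \<noteq> (0 :: 'x \<Rightarrow>\<^sub>0 'k::field)"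
  by (metis lookup_single_eq lookup_zero one_neq_zero)

lemma keys_scale_pm_subset: "supp (scale_pm c v) \<subseteq> supp v"
  by (auto simp: in_keys_iff lookup_scale_pm)

lemma subspace_keys_subset: "pm.subspace {z :: 'x \<Rightarrow>\<^sub>0 'k::field. supp z \<subseteq> K}"
  by (auto simp: pm.subspace_def dest!: subsetD[OF keys_add] subsetD[OF keys_scale_pm_subset])

lemma pm_expand: "z = (\<Sum>p\<in>supp z. scale_pm (lkp z p) (sng p))"
proof (rule poly_mapping_eqI)
  fix x
  have "(\<Sum>p\<in>supp z. lkp (scale_pm (lkp z p) (sng p)) x) =
        (\<Sum>p\<in>supp z. if p = x then lkp z x else 0)"
    by (intro sum.cong refl) (auto simp: lookup_single when_def)
  also have "\<dots> = lkp z x" by (simp add: in_keys_iff)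
  finally show "lkp z x = lkp (\<Sum>p\<in>supp z. scale_pm (lkp z p) (sng p)) x"
    by (simp add: lookup_sum)
qed

lemma keys_subset_eq_span: "{z :: 'x \<Rightarrow>\<^sub>0 'k::field. supp z \<subseteq> K} = pm.span (sng ` K)"
proof (rule sym, rule pm.span_subspace)
  show "sng ` K \<subseteq> {z :: 'x \<Rightarrow>\<^sub>0 'k. supp z \<subseteq> K}" by auto
  show "{z :: 'x \<Rightarrow>\<^sub>0 'k. supp z \<subseteq> K} \<subseteq> pm.span (sng ` K)"
  proof clarify
    fix z :: "'x \<Rightarrow>\<^sub>0 'k" assume "supp z \<subseteq> K"
    then have "(\<Sum>p\<in>supp z. scale_pm (lkp z p) (sng p)) \<in> pm.span (sng ` K)"
      by (intro pm.span_sum pm.span_scale pm.span_base) auto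
    then show "z \<in> pm.span (sng ` K)" by (simp only: pm_expand[symmetric])
  qed
qed (rule subspace_keys_subset)

lemma subspace_contains_keys:
  assumes "pm.subspace I" "\<And>p. p \<in> supp x \<Longrightarrow> sng p \<in> I"
  shows "x \<in> (I :: ('x \<Rightarrow>\<^sub>0 'k::field) set)"
proof -
  have "x \<in> pm.span (sng ` supp x)"
    using keys_subset_eq_span[of "supp x"] by blast
  also have "\<dots> \<subseteq> I" using assms by (intro pm.span_minimal) auto
  finally show ?thesis .
qed

lemma independent_sng: "pm.independent (sng ` K :: ('x \<Rightarrow>\<^sub>0 'k::field) set)"
proof (subst pm.independent_explicit_finite_subsets, intro allI impI ballI)
  fix S :: "('x \<Rightarrow>\<^sub>0 'k) set" and c v
  assume S: "S \<subseteq> sng ` K" "finite S" and 0: "(\<Sum>v\<in>S. scale_pm (c v) v) = 0" and v: "v \<in> S"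
  obtain x where x: "v = sng x" using S v by auto
  have "0 = lkp (\<Sum>v\<in>S. scale_pm (c v) v) x" by (simp add: 0)
  also have "\<dots> = (\<Sum>w\<in>S. if w = v then c v else 0)"
    unfolding lookup_sum lookup_scale_pm
  proof (rule sum.cong[OF refl])
    fix w assume "w \<in> S"
    then obtain y where y: "w = sng y" using S by auto
    show "c w * lkp w x = (if w = v then c v else 0)"
      by (simp add: x y lookup_single when_def)
  qed
  also have "\<dots> = c v" using v S by simp
  finally show "c v = 0" by simp
qed

lemma inj_sng: "inj_on (sng :: 'x \<Rightarrow> ('x \<Rightarrow>\<^sub>0 'k::field)) K"
  by (simp add: inj_on_def)

lemma dim_keys_subset: "pm.dim {z :: 'x \<Rightarrow>\<^sub>0 'k::field. supp z \<subseteq> K} = card K"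
  unfolding keys_subset_eq_span
  by (simp only: pm.dim_span_eq_card_independent[OF independent_sng] card_image[OF inj_sng])

lemma vector_space_mult: "vector_space ((*) :: 'k::field \<Rightarrow> 'k \<Rightarrow> 'k)"
  by unfold_locales (auto simp: algebra_simps)

section \<open>Linear maps from values on a basis or on a subspace\<close>

definition lin_ext :: "('x \<Rightarrow> 'y \<Rightarrow>\<^sub>0 'k::field) \<Rightarrow> ('x \<Rightarrow>\<^sub>0 'k) \<Rightarrow> ('y \<Rightarrow>\<^sub>0 'k)" where
  "lin_ext h z = (\<Sum>p\<in>supp z. scale_pm (lkp z p) (h p))"

lemma lin_ext_superset:
  assumes "finite K" "supp z \<subseteq> K"
  shows "lin_ext h z = (\<Sum>p\<in>K. scale_pm (lkp z p) (h p))"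
  unfolding lin_ext_def using assms
  by (intro sum.mono_neutral_left) (auto simp: in_keys_iff)

lemma linear_lin_ext:
  fixes h :: "'x \<Rightarrow> 'y \<Rightarrow>\<^sub>0 'k::field"
  shows "pm_linear (lin_ext h)"
proof (rule Vector_Spaces.linear_iff[THEN iffD2], intro conjI allI)
  fix x y :: "'x \<Rightarrow>\<^sub>0 'k" and c
  let ?K = "supp x \<union> supp y"
  have "lin_ext h (x + y) = (\<Sum>p\<in>?K. scale_pm (lkp (x + y) p) (h p))"
    by (intro lin_ext_superset) (auto simp: keys_add)
  also have "\<dots> = (\<Sum>p\<in>?K. scale_pm (lkp x p) (h p)) + (\<Sum>p\<in>?K. scale_pm (lkp y p) (h p))"
    by (simp add: lookup_add pm.scale_left_distrib sum.distrib)
  also have "\<dots> = lin_ext h x + lin_ext h y"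
    by (subst (1 2) lin_ext_superset[of ?K]) auto
  finally show "lin_ext h (x + y) = lin_ext h x + lin_ext h y" .
  have "lin_ext h (scale_pm c x) = (\<Sum>p\<in>supp x. scale_pm (lkp (scale_pm c x) p) (h p))"
    by (intro lin_ext_superset) (auto simp: keys_scale_pm_subset)
  also have "\<dots> = scale_pm c (lin_ext h x)"
    by (simp add: lin_ext_def lookup_scale_pm pm.scale_sum_right)
  finally show "lin_ext h (scale_pm c x) = scale_pm c (lin_ext h x)" .
qed (rule pm.vector_space_axioms)+

lemma lin_ext_sng [simp]: "lin_ext h (sng p) = h p"
  by (simp add: lin_ext_def)

text \<open>Homomorphisms are constrained only on the carrier of a module. Prescribing values on a
  basis of the carrier gives a total linear map that agrees with \<open>f\<close> there. The two
  scalings are arbitrary because the target is later both a space of vectors and the field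
  itself.\<close>

lemma linear_extend_from_subspace:
  fixes s1 :: "'k::field \<Rightarrow> 'x::ab_group_add \<Rightarrow> 'x" and s2 :: "'k \<Rightarrow> 'y::ab_group_add \<Rightarrow> 'y"
  assumes vs: "vector_space s1" "vector_space s2" and S: "module.subspace s1 S"
    and add: "\<And>v w. v \<in> S \<Longrightarrow> w \<in> S \<Longrightarrow> f (v + w) = f v + f w"
    and scale: "\<And>c v. v \<in> S \<Longrightarrow> f (s1 c v) = s2 c (f v)"
  obtains g where "Vector_Spaces.linear s1 s2 g" "\<And>v. v \<in> S \<Longrightarrow> g v = f v"
proof -
  interpret vector_space_pair s1 s2 using vs by (simp add: vector_space_pair_def)
  obtain B where B: "B \<subseteq> S" "vs1.independent B" "S \<subseteq> vs1.span B"
    using vs1.maximal_independent_subset by metis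
  let ?g = "construct B f"
  have lin: "Vector_Spaces.linear s1 s2 ?g" by (rule linear_construct[OF B(2)])
  interpret g: Vector_Spaces.linear s1 s2 ?g by (rule lin)
  have f0: "f 0 = 0" using scale[OF vs1.subspace_0[OF S], of 0] by simp
  have "v \<in> S \<and> ?g v = f v" if "v \<in> vs1.span B" for v
    using that
  proof (induction rule: vs1.span_induct_alt)
    case base then show ?case by (simp add: g.zero f0 vs1.subspace_0[OF S])
  next
    case (step c x y)
    then have "x \<in> S" using B(1) by auto
    with step S show ?case
      by (simp add: g.add g.scale construct_basis B(2) add scale vs1.subspace_scale vs1.subspace_add)
  qed
  with B(3) lin show ?thesis by (intro that[of ?g]) auto
qed

lemma dim_bij_linear:
  fixes f :: "('x \<Rightarrow>\<^sub>0 'k::field) \<Rightarrow> ('y \<Rightarrow>\<^sub>0 'k)"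
  assumes S: "pm.subspace S"
    and add: "\<And>v w. v \<in> S \<Longrightarrow> w \<in> S \<Longrightarrow> f (v + w) = f v + f w"
    and scale: "\<And>c v. v \<in> S \<Longrightarrow> f (scale_pm c v) = scale_pm c (f v)"
    and bij: "bij_betw f S T"
  shows "pm.dim T = pm.dim S"
proof -
  obtain g where g: "pm_linear g" "\<And>v. v \<in> S \<Longrightarrow> g v = f v"
    by (rule linear_extend_from_subspace[of scale_pm scale_pm S f])
      (use S add scale pm.vector_space_axioms in blast)+
  interpret g: Vector_Spaces.linear scale_pm scale_pm g by fact
  obtain B where B: "B \<subseteq> S" "pm.independent B" "S \<subseteq> pm.span B" "card B = pm.dim S"
    using pm.basis_exists by metis
  have sp: "pm.span B = S" using B S by (simp add: pm.span_subspace)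
  have inj: "inj_on g S" and im: "g ` S = T"
    using bij g(2) by (auto simp: bij_betw_def inj_on_def)
  have "pm.independent (g ` B)"
    using g.independent_injective_image B(2) inj sp by simp
  moreover have "pm.span (g ` B) = T" using g.span_image sp im by simp
  ultimately have "pm.dim T = card (g ` B)"
    using pm.dim_span_eq_card_independent by metis
  also have "\<dots> = card B" using inj B(1) by (meson card_image inj_on_subset)
  finally show ?thesis using B(4) by simp
qed

section \<open>Vertices lifted to the natural numbers\<close>

text \<open>The residue class of \<open>i\<close> modulo \<open>n\<close>, represented in
  \<open>{1..n}\<close>. Writing \<open>i + n - 1\<close> puts \<open>i = 0\<close> into the class
  of \<open>n\<close>; the truncated difference \<open>i - 1\<close> would send it to vertex
  1.\<close>

definition vt :: "nat \<Rightarrow> nat \<Rightarrow> nat" where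
  "vt n i = (i + n - 1) mod n + 1"

lemma vt_eq_iff: "n > 0 \<Longrightarrow> vt n i = vt n j \<longleftrightarrow> i mod n = j mod n"
proof -
  assume n: "n > 0"
  have "vt n i = vt n j \<longleftrightarrow> (i + (n - 1)) mod n = (j + (n - 1)) mod n"
    using n by (simp add: vt_def)
  also have "\<dots> \<longleftrightarrow> i mod n = j mod n"
  proof
    assume "(i + (n - 1)) mod n = (j + (n - 1)) mod n"
    then have "(i + (n - 1) + 1) mod n = (j + (n - 1) + 1) mod n" by (metis mod_add_left_eq)
    then show "i mod n = j mod n" using n by simp
  next
    assume "i mod n = j mod n"
    then show "(i + (n - 1)) mod n = (j + (n - 1)) mod n" by (metis mod_add_left_eq)
  qed
  finally show ?thesis .
qed

lemma vt_in: "n > 0 \<Longrightarrow> vt n i \<in> {1..n}"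
  by (simp add: vt_def Suc_leI)

lemma vt_id: "a \<in> {1..n} \<Longrightarrow> vt n a = a"
proof -
  assume a: "a \<in> {1..n}"
  then obtain b where b: "a = Suc b" "b < n" by (cases a) auto
  then show ?thesis by (simp add: vt_def)
qed

lemma vt_add_cong: "n > 0 \<Longrightarrow> vt n i = vt n j \<Longrightarrow> vt n (i + l) = vt n (j + l)"
  by (metis mod_add_left_eq vt_eq_iff)

lemma vt_add_cancel: "n > 0 \<Longrightarrow> vt n (i + l) = vt n (j + l) \<longleftrightarrow> vt n i = vt n j"
proof
  assume n: "n > 0" and "vt n (i + l) = vt n (j + l)"
  \<comment> \<open>Subtracting \<open>l\<close> is done by adding \<open>(n - 1) * l\<close>:
    together with \<open>l\<close> this is the multiple \<open>n * l\<close> of the period.\<close>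
  then have "vt n (i + l + (n - 1) * l) = vt n (j + l + (n - 1) * l)"
    by (rule vt_add_cong)
  moreover have "i + l + (n - 1) * l = i + n * l" for i using n by (cases n) auto
  ultimately have "vt n (i + n * l) = vt n (j + n * l)" by metis
  then show "vt n i = vt n j" using n by (simp add: vt_eq_iff)
next
  assume "n > 0" "vt n i = vt n j"
  then show "vt n (i + l) = vt n (j + l)" by (rule vt_add_cong)
qed

lemma vt_add_mult [simp]: "n > 0 \<Longrightarrow> vt n (i + k * n) = vt n i"
  by (simp add: vt_eq_iff)

lemma vt_vt [simp]: "n > 0 \<Longrightarrow> vt n (vt n i) = vt n i"
  using vt_id vt_in by blast

lemma vt_vt_add [simp]: "n > 0 \<Longrightarrow> vt n (vt n i + l) = vt n (i + l)"
  by (rule vt_add_cong) auto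

lemma vt_Suc_vt [simp]: "n > 0 \<Longrightarrow> vt n (Suc (vt n i)) = vt n (Suc i)"
  using vt_vt_add[of n i 1] by simp

lemma cyc_succ_vt: "n > 0 \<Longrightarrow> cyc_succ {1..n} (vt n i) = vt n (Suc i)"
proof -
  assume n: "n > 0"
  have v: "vt n i \<in> {1..n}" using n by (rule vt_in)
  then have "cyc_succ {1..n} (vt n i) = (if vt n i < n then vt n i + 1 else 1)"
    by (intro cyc_succ_interval) auto
  also have "\<dots> = vt n (Suc (vt n i))"
  proof (cases "vt n i < n")
    case True
    then show ?thesis using vt_id[of "Suc (vt n i)" n] by simp
  next
    case False
    then have "vt n i = n" using v by simp
    then show ?thesis using n by (simp add: vt_def)
  qed
  finally show ?thesis using n by simp
qed

lemma cyc_succ_funpow_vt: "n > 0 \<Longrightarrow> (cyc_succ {1..n} ^^ l) (vt n i) = vt n (i + l)"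
proof (induction l)
  case (Suc l)
  then show ?case using cyc_succ_vt[of n "i + l"] by simp
qed simp

lemma path_end_eq: "n > 0 \<Longrightarrow> fst p \<in> {1..n} \<Longrightarrow> path_end n p = vt n (fst p + snd p)"
  using cyc_succ_funpow_vt[of n "snd p" "fst p"] by (simp add: path_end_def vt_id)

section \<open>The ideal generated by a set of paths\<close>

lemma path_mult_single:
  "path_mult n (Poly_Mapping.single p c) (Poly_Mapping.single q d :: path \<Rightarrow>\<^sub>0 'k::field) =
     (if path_end n p = fst q then Poly_Mapping.single (fst p, snd p + snd q) (c * d) else 0)"
  by (cases "c = 0"; cases "d = 0") (auto simp: path_mult_def)

lemma keys_path_mult:
  "supp (path_mult n x (y :: path \<Rightarrow>\<^sub>0 'k::field)) \<subseteq>
     {(fst p, snd p + snd q) | p q. p \<in> supp x \<and> q \<in> supp y \<and> path_end n p = fst q}"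
  (is "_ \<subseteq> ?K")
proof -
  have "path_mult n x y \<in> {z. supp z \<subseteq> ?K}"
    unfolding path_mult_def
  proof (intro pm.subspace_sum[OF subspace_keys_subset])
    fix p q assume "p \<in> supp x" "q \<in> supp y"
    then show "(if path_end n p = fst q
        then Poly_Mapping.single (fst p, snd p + snd q) (lkp x p * lkp y q) else 0)
      \<in> {z. supp z \<subseteq> ?K}" by (force split: if_splits)
  qed
  then show ?thesis by simp
qed

text \<open>Divisibility of \<open>p\<close> by a relation, where \<open>i\<close> is the length of
  the piece in front of it.\<close>

definition contains_path :: "nat \<Rightarrow> path set \<Rightarrow> path \<Rightarrow> bool" where
  "contains_path n R p \<longleftrightarrow> (\<exists>(t, k)\<in>R. \<exists>i. i + k \<le> snd p \<and> vt n (fst p + i) = t)"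

lemma contains_path_ext_right:
  "contains_path n R (s, l) \<Longrightarrow> l \<le> l' \<Longrightarrow> contains_path n R (s, l')"
proof -
  assume "contains_path n R (s, l)" and l: "l \<le> l'"
  then obtain t k i where "(t, k) \<in> R" "i + k \<le> l" "vt n (s + i) = t"
    by (auto simp: contains_path_def)
  then show ?thesis using l unfolding contains_path_def
    by (intro bexI[of _ "(t, k)"]) (auto intro!: exI[of _ i])
qed

lemma contains_path_ext_left:
  assumes n: "n > 0" and "contains_path n R (vt n (s + i), l)"
  shows "contains_path n R (s, i + l)"
proof -
  obtain t k j where *: "(t, k) \<in> R" "j + k \<le> l" "vt n (vt n (s + i) + j) = t"
    using assms(2) by (auto simp: contains_path_def)
  then have "vt n (s + (i + j)) = t" using n by (simp add: add.assoc)
  then show ?thesis using * unfolding contains_path_def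
    by (intro bexI[of _ "(t, k)"]) (auto intro!: exI[of _ "i + j"])
qed

definition monomial_ideal :: "nat \<Rightarrow> path set \<Rightarrow> (path \<Rightarrow>\<^sub>0 'k::field) set" where
  "monomial_ideal n R = {x. supp x \<subseteq> {p. fst p \<in> {1..n} \<and> contains_path n R p}}"

lemma path_algebra_keys: "path_algebra n = {x. supp x \<subseteq> {p. fst p \<in> {1..n}}}"
  by (auto simp: path_algebra_def)

lemma path_alg_ideal_monomial_ideal:
  assumes n: "n > 0"
  shows "path_alg_ideal n (monomial_ideal n R :: (path \<Rightarrow>\<^sub>0 'k::field) set)"
  unfolding path_alg_ideal_def
proof (intro conjI ballI)
  show "pm.subspace (monomial_ideal n R :: (path \<Rightarrow>\<^sub>0 'k) set)"
    unfolding monomial_ideal_def by (rule subspace_keys_subset)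
  show "(monomial_ideal n R :: (path \<Rightarrow>\<^sub>0 'k) set) \<subseteq> path_algebra n"
    by (auto simp: monomial_ideal_def path_algebra_keys)
  fix x y :: "path \<Rightarrow>\<^sub>0 'k" assume x: "x \<in> monomial_ideal n R" and y: "y \<in> path_algebra n"
  have 1: "contains_path n R (fst p, snd p + snd q)" if "contains_path n R p" for p q
    using contains_path_ext_right[of n R "fst p" "snd p"] that by auto
  have 2: "contains_path n R (fst p, snd p + snd q)"
    if "contains_path n R q" "fst p \<in> {1..n}" "path_end n p = fst q" for p q
    using contains_path_ext_left[OF n, of R "fst p" "snd p" "snd q"] that n path_end_eq[of n p]
    by (metis prod.collapse)
  have xR: "fst q \<in> {1..n}" "contains_path n R q" if "q \<in> supp x" for q
    using x that unfolding monomial_ideal_def by blast+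
  have yV: "fst q \<in> {1..n}" if "q \<in> supp y" for q
    using y that unfolding path_algebra_keys by blast
  have 3: "contains_path n R (fst p, snd p + l)" if "p \<in> supp y" "(path_end n p, l) \<in> supp x" for p l
    using 2[OF xR(2)[OF that(2)] yV[OF that(1)]] by simp
  show "path_mult n x y \<in> monomial_ideal n R"
    unfolding monomial_ideal_def mem_Collect_eq
    using keys_path_mult[of n x y] xR 1 by (elim subset_trans) auto
  show "path_mult n y x \<in> monomial_ideal n R"
    unfolding monomial_ideal_def mem_Collect_eq
    using keys_path_mult[of n y x] yV 3 by (elim subset_trans) auto
qed

text \<open>A two-sided ideal is closed under composing a relation with paths on either side, and
  the span of all paths obtained in this way is already an ideal, so nothing else is
  generated.\<close>

lemma ideal_generated_by_paths:
  assumes n: "n > 0" and R: "R \<subseteq> {(s, l). s \<in> {1..n} \<and> l \<ge> 1}"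
  shows "(ideal_generated_by n R :: (path \<Rightarrow>\<^sub>0 'k::field) set) = monomial_ideal n R"
proof
  have "sng ` R \<subseteq> (monomial_ideal n R :: (path \<Rightarrow>\<^sub>0 'k) set)"
  proof clarify
    fix t k assume tk: "(t, k) \<in> R"
    then have "contains_path n R (t, k)" using R vt_id
      unfolding contains_path_def by (intro bexI[of _ "(t, k)"]) (auto intro!: exI[of _ 0])
    then show "sng (t, k) \<in> (monomial_ideal n R :: (path \<Rightarrow>\<^sub>0 'k) set)"
      using tk R by (auto simp: monomial_ideal_def)
  qed
  then show "ideal_generated_by n R \<subseteq> (monomial_ideal n R :: (path \<Rightarrow>\<^sub>0 'k) set)"
    using path_alg_ideal_monomial_ideal[OF n] unfolding ideal_generated_by_def by blast
  show "monomial_ideal n R \<subseteq> (ideal_generated_by n R :: (path \<Rightarrow>\<^sub>0 'k) set)"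
    unfolding ideal_generated_by_def
  proof (intro Inter_greatest subsetI, clarify)
    fix I and x :: "path \<Rightarrow>\<^sub>0 'k"
    assume I: "path_alg_ideal n I" "sng ` R \<subseteq> (I :: (path \<Rightarrow>\<^sub>0 'k) set)" and x: "x \<in> monomial_ideal n R"
    have single_in: "Poly_Mapping.single p c \<in> I" if p: "fst p \<in> {1..n}" "contains_path n R p" for p c
    proof -
      obtain t k i where tk: "(t, k) \<in> R" "i + k \<le> snd p" "vt n (fst p + i) = t"
        using p by (auto simp: contains_path_def)
      \<comment> \<open>The path is cut into a piece of length \<open>i\<close>, the relation
        \<open>(t, k)\<close> and a rest; the scalar \<open>c\<close> travels with the first
        piece.\<close>
      let ?y = "Poly_Mapping.single (fst p, i) c :: path \<Rightarrow>\<^sub>0 'k"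
      let ?z = "sng (vt n (t + k), snd p - i - k) :: path \<Rightarrow>\<^sub>0 'k"
      have t: "t \<in> {1..n}" using tk R by auto
      have yz: "?y \<in> path_algebra n" "?z \<in> path_algebra n"
        using p vt_in[OF n] by (auto simp: path_algebra_keys)
      have "path_mult n (sng (t, k)) ?z \<in> I"
        using I tk yz unfolding path_alg_ideal_def by blast
      then have "sng (t, snd p - i) \<in> I"
        using tk t path_end_eq[OF n, of "(t, k)"] by (simp add: path_mult_single)
      then have "path_mult n ?y (sng (t, snd p - i)) \<in> I"
        using I yz unfolding path_alg_ideal_def by blast
      moreover have "path_end n (fst p, i) = t"
        using path_end_eq[OF n, of "(fst p, i)"] p(1) tk(3) by simp
      moreover have "i + (snd p - i) = snd p" using tk(2) by linarith
      ultimately show ?thesis by (simp only: path_mult_single fst_conv snd_conv if_True mult_1_right prod.collapse refl)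
    qed
    have "fst p \<in> {1..n} \<and> contains_path n R p" if "p \<in> supp x" for p
      using x that by (auto simp: monomial_ideal_def)
    then have "\<And>p. p \<in> supp x \<Longrightarrow> sng p \<in> I" using single_in by simp
    with I(1)[unfolded path_alg_ideal_def, THEN conjunct1] show "x \<in> I"
      by (rule subspace_contains_keys)
  qed
qed

section \<open>A basis of a Nakayama algebra\<close>

text \<open>Vertices are lifted along \<^term>\<open>vt n\<close>: for \<open>i :: nat\<close>, \<open>u i l\<close> is the image of the path of length \<open>l\<close>
  starting at \<open>vt n i\<close>, and \<open>p i\<close> is the dimension of the projective module at \<open>vt n i\<close>.\<close>

locale nakayama = vs: vector_space "smul A"
  for A :: "('k::field, 'a::ring) vertex_algebra" +
  fixes n :: nat and u :: "nat \<Rightarrow> nat \<Rightarrow> 'a" and p :: "nat \<Rightarrow> nat"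
  assumes n_pos [simp]: "n > 0"
    and vert_A: "vert A = {1..n}"
    and smul_mult_left: "smul A c x * y = smul A c (x * y)"
    and smul_mult_right: "x * smul A c y = smul A c (x * y)"
    and u_vt [simp]: "u (vt n i) l = u i l"
    and p_vt [simp]: "p (vt n i) = p i"
    and p_pos: "p i > 0"
    and p_Suc: "p i \<le> Suc (p (Suc i))"
    and idem_A: "a \<in> {1..n} \<Longrightarrow> idem A a = u a 0"
    and u_mult: "u i l * u j k = (if vt n (i + l) = vt n j then u i (l + k) else 0)"
    and u_zero: "p i \<le> l \<Longrightarrow> u i l = 0"
    and inj_u: "inj_on (\<lambda>(s, l). u s l) {(s, l). s \<in> {1..n} \<and> l < p s}"
    and indep_u: "vs.independent ((\<lambda>(s, l). u s l) ` {(s, l). s \<in> {1..n} \<and> l < p s})"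
    and elems_A: "elems A = vs.span ((\<lambda>(s, l). u s l) ` {(s, l). s \<in> {1..n} \<and> l < p s})"

text \<open>Paths without relations form a basis of the quotient, since the kernel is spanned by the
  others. Take \<open>p i\<close> as the least length at which paths from \<open>vt n i\<close>
  become zero. Then \<open>p_pos\<close> holds because relations are nontrivial, and
  \<open>p_Suc\<close> because a vanishing path stays zero when an arrow is put in front of
  it.\<close>

lemma nakayama_algebra_imp_nakayama:
  fixes A :: "('k::field, 'a::ring) vertex_algebra"
  assumes A: "nakayama_algebra n A"
  obtains u p where "nakayama A n u p"
proof -
  have n: "n > 0" and vert: "vert A = {1..n}" and vsA: "vector_space (smul A)"
    and "\<forall>c x y. smul A c (x * y) = smul A c x * y \<and> smul A c (x * y) = x * smul A c y"
    using A[unfolded nakayama_algebra_def] by (elim conjE, simp)+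
  then have sm: "smul A c x * y = smul A c (x * y)" "x * smul A c y = smul A c (x * y)" for c x y
    by metis+
  obtain B0 where B0: "finite B0" "elems A \<subseteq> module.span (smul A) B0"
    using A by (auto simp: nakayama_algebra_def)
  obtain R \<phi> where H: "R \<subseteq> {(s, l). s \<in> {1..n} \<and> l \<ge> 1} \<and> Vector_Spaces.linear scale_pm (smul A) \<phi> \<and>
      (\<forall>x\<in>path_algebra n. \<forall>y\<in>path_algebra n. \<phi> (path_mult n x y) = \<phi> x * \<phi> y) \<and>
      (\<forall>a\<in>{1..n}. \<phi> (sng (a, 0)) = idem A a) \<and> \<phi> ` path_algebra n = elems A \<and>
      {x\<in>path_algebra n. \<phi> x = 0} = ideal_generated_by n R"
    using A[unfolded nakayama_algebra_def] by (elim conjE exE, intro that conjI) assumption+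
  then have R: "R \<subseteq> {(s, l). s \<in> {1..n} \<and> l \<ge> 1}"
    and lin: "Vector_Spaces.linear scale_pm (smul A) \<phi>"
    and mult: "\<And>x y. x \<in> path_algebra n \<Longrightarrow> y \<in> path_algebra n \<Longrightarrow> \<phi> (path_mult n x y) = \<phi> x * \<phi> y"
    and idem: "\<And>a. a \<in> {1..n} \<Longrightarrow> \<phi> (Poly_Mapping.single (a, 0) 1) = idem A a"
    and onto: "\<phi> ` path_algebra n = elems A"
    and ker: "{x\<in>path_algebra n. \<phi> x = 0} = ideal_generated_by n R"
    by (elim conjE, simp)+
  interpret vs: vector_space "smul A" by (rule vsA)
  interpret \<phi>: Vector_Spaces.linear scale_pm "smul A" \<phi> by (rule lin)
  define V where "V = {p :: path. fst p \<in> {1..n}}"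
  define good where "good = {p \<in> V. \<not> contains_path n R p}"
  define b where "b = (\<lambda>p :: path. \<phi> (sng p))"
  have PA: "path_algebra n = pm.span (sng ` V :: (path \<Rightarrow>\<^sub>0 'k) set)"
    by (simp add: V_def path_algebra_keys flip: keys_subset_eq_span)
  have PAk: "x \<in> path_algebra n \<longleftrightarrow> supp x \<subseteq> V" for x :: "path \<Rightarrow>\<^sub>0 'k"
    by (simp add: V_def path_algebra_keys)
  have ker': "\<phi> x = 0 \<longleftrightarrow> (\<forall>q\<in>supp x. contains_path n R q)" if "supp x \<subseteq> V" for x
  proof -
    have "\<phi> x = 0 \<longleftrightarrow> x \<in> monomial_ideal n R"
      using ker that PAk[of x] ideal_generated_by_paths[OF n R, where 'k='k] by blast
    also have "\<dots> \<longleftrightarrow> (\<forall>q\<in>supp x. contains_path n R q)"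
      using that by (auto simp: monomial_ideal_def V_def)
    finally show ?thesis .
  qed
  have b0: "b q = 0 \<longleftrightarrow> contains_path n R q" if "q \<in> V" for q
    using ker'[of "sng q"] that by (simp add: b_def)
  have inj: "inj_on b good"
  proof (rule inj_onI, rule ccontr)
    fix q r assume qr: "q \<in> good" "r \<in> good" "b q = b r" "q \<noteq> r"
    have k: "supp (sng q - sng r :: path \<Rightarrow>\<^sub>0 'k) = {q, r}"
      using qr(4) by (auto simp: in_keys_iff lookup_minus lookup_single when_def split: if_splits)
    have "\<phi> (sng q - sng r) = 0" using qr(3) by (simp add: b_def \<phi>.diff)
    then show False using ker'[of "sng q - sng r"] k qr by (auto simp: good_def)
  qed
  have indep: "vs.independent (b ` good)"
  proof (subst vs.independent_explicit_finite_subsets, intro allI impI ballI)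
    fix S c v assume S: "S \<subseteq> b ` good" "finite S" and 0: "(\<Sum>v\<in>S. smul A (c v) v) = 0" and v: "v \<in> S"
    define Q where "Q = {q \<in> good. b q \<in> S}"
    have bQ: "b ` Q = S" using S by (auto simp: Q_def)
    have injQ: "inj_on b Q" using inj by (rule inj_on_subset) (auto simp: Q_def)
    have finQ: "finite Q" using bQ injQ S(2) finite_imageD by blast
    obtain q where q: "q \<in> Q" "v = b q" using v bQ by auto
    define x where "x = (\<Sum>q\<in>Q. scale_pm (c (b q)) (sng q))"
    have lk: "lkp x r = (if r \<in> Q then c (b r) else 0)" for r
    proof -
      have "lkp x r = (\<Sum>q\<in>Q. if q = r then c (b r) else 0)"
        unfolding x_def by (auto simp: lookup_sum lookup_single when_def intro!: sum.cong)
      then show ?thesis using finQ by simp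
    qed
    have "\<phi> x = (\<Sum>q\<in>Q. smul A (c (b q)) (b q))"
      unfolding x_def \<phi>.sum \<phi>.scale b_def ..
    also have "\<dots> = (\<Sum>v\<in>S. smul A (c v) v)"
      unfolding bQ[symmetric] using injQ by (simp add: sum.reindex)
    finally have "\<phi> x = 0" using 0 by simp
    moreover have kx: "supp x \<subseteq> Q" by (auto simp: in_keys_iff lk split: if_splits)
    moreover have QV: "Q \<subseteq> V" by (auto simp: Q_def good_def)
    ultimately have "\<forall>q\<in>supp x. contains_path n R q" using ker'[of x] by blast
    moreover have "\<not> contains_path n R q" using q by (auto simp: Q_def good_def)
    ultimately have "lkp x q = 0" by (auto simp: in_keys_iff)
    then show "c v = 0" using q by (simp add: lk)
  qed
  have span_good: "elems A = vs.span (b ` good)"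
  proof -
    have "elems A = vs.span (b ` V)"
      unfolding onto[symmetric] PA b_def \<phi>.span_image[symmetric] by (simp add: image_image)
    \<comment> \<open>Paths that contain a relation have image zero, so removing zero makes the two
      generating sets equal.\<close>
    also have "\<dots> = vs.span (b ` V - {0})" by simp
    also have "b ` V - {0} = b ` good - {0}" using b0 by (auto simp: good_def)
    finally show ?thesis by simp
  qed
  have "finite good"
  proof -
    have "b ` good \<subseteq> vs.span B0" using B0 span_good vs.span_superset by blast
    then have "finite (b ` good)" using vs.independent_span_bound[OF B0(1) indep] by blast
    then show ?thesis using inj finite_imageD by blast
  qed
  \<comment> \<open>Finite dimension enters here: a vertex from which no path ever contains a
    relation would start infinitely many independent paths.\<close>
  have ex: "\<exists>l. contains_path n R (vt n i, l)" for i
  proof (rule ccontr)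
    assume *: "\<nexists>l. contains_path n R (vt n i, l)"
    have "range (\<lambda>l. (vt n i, l)) \<subseteq> good" using * vt_in[OF n] by (auto simp: good_def V_def)
    then have "finite (range (\<lambda>l::nat. (vt n i, l)))" using \<open>finite good\<close> finite_subset by blast
    then show False using finite_imageD[of "\<lambda>l::nat. (vt n i, l)" UNIV] by (auto simp: inj_on_def)
  qed
  define p where "p i = (LEAST l. contains_path n R (vt n i, l))" for i
  define u where "u i l = b (vt n i, l)" for i l
  have p_iff: "contains_path n R (vt n i, l) \<longleftrightarrow> p i \<le> l" for i l
  proof
    assume "p i \<le> l"
    moreover have "contains_path n R (vt n i, p i)" unfolding p_def using ex by (rule LeastI_ex)
    ultimately show "contains_path n R (vt n i, l)" using contains_path_ext_right by blast
  qed (auto simp: p_def intro: Least_le)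
  have u0: "u i l = 0 \<longleftrightarrow> p i \<le> l" for i l
    using b0[of "(vt n i, l)"] vt_in[OF n] by (simp add: u_def V_def p_iff)
  have good_eq: "good = {(s, l). s \<in> {1..n} \<and> l < p s}"
  proof -
    have "contains_path n R (s, l) \<longleftrightarrow> p s \<le> l" if "s \<in> {1..n}" for s l
      using p_iff[of s l] that by (simp only: vt_id)
    then show ?thesis by (auto simp: good_def V_def not_le)
  qed
  have b_u: "b q = (\<lambda>(s, l). u s l) q" if "q \<in> good" for q
    using that vt_id[of "fst q" n] by (auto simp: u_def good_def V_def split: prod.splits)
  have b_img: "b ` good = (\<lambda>(s, l). u s l) ` good" using b_u by (rule image_cong[OF refl])
  have "nakayama A n u p"
  proof (unfold_locales)
    show "u i l * u j k = (if vt n (i + l) = vt n j then u i (l + k) else 0)" for i l j k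
    proof -
      have "u i l * u j k = \<phi> (path_mult n (sng (vt n i, l)) (sng (vt n j, k)))"
        unfolding u_def b_def using vt_in[OF n] by (subst mult) (auto simp: PAk V_def)
      also have "path_end n (vt n i, l) = vt n (i + l)"
        using path_end_eq[OF n, of "(vt n i, l)"] vt_in[OF n] n by simp
      then have "path_mult n (sng (vt n i, l)) (sng (vt n j, k)) =
        (if vt n (i + l) = vt n j then sng (vt n i, l + k) else (0 :: path \<Rightarrow>\<^sub>0 'k))"
        by (simp add: path_mult_single)
      finally show ?thesis by (simp add: u_def b_def \<phi>.zero)
    qed
    show "p i \<le> Suc (p (Suc i))" for i
    proof -
      have "contains_path n R (vt n (vt n i + 1), p (Suc i))" using p_iff[of "Suc i"] n by simp
      then have "contains_path n R (vt n i, 1 + p (Suc i))" by (rule contains_path_ext_left[OF n])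
      then show ?thesis by (simp add: p_iff)
    qed
    show "p i > 0" for i
    proof (rule ccontr)
      assume "\<not> 0 < p i"
      then have "contains_path n R (vt n i, 0)" by (simp add: p_iff)
      then show False using R by (auto simp: contains_path_def)
    qed
    show "inj_on (\<lambda>(s, l). u s l) {(s, l). s \<in> {1..n} \<and> l < p s}"
      using inj inj_on_cong[of good b "\<lambda>(s, l). u s l"] b_u good_eq by simp
    show "vs.independent ((\<lambda>(s, l). u s l) ` {(s, l). s \<in> {1..n} \<and> l < p s})"
      using indep b_img good_eq by simp
    show "elems A = vs.span ((\<lambda>(s, l). u s l) ` {(s, l). s \<in> {1..n} \<and> l < p s})"
      using span_good b_img good_eq by simp
    show "idem A a = u a 0" if "a \<in> {1..n}" for a
      using idem[OF that] vt_id[OF that] by (simp add: u_def b_def)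
    show "p i \<le> l \<Longrightarrow> u i l = 0" for i l by (simp add: u0)
  qed (use n vert sm in \<open>simp_all add: u_def p_def\<close>)
  then show ?thesis by (rule that)
qed

context nakayama
begin

lemma p_eq: "vt n i = vt n j \<Longrightarrow> p i = p j"
  by (metis p_vt)

lemma u_eq: "vt n i = vt n j \<Longrightarrow> u i l = u j l"
  by (metis u_vt)

definition f :: "nat \<Rightarrow> nat" where "f i = i + p i"

lemma f_gt: "i < f i"
  using p_pos by (simp add: f_def)

text \<open>Monotonicity of the lift is the inequality \<open>p_Suc\<close>, which expresses that
  the radical of the projective module at \<open>i\<close> is an epimorphic image of the one at
  \<open>Suc i\<close>.\<close>

lemma f_mono: "i \<le> j \<Longrightarrow> f i \<le> f j"
proof (induction j rule: dec_induct)
  case (step m)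
  then show ?case using p_Suc[of m] by (simp add: f_def)
qed simp

lemma f_add_mult: "f (i + k * n) = f i + k * n"
  by (simp add: f_def p_eq[of "i + k * n" i])

section \<open>Corner algebras\<close>

definition basis :: "nat set \<Rightarrow> 'a set" where
  "basis V = {u s l | s l. s \<in> V \<and> l < p s \<and> vt n (s + l) \<in> V}"

abbreviation Sp :: "nat set \<Rightarrow> 'a set" where "Sp V \<equiv> vs.span (basis V)"

text \<open>The corner algebra spanned by the paths with both ends in \<open>V\<close>. Paths keep
  their length in \<open>A\<close>, so that iterated corners are all described by the same
  \<open>u\<close> and \<open>p\<close>.\<close>

definition cor :: "nat set \<Rightarrow> ('k, 'a) vertex_algebra" where
  "cor V = A\<lparr>elems := Sp V, vert := V\<rparr>"

lemma cor_simps [simp]: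
  "smul (cor V) = smul A" "elems (cor V) = Sp V" "vert (cor V) = V" "idem (cor V) = idem A"
  by (simp_all add: cor_def)

lemma basis_full: "basis {1..n} = (\<lambda>(s, l). u s l) ` {(s, l). s \<in> {1..n} \<and> l < p s}"
proof -
  have "vt n i \<in> {1..n}" for i by (rule vt_in) simp
  then show ?thesis unfolding basis_def by (auto simp del: atLeastAtMost_iff)
qed

lemma elems_A_basis: "elems A = Sp {1..n}"
  by (simp only: basis_full elems_A)

lemma cor_full: "cor {1..n} = A"
  unfolding cor_def using vert_A elems_A_basis by (cases A) (simp del: One_nat_def)

lemma basis_mono: "V \<subseteq> W \<Longrightarrow> basis V \<subseteq> basis W"
  by (auto simp: basis_def)

lemma span_basis_mono: "V \<subseteq> W \<Longrightarrow> Sp V \<subseteq> Sp W"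
  by (intro vs.span_mono basis_mono)

lemma u_in_basis: "vt n s \<in> V \<Longrightarrow> l < p s \<Longrightarrow> vt n (s + l) \<in> V \<Longrightarrow> u s l \<in> basis V"
  unfolding basis_def by (rule CollectI, rule exI[of _ "vt n s"], rule exI[of _ l]) simp

lemma u_in_span: "vt n s \<in> V \<Longrightarrow> vt n (s + l) \<in> V \<Longrightarrow> u s l \<in> Sp V"
  by (cases "l < p s") (auto simp: u_zero vs.span_zero intro!: vs.span_base u_in_basis)

lemma u_in_elems: "u s l \<in> elems A"
  unfolding elems_A_basis by (rule u_in_span; rule vt_in) simp_all

lemma basis_induct [consumes 1, case_names zero base add smul]:
  assumes "x \<in> Sp V"
    and "P 0"
    and "\<And>s l. s \<in> V \<Longrightarrow> l < p s \<Longrightarrow> vt n (s + l) \<in> V \<Longrightarrow> P (u s l)"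
    and "\<And>x y. x \<in> Sp V \<Longrightarrow> y \<in> Sp V \<Longrightarrow> P x \<Longrightarrow> P y \<Longrightarrow> P (x + y)"
    and "\<And>c x. x \<in> Sp V \<Longrightarrow> P x \<Longrightarrow> P (smul A c x)"
  shows "P x"
proof -
  have "x \<in> Sp V \<and> P x"
    using assms(1)
  proof (induction rule: vs.span_induct_alt)
    case base
    then show ?case using assms(2) by (simp add: vs.span_zero)
  next
    case (step c x y)
    then obtain s l where x: "x = u s l" "s \<in> V" "l < p s" "vt n (s + l) \<in> V" by (auto simp: basis_def)
    have "x \<in> Sp V" using step by (intro vs.span_base) auto
    moreover have "P x" using x assms(3) by simp
    ultimately show ?case using step assms(4,5) by (simp add: vs.span_add vs.span_scale)
  qed
  then show ?thesis ..
qed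

lemma span_basis_mult:
  assumes V: "V \<subseteq> {1..n}" and "x \<in> Sp V" "y \<in> Sp V"
  shows "x * y \<in> Sp V"
  using assms(2)
proof (induction rule: basis_induct)
  case (base s l)
  show ?case using assms(3)
  proof (induction rule: basis_induct)
    case (base t k)
    have "vt n s = s" "vt n t = t" using base \<open>s \<in> V\<close> V vt_id by blast+
    show ?case
    proof (cases "vt n (s + l) = vt n t")
      case True
      then have "vt n (s + (l + k)) = vt n (t + k)"
        using vt_add_cong[OF n_pos True, of k] by (simp add: add.assoc)
      then have "u s (l + k) \<in> Sp V"
        using base \<open>s \<in> V\<close> \<open>vt n s = s\<close> by (intro u_in_span) simp_all
      then show ?thesis using True by (simp add: u_mult)
    qed (simp add: u_mult vs.span_zero)
  qed (simp_all add: vs.span_zero distrib_left vs.span_add smul_mult_right vs.span_scale)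
qed (simp_all add: vs.span_zero distrib_right vs.span_add smul_mult_left vs.span_scale)

lemma elems_mult: "x \<in> elems A \<Longrightarrow> y \<in> elems A \<Longrightarrow> x * y \<in> elems A"
  using span_basis_mult[of "{1..n}"] by (simp only: elems_A_basis)

section \<open>Coefficients\<close>

text \<open>The coordinate of \<open>w\<close> at the path \<open>u i l\<close>. The starting point
  is a lift, and the value depends only on its residue class; for \<open>l \<ge> p i\<close>, where
  the path vanishes, it is 0.\<close>

definition cf :: "'a \<Rightarrow> nat \<Rightarrow> nat \<Rightarrow> 'k" where
  "cf w i l = (if l < p i then vs.representation (basis {1..n}) w (u i l) else 0)"

lemma indep_basis: "vs.independent (basis {1..n})"
  using indep_u unfolding basis_full .

lemma cf_vt: "vt n i = vt n j \<Longrightarrow> cf w i l = cf w j l"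
  using p_eq[of i j] u_eq[of i j l] by (simp add: cf_def)

lemma cf_add: "x \<in> elems A \<Longrightarrow> y \<in> elems A \<Longrightarrow> cf (x + y) i l = cf x i l + cf y i l"
  unfolding elems_A_basis by (simp add: cf_def vs.representation_add[OF indep_basis] del: One_nat_def)

lemma cf_smul: "x \<in> elems A \<Longrightarrow> cf (smul A c x) i l = c * cf x i l"
  unfolding elems_A_basis by (simp add: cf_def vs.representation_scale[OF indep_basis] del: One_nat_def)

lemma cf_zero [simp]: "cf 0 i l = 0"
  by (simp add: cf_def vs.representation_zero)

lemma u_inj:
  assumes "u s l = u t k" "l < p s" "k < p t"
  shows "vt n s = vt n t \<and> l = k"
proof -
  have "(vt n s, l) = (vt n t, k)"
    by (rule inj_onD[OF inj_u]) (use assms vt_in[OF n_pos] in auto)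
  then show ?thesis by simp
qed

lemma cf_u: "cf (u s l) i k = (if vt n i = vt n s \<and> l = k \<and> l < p s then 1 else 0)"
proof (cases "l < p s")
  case True
  then have "u s l \<in> basis {1..n}" by (intro u_in_basis vt_in) simp_all
  then have "vs.representation (basis {1..n}) (u s l) = (\<lambda>v. if v = u s l then 1 else 0)"
    by (rule vs.representation_basis[OF indep_basis])
  moreover have "k < p i \<Longrightarrow> u i k = u s l \<longleftrightarrow> vt n i = vt n s \<and> l = k"
    using True u_inj[of i k s l] u_eq[of i s l] by auto
  ultimately show ?thesis using True p_eq[of i s] by (auto simp: cf_def)
qed (simp add: u_zero)

lemma expand_cf:
  assumes "w \<in> elems A"
  shows "w = (\<Sum>s\<in>{1..n}. \<Sum>l<p s. smul A (cf w s l) (u s l))"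
proof -
  have fin: "finite {1..n}" by simp
  show ?thesis
    using assms unfolding elems_A_basis
  proof (induction rule: basis_induct)
    case (base t k)
    have 1: "cf (u t k) s l = (if s = t \<and> l = k then 1 else 0)" if "s \<in> {1..n}" for s l
      using that base(1,2) by (simp only: cf_u vt_id) auto
    have "(\<Sum>s\<in>{1..n}. \<Sum>l<p s. smul A (cf (u t k) s l) (u s l)) =
        (\<Sum>s\<in>{1..n}. \<Sum>l<p s. if s = t \<and> l = k then u t k else 0)"
      by (intro sum.cong refl) (use 1 in auto)
    also have "\<dots> = (\<Sum>s\<in>{1..n}. if s = t then u t k else 0)"
      by (intro sum.cong refl) (use base(2) in auto)
    also have "\<dots> = u t k" using base(1) by (simp only: sum.delta[OF fin] if_True)
    finally show ?case ..
  next
    case (add x y)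
    then have "x \<in> elems A" "y \<in> elems A" by (simp_all only: elems_A_basis)
    then have "(\<Sum>s\<in>{1..n}. \<Sum>l<p s. smul A (cf (x + y) s l) (u s l)) =
       (\<Sum>s\<in>{1..n}. \<Sum>l<p s. smul A (cf x s l) (u s l)) + (\<Sum>s\<in>{1..n}. \<Sum>l<p s. smul A (cf y s l) (u s l))"
      by (simp only: cf_add vs.scale_left_distrib sum.distrib)
    then show ?case using add.IH by (simp only:)
  next
    case (smul c x)
    then have "x \<in> elems A" by (simp only: elems_A_basis)
    then have "(\<Sum>s\<in>{1..n}. \<Sum>l<p s. smul A (cf (smul A c x) s l) (u s l)) =
       smul A c (\<Sum>s\<in>{1..n}. \<Sum>l<p s. smul A (cf x s l) (u s l))"
      by (simp only: cf_smul vs.scale_sum_right vs.scale_scale)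
    then show ?case using smul.IH by (simp only:)
  qed simp
qed

section \<open>Interval modules\<close>

text \<open>A row vector times an upper triangular matrix, with columns cut off at \<open>y\<close>:
  the path \<open>u i l\<close> moves position \<open>i\<close> to \<open>i + l\<close>. Since
  positions only move up, the lower end of an interval appears in the carrier alone.\<close>

definition act :: "nat \<Rightarrow> 'k uvec \<Rightarrow> 'a \<Rightarrow> 'k uvec" where
  "act y v w = Abs_poly_mapping (\<lambda>j. if j < y then \<Sum>i\<le>j. lkp v i * cf w i (j - i) else 0)"

lemma lookup_act: "lkp (act y v w) j = (if j < y then \<Sum>i\<le>j. lkp v i * cf w i (j - i) else 0)"
proof -
  have "finite {j. (if j < y then \<Sum>i\<le>j. lkp v i * cf w i (j - i) else 0) \<noteq> 0}"
    by (rule finite_subset[of _ "{..<y}"]) (auto split: if_splits)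
  then show ?thesis by (simp add: act_def)
qed

lemma act_add_left: "act y (v + v') w = act y v w + act y v' w"
  by (rule poly_mapping_eqI) (simp add: lookup_act lookup_add distrib_right sum.distrib)

lemma act_scale_left: "act y (scale_pm c v) w = scale_pm c (act y v w)"
  by (rule poly_mapping_eqI) (simp add: lookup_act lookup_scale_pm sum_distrib_left mult.assoc)

lemma act_add_right:
  "w \<in> elems A \<Longrightarrow> w' \<in> elems A \<Longrightarrow> act y v (w + w') = act y v w + act y v w'"
  by (rule poly_mapping_eqI) (simp add: lookup_act lookup_add cf_add distrib_left sum.distrib)

lemma act_scale_right: "w \<in> elems A \<Longrightarrow> act y v (smul A c w) = scale_pm c (act y v w)"
  by (rule poly_mapping_eqI) (simp add: lookup_act lookup_scale_pm cf_smul sum_distrib_left ac_simps)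

lemma act_zero [simp]: "act y 0 w = 0" "act y v 0 = 0"
  by (rule poly_mapping_eqI; simp add: lookup_act)+

lemma act_sum_right:
  "(\<And>x. x \<in> I \<Longrightarrow> g x \<in> elems A) \<Longrightarrow> act y v (\<Sum>x\<in>I. g x) = (\<Sum>x\<in>I. act y v (g x))"
proof (induction I rule: infinite_finite_induct)
  case (insert x F)
  then have "(\<Sum>x\<in>F. g x) \<in> elems A" unfolding elems_A_basis by (intro vs.span_sum) auto
  then show ?case using insert by (simp add: act_add_right)
qed simp_all

lemma lookup_act_u:
  "lkp (act y v (u s l)) j =
     (if l \<le> j \<and> j < y \<and> vt n (j - l) = vt n s \<and> l < p s then lkp v (j - l) else 0)"
proof -
  have "(\<Sum>i\<le>j. lkp v i * cf (u s l) i (j - i)) =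
      (\<Sum>i\<le>j. if i = j - l then (if l \<le> j \<and> vt n (j - l) = vt n s \<and> l < p s then lkp v (j - l) else 0) else 0)"
    by (intro sum.cong refl) (auto simp: cf_u)
  then show ?thesis by (simp add: lookup_act)
qed

lemma act_single_u:
  "act y (Poly_Mapping.single i c) (u i l) = (if i + l < y \<and> l < p i then Poly_Mapping.single (i + l) c else 0)"
  by (rule poly_mapping_eqI) (auto simp: lookup_act_u lookup_single when_def)

text \<open>An interval restricted to the positions over \<open>V\<close>, as a module over
  \<open>cor V\<close>. Intervals with the same upper end share their action, so tails of an
  interval are literally submodules of it.\<close>

definition Itv :: "nat set \<Rightarrow> nat \<Rightarrow> nat \<Rightarrow> ('k, 'a) rmod" where
  "Itv V x y = \<lparr>mcar = {v. supp v \<subseteq> {i \<in> {x..<y}. vt n i \<in> V}}, mact = act y\<rparr>"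

lemma mact_Itv [simp]: "mact (Itv V x y) = act y"
  by (simp add: Itv_def)

lemma mcar_Itv: "mcar (Itv V x y) = {v. supp v \<subseteq> {i \<in> {x..<y}. vt n i \<in> V}}"
  by (simp add: Itv_def)

lemma in_Itv_iff: "v \<in> mcar (Itv V x y) \<longleftrightarrow> (\<forall>i. lkp v i \<noteq> 0 \<longrightarrow> x \<le> i \<and> i < y \<and> vt n i \<in> V)"
  by (auto simp: mcar_Itv in_keys_iff)

lemma single_in_Itv: "x \<le> i \<Longrightarrow> i < y \<Longrightarrow> vt n i \<in> V \<Longrightarrow> Poly_Mapping.single i c \<in> mcar (Itv V x y)"
  by (auto simp: in_Itv_iff lookup_single when_def split: if_splits)

lemma subspace_Itv: "pm.subspace (mcar (Itv V x y))"
  unfolding mcar_Itv by (rule subspace_keys_subset)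

lemma act_u_closed:
  assumes "v \<in> mcar (Itv V x y)" "vt n (s + l) \<in> V"
  shows "act y v (u s l) \<in> mcar (Itv V x y)"
  unfolding in_Itv_iff
proof (intro allI impI)
  fix j assume "lkp (act y v (u s l)) j \<noteq> 0"
  then have j: "l \<le> j" "j < y" "vt n (j - l) = vt n s" "lkp v (j - l) \<noteq> 0"
    by (auto simp: lookup_act_u split: if_splits)
  then have "x \<le> j - l" using assms by (auto simp: in_Itv_iff)
  moreover have "vt n j = vt n (s + l)" using vt_add_cong[OF n_pos j(3), of l] j(1) by simp
  ultimately show "x \<le> j \<and> j < y \<and> vt n j \<in> V" using j assms(2) by simp
qed

lemma act_closed:
  assumes v: "v \<in> mcar (Itv V x y)" and w: "w \<in> Sp V" and V: "V \<subseteq> {1..n}"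
  shows "act y v w \<in> mcar (Itv V x y)"
  using w
proof (induction rule: basis_induct)
  case zero
  then show ?case using pm.subspace_0[OF subspace_Itv] by simp
next
  case (base s l)
  then show ?case using v act_u_closed by blast
next
  case (add w w')
  then have "w \<in> elems A" "w' \<in> elems A" unfolding elems_A_basis using span_basis_mono[OF V] by blast+
  then show ?case using add pm.subspace_add[OF subspace_Itv] by (simp add: act_add_right)
next
  case (smul c w)
  then have "w \<in> elems A" unfolding elems_A_basis using span_basis_mono[OF V] by blast
  then show ?case using smul pm.subspace_scale[OF subspace_Itv] by (simp add: act_scale_right)
qed

text \<open>Multiplicativity is where \<open>y \<le> f x\<close> enters. A move from
  \<open>i \<ge> x\<close> to a position below \<open>y\<close> has length less than
  \<open>p i\<close>, so a product of paths that stays inside the interval is nonzero in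
  \<open>A\<close>; outside the interval both sides vanish.\<close>

lemma act_act_u:
  assumes v: "v \<in> mcar (Itv V x y)" and y: "y \<le> f x"
  shows "act y (act y v (u s l)) (u t k) = act y v (u s l * u t k)"
proof (rule poly_mapping_eqI)
  fix j
  show "lkp (act y (act y v (u s l)) (u t k)) j = lkp (act y v (u s l * u t k)) j"
  proof (cases "l + k \<le> j \<and> j < y \<and> lkp v (j - (l + k)) \<noteq> 0 \<and> vt n (j - (l + k)) = vt n s")
    case True
    define i where "i = j - (l + k)"
    have i: "j = i + l + k" "vt n i = vt n s" using True by (auto simp: i_def)
    have "x \<le> i" using v True by (auto simp: in_Itv_iff i_def)
    then have "f x \<le> f i" "f x \<le> f (i + l)" by (auto intro!: f_mono)
    then have "j < f i" "j < f (i + l)" using True y by auto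
    then have pp: "l + k < p s" "k < p (i + l)" using i p_eq[of i s] by (auto simp: f_def)
    have "vt n (s + l) = vt n (i + l)" using vt_add_cong[OF n_pos i(2)[symmetric]] .
    then show ?thesis using pp True i p_eq[of "i + l" t]
      by (auto simp: u_mult lookup_act_u)
  next
    case False
    then show ?thesis by (auto simp: u_mult lookup_act_u diff_diff_left add.commute)
  qed
qed

lemma act_act:
  assumes v: "v \<in> mcar (Itv V x y)" and y: "y \<le> f x" and w: "w \<in> elems A" and w': "w' \<in> elems A"
  shows "act y (act y v w) w' = act y v (w * w')"
  using w unfolding elems_A_basis
proof (induction rule: basis_induct)
  case (base s l)
  show ?case using w' unfolding elems_A_basis
  proof (induction rule: basis_induct)
    case (base t k)
    show ?case by (rule act_act_u[OF v y])
  next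
    case (add w w')
    then have "w \<in> elems A" "w' \<in> elems A" by (simp_all only: elems_A_basis)
    then show ?case using add by (simp add: act_add_right distrib_left u_in_elems elems_mult)
  next
    case (smul c w)
    then have "w \<in> elems A" by (simp only: elems_A_basis)
    then show ?case using smul by (simp add: act_scale_right smul_mult_right u_in_elems elems_mult)
  qed simp
next
  case (add w1 w2)
  then have "w1 \<in> elems A" "w2 \<in> elems A" by (simp_all only: elems_A_basis)
  then show ?case using add w' by (simp add: act_add_right act_add_left distrib_right elems_mult)
next
  case (smul c w)
  then have "w \<in> elems A" by (simp only: elems_A_basis)
  then show ?case using smul w' by (simp add: act_scale_right act_scale_left smul_mult_left elems_mult)
qed simp

lemma idem_vt: "idem A (vt n i) = u i 0"
  using idem_A[OF vt_in[OF n_pos]] by simp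

lemma alg_one_cor: "V \<subseteq> {1..n} \<Longrightarrow> alg_one (cor V) = (\<Sum>a\<in>V. u a 0)"
  unfolding alg_one_def by (intro sum.cong) (auto intro!: idem_A)

lemma finite_vertices: "V \<subseteq> {1..n} \<Longrightarrow> finite V"
  using finite_subset by blast

lemma lookup_act_one:
  assumes "V \<subseteq> {1..n}"
  shows "lkp (act y v (\<Sum>a\<in>V. u a 0)) j = (if j < y \<and> vt n j \<in> V then lkp v j else 0)"
proof -
  have "act y v (\<Sum>a\<in>V. u a 0) = (\<Sum>a\<in>V. act y v (u a 0))"
    by (intro act_sum_right u_in_elems)
  then have "lkp (act y v (\<Sum>a\<in>V. u a 0)) j = (\<Sum>a\<in>V. if a = vt n j then (if j < y then lkp v j else 0) else 0)"
    unfolding lookup_sum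
  proof (simp only: lookup_sum, intro sum.cong refl)
    fix a assume "a \<in> V"
    then have "vt n a = a" using assms vt_id by blast
    then show "lkp (act y v (u a 0)) j = (if a = vt n j then if j < y then lkp v j else 0 else 0)"
      using p_pos by (auto simp: lookup_act_u)
  qed
  then show ?thesis using finite_vertices[OF assms] by simp
qed

lemma right_module_Itv:
  assumes V: "V \<subseteq> {1..n}" and y: "y \<le> f x"
  shows "right_module (cor V) (Itv V x y)"
proof -
  have el: "w \<in> Sp V \<Longrightarrow> w \<in> elems A" for w
    unfolding elems_A_basis using span_basis_mono[OF V] by blast
  have one: "act y v (alg_one (cor V)) = v" if "v \<in> mcar (Itv V x y)" for v
    by (rule poly_mapping_eqI) (use that in \<open>auto simp: alg_one_cor[OF V] lookup_act_one[OF V] in_Itv_iff\<close>)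
  have fin: "\<exists>B. finite B \<and> mcar (Itv V x y) \<subseteq> pm.span B"
    unfolding mcar_Itv keys_subset_eq_span
    by (rule exI[of _ "sng ` {i \<in> {x..<y}. vt n i \<in> V}"]) simp
  show ?thesis
    unfolding right_module_def
    by (simp add: subspace_Itv fin act_closed[OF _ _ V] act_add_left act_add_right el act_scale_left act_scale_right
        act_act[OF _ y] one)
qed

end

section \<open>Generalities on modules\<close>

lemma moduleD:
  assumes "right_module A M"
  shows "pm.subspace (mcar M)"
    and "v \<in> mcar M \<Longrightarrow> x \<in> elems A \<Longrightarrow> mact M v x \<in> mcar M"
    and "v \<in> mcar M \<Longrightarrow> w \<in> mcar M \<Longrightarrow> x \<in> elems A \<Longrightarrow> mact M (v + w) x = mact M v x + mact M w x"
    and "v \<in> mcar M \<Longrightarrow> x \<in> elems A \<Longrightarrow> y \<in> elems A \<Longrightarrow> mact M v (x + y) = mact M v x + mact M v y"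
    and "v \<in> mcar M \<Longrightarrow> x \<in> elems A \<Longrightarrow> mact M (scale_pm c v) x = scale_pm c (mact M v x)"
    and "v \<in> mcar M \<Longrightarrow> x \<in> elems A \<Longrightarrow> mact M v (smul A c x) = scale_pm c (mact M v x)"
    and "v \<in> mcar M \<Longrightarrow> x \<in> elems A \<Longrightarrow> y \<in> elems A \<Longrightarrow> mact M (mact M v x) y = mact M v (x * y)"
    and "v \<in> mcar M \<Longrightarrow> mact M v (alg_one A) = v"
  using assms by (simp_all add: right_module_def)

lemma module_closed:
  assumes "right_module A M"
  shows "0 \<in> mcar M"
    and "v \<in> mcar M \<Longrightarrow> w \<in> mcar M \<Longrightarrow> v + w \<in> mcar M"
    and "v \<in> mcar M \<Longrightarrow> scale_pm c v \<in> mcar M"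
    and "v \<in> mcar M \<Longrightarrow> w \<in> mcar M \<Longrightarrow> v - w \<in> mcar M"
  using moduleD(1)[OF assms]
  by (simp_all add: pm.subspace_0 pm.subspace_add pm.subspace_scale pm.subspace_diff)

lemma mact_zero: "right_module A M \<Longrightarrow> x \<in> elems A \<Longrightarrow> mact M 0 x = 0"
  using moduleD(5)[of A M 0 x 0] module_closed(1)[of A M] by simp

lemma mod_homD:
  assumes "mod_hom A M N h"
  shows "v \<in> mcar M \<Longrightarrow> h v \<in> mcar N"
    and "v \<in> mcar M \<Longrightarrow> w \<in> mcar M \<Longrightarrow> h (v + w) = h v + h w"
    and "v \<in> mcar M \<Longrightarrow> h (scale_pm c v) = scale_pm c (h v)"
    and "v \<in> mcar M \<Longrightarrow> x \<in> elems A \<Longrightarrow> h (mact M v x) = mact N (h v) x"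
  using assms by (simp_all add: mod_hom_def)

lemma mod_hom_zero: "mod_hom A M N h \<Longrightarrow> v \<in> mcar M \<Longrightarrow> h 0 = 0"
  using mod_homD(3)[of A M N h v 0] by simp

lemma mod_hom_diff:
  assumes "mod_hom A M N h" "pm.subspace (mcar M)" "v \<in> mcar M" "w \<in> mcar M"
  shows "h (v - w) = h v - h w"
proof -
  have "scale_pm (- 1) w \<in> mcar M" using assms pm.subspace_scale by blast
  then have "h (v + scale_pm (- 1) w) = h v + scale_pm (- 1) (h w)"
    using assms mod_homD(2,3)[OF assms(1)] by metis
  then show ?thesis by simp
qed

lemma mod_hom_comp: "mod_hom A M N g \<Longrightarrow> mod_hom A N L h \<Longrightarrow> mod_hom A M L (\<lambda>v. h (g v))"
  by (simp add: mod_hom_def)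

lemma submodule_right_module:
  assumes "right_module A M" "submodule A L M"
  shows "right_module A (M\<lparr>mcar := L\<rparr>)"
proof -
  have L: "L \<subseteq> mcar M" "pm.subspace L" "\<And>v x. v \<in> L \<Longrightarrow> x \<in> elems A \<Longrightarrow> mact M v x \<in> L"
    using assms(2) by (auto simp: submodule_def)
  obtain B where B: "finite B" "mcar M \<subseteq> pm.span B"
    using assms(1) unfolding right_module_def by blast
  then have "\<exists>B. finite B \<and> L \<subseteq> pm.span B" using L(1) by blast
  with L show ?thesis
    using moduleD[OF assms(1)] unfolding right_module_def
    by (auto dest!: subsetD[OF L(1)])
qed

lemma mod_hom_restrict:
  "mod_hom A M N h \<Longrightarrow> L \<subseteq> mcar M \<Longrightarrow> h ` L \<subseteq> K \<Longrightarrow> mod_hom A (M\<lparr>mcar := L\<rparr>) (N\<lparr>mcar := K\<rparr>) h"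
  unfolding mod_hom_def by (simp add: subset_iff)

lemma submodule_ker:
  assumes "right_module A M" "right_module A N" "mod_hom A M N h"
  shows "submodule A (mod_ker M h) M"
proof -
  have "h 0 = 0" using mod_hom_zero[OF assms(3)] module_closed(1)[OF assms(1)] by blast
  then show ?thesis
    using module_closed[OF assms(1)] moduleD(2)[OF assms(1)] mact_zero[OF assms(2)]
    unfolding submodule_def mod_ker_def pm.subspace_def by (auto simp: mod_homD[OF assms(3)])
qed

lemma submodule_image:
  assumes "right_module A M" "right_module A N" "mod_hom A M N h" "submodule A L M"
  shows "submodule A (h ` L) N"
proof -
  have L: "L \<subseteq> mcar M" "pm.subspace L" "\<And>v x. v \<in> L \<Longrightarrow> x \<in> elems A \<Longrightarrow> mact M v x \<in> L"
    using assms(4) by (auto simp: submodule_def)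
  note h = mod_homD[OF assms(3)]
  have "pm.subspace (h ` L)"
    unfolding pm.subspace_def
  proof (intro conjI ballI allI)
    show "0 \<in> h ` L"
      using mod_hom_zero[OF assms(3)] module_closed(1)[OF assms(1)] pm.subspace_0[OF L(2)]
      by (metis imageI)
  next
    fix x y assume "x \<in> h ` L" "y \<in> h ` L"
    then obtain v w where "v \<in> L" "w \<in> L" "x = h v" "y = h w" by auto
    then show "x + y \<in> h ` L" using h(2)[of v w] L pm.subspace_add[OF L(2)] by (metis imageI subsetD)
  next
    fix c x assume "x \<in> h ` L"
    then obtain v where "v \<in> L" "x = h v" by auto
    then show "scale_pm c x \<in> h ` L" using h(3)[of v] L pm.subspace_scale[OF L(2)] by (metis imageI subsetD)
  qed
  moreover have "mact N x y \<in> h ` L" if "x \<in> h ` L" "y \<in> elems A" for x y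
  proof -
    obtain v where "v \<in> L" "x = h v" using \<open>x \<in> h ` L\<close> by auto
    then show ?thesis using h(4)[of v y] L that by (metis imageI subsetD)
  qed
  moreover have "h ` L \<subseteq> mcar N" using h(1) L(1) by auto
  ultimately show ?thesis by (simp add: submodule_def)
qed

lemma submodule_mcar: "right_module A M \<Longrightarrow> submodule A (mcar M) M"
  by (simp add: submodule_def moduleD)

lemma mod_hom_bij_eq_0_iff:
  assumes "mod_hom A M N h" "bij_betw h (mcar M) (mcar N)" "right_module A M" "v \<in> mcar M"
  shows "h v = 0 \<longleftrightarrow> v = 0"
  using assms mod_hom_zero[OF assms(1,4)] module_closed(1)[OF assms(3)]
  unfolding bij_betw_def inj_on_def by metis

lemma mod_iso_refl: "mod_iso A M M"
  unfolding mod_iso_def by (rule exI[of _ "\<lambda>v. v"]) (simp add: mod_hom_def bij_betw_def)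

lemma mod_iso_trans: "mod_iso A M N \<Longrightarrow> mod_iso A N L \<Longrightarrow> mod_iso A M L"
proof -
  assume "mod_iso A M N" "mod_iso A N L"
  then obtain g h where "mod_hom A M N g" "bij_betw g (mcar M) (mcar N)" "mod_hom A N L h" "bij_betw h (mcar N) (mcar L)"
    by (auto simp: mod_iso_def)
  then show ?thesis unfolding mod_iso_def using mod_hom_comp[of A M N g L h] bij_betw_trans[of g "mcar M" "mcar N" h "mcar L"]
    by (auto simp: o_def)
qed

lemma mod_hom_inverse:
  assumes M: "right_module A M" and h: "mod_hom A M N h" and bij: "bij_betw h (mcar M) (mcar N)"
  shows "mod_hom A N M (inv_into (mcar M) h)"
proof -
  let ?g = "inv_into (mcar M) h"
  have im: "h ` mcar M = mcar N" and inj: "inj_on h (mcar M)" using bij by (auto simp: bij_betw_def)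
  have gh: "?g (h v) = v" if "v \<in> mcar M" for v using inj that by simp
  have ex: "\<exists>v\<in>mcar M. h v = x" if "x \<in> mcar N" for x
    using that unfolding im[symmetric] by blast
  note hD = mod_homD[OF h] and M' = module_closed[OF M] moduleD(2)[OF M]
  show ?thesis
    unfolding mod_hom_def
  proof (intro conjI ballI allI)
    fix x assume "x \<in> mcar N"
    then show "?g x \<in> mcar M" using ex gh by metis
  next
    fix x y assume "x \<in> mcar N" "y \<in> mcar N"
    then obtain v w where "v \<in> mcar M" "w \<in> mcar M" "x = h v" "y = h w" using ex by metis
    then show "?g (x + y) = ?g x + ?g y" using gh M' hD(2) by metis
  next
    fix c x assume "x \<in> mcar N"
    then obtain v where "v \<in> mcar M" "x = h v" using ex by metis
    then show "?g (scale_pm c x) = scale_pm c (?g x)" using gh M' hD(3) by metis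
  next
    fix x y assume "x \<in> mcar N" "y \<in> elems A"
    then obtain v where "v \<in> mcar M" "x = h v" using ex by metis
    then show "?g (mact N x y) = mact M (?g x) y" using gh M' hD(4) \<open>y \<in> elems A\<close> by metis
  qed
qed

lemma mod_iso_sym:
  assumes "right_module A M" "mod_iso A M N"
  shows "mod_iso A N M"
proof -
  obtain h where h: "mod_hom A M N h" "bij_betw h (mcar M) (mcar N)" using assms(2) by (auto simp: mod_iso_def)
  then show ?thesis
    unfolding mod_iso_def using mod_hom_inverse[OF assms(1) h] bij_betw_inv_into[OF h(2)] by blast
qed

lemma Schur_bij:
  assumes M: "simple_module A M" and N: "simple_module A N" and h: "mod_hom A M N h"
    and v: "v \<in> mcar M" "h v \<noteq> 0"
  shows "bij_betw h (mcar M) (mcar N)"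
proof -
  have rM: "right_module A M" and rN: "right_module A N" using M N by (auto simp: simple_module_def)
  have "mod_ker M h = {0} \<or> mod_ker M h = mcar M"
    using M submodule_ker[OF rM rN h] by (simp add: simple_module_def)
  then have ker: "mod_ker M h = {0}" using v by (auto simp: mod_ker_def)
  have "h ` mcar M = {0} \<or> h ` mcar M = mcar N"
    using N submodule_image[OF rM rN h submodule_mcar[OF rM]] by (simp add: simple_module_def)
  then have im: "h ` mcar M = mcar N" using v by auto
  have "inj_on h (mcar M)"
  proof (rule inj_onI)
    fix x y assume xy: "x \<in> mcar M" "y \<in> mcar M" "h x = h y"
    then have "x - y \<in> mod_ker M h"
      using mod_hom_diff[OF h moduleD(1)[OF rM] xy(1,2)] module_closed(4)[OF rM]
      by (simp add: mod_ker_def)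
    then show "x = y" using ker by simp
  qed
  then show ?thesis using im by (simp add: bij_betw_def)
qed

lemma inj_on_ker:
  assumes "right_module A M" "mod_hom A M N h" "\<And>v. v \<in> mcar M \<Longrightarrow> h v = 0 \<Longrightarrow> v = 0"
  shows "inj_on h (mcar M)"
proof (rule inj_onI)
  fix x y assume xy: "x \<in> mcar M" "y \<in> mcar M" "h x = h y"
  then have "h (x - y) = 0" using mod_hom_diff[OF assms(2) moduleD(1)[OF assms(1)]] by simp
  then have "x - y = 0" using xy module_closed(4)[OF assms(1)] assms(3) by blast
  then show "x = y" by simp
qed

lemma composition_factor_iso:
  assumes M: "right_module A M" and N: "right_module A N" and iso: "mod_iso A M N"
    and cf: "composition_factor A S M"
  shows "composition_factor A S N"
proof -
  obtain g where g: "mod_hom A M N g" and bij: "bij_betw g (mcar M) (mcar N)"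
    using iso by (auto simp: mod_iso_def)
  let ?k = "inv_into (mcar M) g"
  have k: "mod_hom A N M ?k" by (rule mod_hom_inverse[OF M g bij])
  have kg: "?k (g v) = v" if "v \<in> mcar M" for v
    using bij that by (simp add: bij_betw_def)
  obtain l L i where L: "composition_series A M l L" and i: "i < l" "is_subquotient A M (L i) (L (Suc i)) S"
    using cf by (auto simp: composition_factor_def)
  have sub: "submodule A (L j) M" if "j \<le> l" for j using L that by (auto simp: composition_series_def)
  have quot: "is_subquotient A N (g ` K) (g ` K') T"
    if T: "is_subquotient A M K K' T" and K: "submodule A K M" "submodule A K' M" for K K' T
  proof -
    obtain h where h: "mod_hom A (M\<lparr>mcar := K'\<rparr>) T h" "h ` K' = mcar T" "mod_ker (M\<lparr>mcar := K'\<rparr>) h = K"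
      using T by (auto simp: is_subquotient_def)
    have KM: "K' \<subseteq> mcar M" using K by (simp add: submodule_def)
    have kg': "?k ` g ` K' = K'" using kg KM by (force simp: image_image)
    have gK: "g ` K' \<subseteq> mcar N" using KM mod_homD(1)[OF g] by auto
    have "mod_hom A (N\<lparr>mcar := g ` K'\<rparr>) (M\<lparr>mcar := K'\<rparr>) ?k"
      by (rule mod_hom_restrict[OF k gK]) (simp add: kg')
    then have "mod_hom A (N\<lparr>mcar := g ` K'\<rparr>) T (\<lambda>v. h (?k v))" using h(1) by (rule mod_hom_comp)
    moreover have "(\<lambda>v. h (?k v)) ` g ` K' = mcar T"
      using h(2) kg' by (metis image_image)
    moreover have "mod_ker (N\<lparr>mcar := g ` K'\<rparr>) (\<lambda>v. h (?k v)) = g ` K"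
      using h(3) kg KM by (auto simp: mod_ker_def)
    ultimately show ?thesis unfolding is_subquotient_def by (intro exI[of _ "\<lambda>v. h (?k v)"]) simp
  qed
  have "composition_series A N l (\<lambda>j. g ` L j)"
    unfolding composition_series_def
  proof (intro conjI allI impI)
    have "g 0 = 0" using mod_hom_zero[OF g module_closed(1)[OF M]] .
    then show "g ` L 0 = {0}" using L by (simp add: composition_series_def)
    show "g ` L l = mcar N" using L bij by (simp add: composition_series_def bij_betw_def)
  next
    fix j assume "j \<le> l"
    then show "submodule A (g ` L j) N" using sub submodule_image[OF M N g] by blast
  next
    fix j assume j: "j < l"
    then show "g ` L j \<subseteq> g ` L (Suc j)" using L unfolding composition_series_def by blast
    obtain T where "simple_module A T" "is_subquotient A M (L j) (L (Suc j)) T"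
      using L j unfolding composition_series_def by blast
    then show "\<exists>T. simple_module A T \<and> is_subquotient A N (g ` L j) (g ` L (Suc j)) T"
      using quot sub j by (metis Suc_leI less_imp_le)
  qed
  moreover have "is_subquotient A N (g ` L i) (g ` L (Suc i)) S" using quot i sub by simp
  ultimately show ?thesis using i(1) unfolding composition_factor_def by blast
qed

text \<open>An element that kills \<open>M\<close> kills every subquotient of \<open>M\<close>. With
  \<open>x\<close> the idempotent at \<open>b\<close> this tests whether the simple module at
  \<open>b\<close> can occur.\<close>

lemma composition_factor_act:
  assumes M: "right_module A M" and S: "right_module A S" and cf: "composition_factor A S M"
    and w: "w \<in> mcar S" "mact S w x \<noteq> 0" and x: "x \<in> elems A"
  shows "\<exists>v\<in>mcar M. mact M v x \<noteq> 0"
proof -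
  obtain l L i where L: "composition_series A M l L" and i: "i < l" "is_subquotient A M (L i) (L (Suc i)) S"
    using cf by (auto simp: composition_factor_def)
  obtain h where h: "mod_hom A (M\<lparr>mcar := L (Suc i)\<rparr>) S h" "h ` L (Suc i) = mcar S"
    using i(2) by (auto simp: is_subquotient_def)
  have LM: "L (Suc i) \<subseteq> mcar M"
    using L i(1) unfolding composition_series_def submodule_def by (metis Suc_leI)
  obtain v where v: "v \<in> L (Suc i)" "w = h v" using h(2) w(1) by auto
  have "h (mact M v x) = mact S w x" using mod_homD(4)[OF h(1), of v x] v x by simp
  moreover have "h 0 = 0" using mod_hom_zero[OF h(1), of v] v by simp
  ultimately have "mact M v x \<noteq> 0" using w(2) by metis
  then show ?thesis using v(1) LM by blast
qed

context nakayama
begin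

definition full :: "nat set" where "full = {1..n}"

lemma vt_full [simp]: "vt n i \<in> full"
  unfolding full_def by (rule vt_in) simp

lemma full_subset: "full \<subseteq> {1..n}"
  by (simp add: full_def)

lemma cor_full' [simp]: "cor full = A"
  unfolding full_def by (rule cor_full)

lemma elems_full: "Sp full = elems A"
  unfolding full_def by (rule elems_A_basis[symmetric])

lemma span_basis_elems: "V \<subseteq> {1..n} \<Longrightarrow> w \<in> Sp V \<Longrightarrow> w \<in> elems A"
  unfolding elems_A_basis using span_basis_mono by blast

abbreviation J :: "nat \<Rightarrow> nat \<Rightarrow> ('k, 'a) rmod" where "J \<equiv> Itv full"

lemma right_module_J: "y \<le> f x \<Longrightarrow> right_module A (J x y)"
  using right_module_Itv[OF full_subset, of y x] by simp

lemma mcar_J: "mcar (J x y) = {v. supp v \<subseteq> {x..<y}}"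
  by (auto simp: mcar_Itv)

lemma mcar_J_empty: "y \<le> x \<Longrightarrow> mcar (J x y) = {0}"
  by (auto simp: in_Itv_iff intro!: poly_mapping_eqI) force

lemma Itv_mono: "x \<le> x' \<Longrightarrow> mcar (Itv V x' y) \<subseteq> mcar (Itv V x y)"
  by (meson in_Itv_iff le_trans subsetI)

lemma Itv_update [simp]: "Itv V x y\<lparr>mcar := mcar (Itv W z y)\<rparr> = Itv W z y"
  by (simp add: Itv_def)

lemma submodule_J: "x \<le> x' \<Longrightarrow> y \<le> f x \<Longrightarrow> submodule A (mcar (J x' y)) (J x y)"
  unfolding submodule_def
proof (intro conjI ballI)
  assume "x \<le> x'" "y \<le> f x"
  then show "mcar (J x' y) \<subseteq> mcar (J x y)" by (intro Itv_mono)
  show "pm.subspace (mcar (J x' y))" by (rule subspace_Itv)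
  fix v w assume "v \<in> mcar (J x' y)" "w \<in> elems A"
  then show "mact (J x y) v w \<in> mcar (J x' y)"
    using act_closed[OF _ _ full_subset] by (simp add: elems_full)
qed

text \<open>This is the uniseriality of interval modules.\<close>

lemma submodule_contains_tail:
  assumes L: "submodule A L (J x y)" and y: "y \<le> f x"
    and v: "v \<in> L" "lkp v i \<noteq> 0" "\<And>j. j < i \<Longrightarrow> lkp v j = 0"
    and w: "w \<in> mcar (J i y)"
  shows "w \<in> L"
proof -
  have LM: "L \<subseteq> mcar (J x y)" and subL: "pm.subspace L" and actL: "\<And>v z. v \<in> L \<Longrightarrow> z \<in> elems A \<Longrightarrow> act y v z \<in> L"
    using L by (simp_all add: submodule_def)
  have xi: "x \<le> i" using v LM by (auto simp: in_Itv_iff)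
  \<comment> \<open>Downward induction from the upper end: \<open>k\<close> bounds the length
    \<open>y - j\<close> of the tail that starts at \<open>j\<close>.\<close>
  have "\<forall>j w. i \<le> j \<longrightarrow> y - j \<le> k \<longrightarrow> w \<in> mcar (J j y) \<longrightarrow> w \<in> L" for k
  proof (induction k)
    case 0
    show ?case using mcar_J_empty pm.subspace_0[OF subL] by simp
  next
    case (Suc k)
    show ?case
    proof (intro allI impI)
      fix j w assume j: "i \<le> j" "y - j \<le> Suc k" and w: "w \<in> mcar (J j y)"
      show "w \<in> L"
      proof (cases "j < y")
        case False
        then show ?thesis using w mcar_J_empty[of y j] pm.subspace_0[OF subL] by simp
      next
        case True
        \<comment> \<open>Moving \<open>v\<close> along the path from \<open>i\<close> to
          \<open>j\<close> gives an element of \<open>L\<close> whose lowest position is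
          \<open>j\<close>. Subtracting a multiple of it from \<open>w\<close> leaves a vector in
          the next shorter tail.\<close>
        define v' where "v' = act y v (u i (j - i))"
        have "j - i < p i" using True y f_mono[OF xi] j by (simp add: f_def)
        moreover have "j - (j - i) = i" using j by simp
        ultimately have lkj: "lkp v' j = lkp v i" using True by (simp add: v'_def lookup_act_u)
        have lk0: "lkp v' j' = 0" if "j' < j" for j'
        proof -
          have "lkp v (j' - (j - i)) = 0" if "j - i \<le> j'" using that \<open>j' < j\<close> j by (intro v(3)) linarith
          then show ?thesis by (simp add: v'_def lookup_act_u)
        qed
        note lk = lkj lk0
        have v'L: "v' \<in> L" unfolding v'_def by (intro actL v u_in_elems)
        define w' where "w' = w - scale_pm (lkp w j / lkp v i) v'"
        have "w' \<in> mcar (J (Suc j) y)"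
          unfolding in_Itv_iff
        proof (intro allI impI)
          fix a assume a: "lkp w' a \<noteq> 0"
          have "a \<noteq> j" using a lk v(2) by (auto simp: w'_def lookup_minus lookup_scale_pm)
          moreover have "lkp w a \<noteq> 0 \<or> lkp v' a \<noteq> 0" using a by (auto simp: w'_def lookup_minus lookup_scale_pm)
          then have "j \<le> a \<and> a < y"
          proof
            assume "lkp v' a \<noteq> 0"
            moreover have "v' \<in> mcar (J x y)" using v'L LM by blast
            ultimately show ?thesis using lk(2)[of a] by (auto simp: in_Itv_iff not_less)
          qed (use w in \<open>auto simp: in_Itv_iff\<close>)
          ultimately show "Suc j \<le> a \<and> a < y \<and> vt n a \<in> full" by simp
        qed
        then have "w' \<in> L" using Suc.IH j True by (metis Suc_diff_Suc Suc_le_mono le_SucI)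
        moreover have "w = w' + scale_pm (lkp w j / lkp v i) v'" by (simp add: w'_def)
        ultimately show ?thesis using v'L subL by (metis pm.subspace_add pm.subspace_scale)
      qed
    qed
  qed
  from this[of "y - i"] w show ?thesis by blast
qed

text \<open>The top of an interval is simple and sits at its lowest position, so a submodule that
  reaches it is everything. Simplicity of \<open>J x (Suc x)\<close> and minimality of the
  resolutions rest on this.\<close>

lemma submodule_J_eq_top:
  assumes L: "submodule A L (J x y)" and y: "y \<le> f x" and v: "v \<in> L" "lkp v x \<noteq> 0"
  shows "L = mcar (J x y)"
proof
  show "L \<subseteq> mcar (J x y)" using L by (simp add: submodule_def)
  then have "lkp v j = 0" if "j < x" for j using v(1) that by (force simp: in_Itv_iff)
  then show "mcar (J x y) \<subseteq> L" using submodule_contains_tail[OF L y v] by blast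
qed

lemma lowest_position:
  fixes v :: "'k uvec"
  assumes "v \<noteq> 0"
  obtains i where "lkp v i \<noteq> 0" "\<And>j. j < i \<Longrightarrow> lkp v j = 0"
proof -
  have "\<exists>i. lkp v i \<noteq> 0" using assms by (metis lookup_zero poly_mapping_eqI)
  then show ?thesis using that[of "LEAST i. lkp v i \<noteq> 0"] LeastI_ex[of "\<lambda>i. lkp v i \<noteq> 0"]
    not_less_Least[of _ "\<lambda>i. lkp v i \<noteq> 0"] by blast
qed

section \<open>Homomorphisms between interval modules\<close>

lemma mod_hom_basisI:
  assumes V: "V \<subseteq> {1..n}" and M: "right_module (cor V) M" and N: "right_module (cor V) N"
    and mem: "\<And>v. v \<in> mcar M \<Longrightarrow> h v \<in> mcar N"
    and add: "\<And>v w. v \<in> mcar M \<Longrightarrow> w \<in> mcar M \<Longrightarrow> h (v + w) = h v + h w"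
    and scale: "\<And>c v. v \<in> mcar M \<Longrightarrow> h (scale_pm c v) = scale_pm c (h v)"
    and hact: "\<And>v s l. v \<in> mcar M \<Longrightarrow> s \<in> V \<Longrightarrow> l < p s \<Longrightarrow> vt n (s + l) \<in> V \<Longrightarrow>
      h (mact M v (u s l)) = mact N (h v) (u s l)"
  shows "mod_hom (cor V) M N h"
proof -
  note Md = moduleD[OF M, simplified] and Nd = moduleD[OF N, simplified]
  have "h (mact M v x) = mact N (h v) x" if v: "v \<in> mcar M" and x: "x \<in> Sp V" for v x
    using x
  proof (induction rule: basis_induct)
    case zero
    have "mact M v (smul A 0 0) = 0" "mact N (h v) (smul A 0 0) = 0"
      using Md(6)[OF v, of 0 0] Nd(6)[OF mem[OF v], of 0 0] by (simp_all add: vs.span_zero)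
    moreover have "h 0 = 0" using scale[OF v, of 0] by simp
    ultimately show ?case by simp
  next
    case (base s l)
    then show ?case using hact v by blast
  next
    case (add x y)
    then show ?case using Md(4)[OF v] Nd(4)[OF mem[OF v]] assms(5)[OF Md(2)[OF v] Md(2)[OF v]] by simp
  next
    case (smul c x)
    then show ?case using Md(6)[OF v] Nd(6)[OF mem[OF v]] assms(6)[OF Md(2)[OF v]] by simp
  qed
  then show ?thesis using mem add scale by (simp add: mod_hom_def)
qed

lemma mod_hom_basisI_full:
  assumes "right_module A M" and "right_module A N"
    and "\<And>v. v \<in> mcar M \<Longrightarrow> h v \<in> mcar N"
    and "\<And>v w. v \<in> mcar M \<Longrightarrow> w \<in> mcar M \<Longrightarrow> h (v + w) = h v + h w"
    and "\<And>c v. v \<in> mcar M \<Longrightarrow> h (scale_pm c v) = scale_pm c (h v)"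
    and "\<And>v s l. v \<in> mcar M \<Longrightarrow> l < p s \<Longrightarrow> h (mact M v (u s l)) = mact N (h v) (u s l)"
  shows "mod_hom A M N h"
  using mod_hom_basisI[OF full_subset, of M N h] assms by simp

lemma Itv_induct [consumes 1, case_names zero step]:
  assumes "v \<in> mcar (Itv V x y)"
    and "P 0"
    and "\<And>c i w. x \<le> i \<Longrightarrow> i < y \<Longrightarrow> vt n i \<in> V \<Longrightarrow> w \<in> mcar (Itv V x y) \<Longrightarrow> P w \<Longrightarrow> P (scale_pm c (sng i) + w)"
  shows "P v"
proof -
  have "v \<in> pm.span (sng ` {i \<in> {x..<y}. vt n i \<in> V})"
    using assms(1) unfolding mcar_Itv keys_subset_eq_span .
  then have "v \<in> mcar (Itv V x y) \<and> P v"
  proof (induction rule: pm.span_induct_alt)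
    case base
    then show ?case using assms(2) pm.subspace_0[OF subspace_Itv] by simp
  next
    case (step c z w)
    then obtain i where i: "z = sng i" "x \<le> i" "i < y" "vt n i \<in> V" by auto
    then have "z \<in> mcar (Itv V x y)" by (simp add: single_in_Itv)
    then have "scale_pm c z + w \<in> mcar (Itv V x y)"
      using step by (intro pm.subspace_add[OF subspace_Itv] pm.subspace_scale[OF subspace_Itv]) simp_all
    moreover have "P (scale_pm c z + w)"
      unfolding i(1) using step i by (intro assms(3)) simp_all
    ultimately show ?case ..
  qed
  then show ?thesis ..
qed

lemma act_sng_u: "act y (sng i) (u s l) = (if vt n i = vt n s \<and> i + l < y \<and> l < p i then sng (i + l) else 0)"
proof (cases "vt n i = vt n s")
  case True
  then show ?thesis using act_single_u[of y i 1 l] u_eq[OF True] by simp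
next
  case False
  then show ?thesis by (intro poly_mapping_eqI) (auto simp: lookup_act_u lookup_single when_def)
qed

section \<open>Homomorphisms out of an interval, and projective intervals\<close>

definition gen :: "('k, 'a) rmod \<Rightarrow> 'k uvec \<Rightarrow> nat \<Rightarrow> 'k uvec \<Rightarrow> 'k uvec" where
  "gen M m x = lin_ext (\<lambda>i. mact M m (u x (i - x)))"

lemma gen_linear: "pm_linear (gen M m x)"
  unfolding gen_def by (rule linear_lin_ext)

lemma gen_add: "gen M m x (v + w) = gen M m x v + gen M m x w"
  and gen_scale: "gen M m x (scale_pm c v) = scale_pm c (gen M m x v)"
  and gen_zero: "gen M m x 0 = 0"
proof -
  interpret l: Vector_Spaces.linear scale_pm scale_pm "gen M m x" by (rule gen_linear)
  show "gen M m x (v + w) = gen M m x v + gen M m x w" "gen M m x (scale_pm c v) = scale_pm c (gen M m x v)"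
    "gen M m x 0 = 0" by (rule l.add l.scale l.zero)+
qed

lemma gen_sng: "gen M m x (sng i) = mact M m (u x (i - x))"
  by (simp add: gen_def)

text \<open>The interval \<open>J x y\<close> is the projective module at \<open>x\<close> modulo
  the paths of length at least \<open>y - x\<close>; hence an element annihilated by these paths
  defines a map out of it. \<open>gen\<close> sends the generator \<open>sng x\<close> to
  \<open>mact M m (u x 0)\<close>.\<close>

lemma mod_hom_gen:
  assumes M: "right_module A M" and m: "m \<in> mcar M" and y: "y \<le> f x"
    and ann: "\<And>l. y \<le> x + l \<Longrightarrow> mact M m (u x l) = 0"
  shows "mod_hom A (J x y) M (gen M m x)"
proof (rule mod_hom_basisI_full[OF right_module_J[OF y] M])
  note Mc = module_closed[OF M] and Md = moduleD[OF M]
  fix v :: "'k uvec" assume v: "v \<in> mcar (J x y)"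
  have mem: "gen M m x v \<in> mcar M" if "v \<in> mcar (J x y)" for v
    using that
    by (induction rule: Itv_induct) (simp_all add: gen_zero gen_add gen_scale gen_sng Mc Md m u_in_elems del: scale_pm_single)
  then show "gen M m x v \<in> mcar M" using v .
  fix s l assume l: "l < p s"
  show "gen M m x (mact (J x y) v (u s l)) = mact M (gen M m x v) (u s l)"
    using v
  proof (induction rule: Itv_induct)
    case zero
    then show ?case by (simp add: gen_zero mact_zero[OF M] u_in_elems)
  next
    case (step c i w)
    have xi: "x + (i - x) = i" using step by simp
    have "gen M m x (act y (sng i) (u s l)) = mact M (mact M m (u x (i - x))) (u s l)"
    proof (cases "vt n i = vt n s")
      case True
      have "mact M (mact M m (u x (i - x))) (u s l) = mact M m (u x (i - x + l))"
        using True xi by (subst Md(7)) (simp_all add: m u_in_elems u_mult)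
      moreover have "i + l - x = i - x + l" using step by simp
      moreover have "mact M m (u x (i - x + l)) = 0" if "\<not> i + l < y"
        using that step(1) by (intro ann) simp
      ultimately show ?thesis using True l p_eq[OF True] by (simp add: act_sng_u gen_sng gen_zero)
    next
      case False
      have "mact M (mact M m (u x (i - x))) (u s l) = mact M m 0"
        using False xi by (subst Md(7)) (simp_all add: m u_in_elems u_mult)
      also have "\<dots> = 0" using Md(6)[OF m, of 0 0] u_zero[of x "p x"] u_in_elems[of x "p x"] by simp
      finally show ?thesis using False by (simp add: act_sng_u gen_zero)
    qed
    moreover have "gen M m x (sng i) \<in> mcar M" by (simp add: gen_sng Md m u_in_elems)
    ultimately show ?case using step mem
      by (simp add: act_add_left act_scale_left gen_add gen_scale Md Mc u_in_elems del: scale_pm_single)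
         (simp add: gen_sng)
  qed
qed (simp_all add: gen_add gen_scale)

lemma mact_u_zero: "right_module A M \<Longrightarrow> m \<in> mcar M \<Longrightarrow> p x \<le> l \<Longrightarrow> mact M m (u x l) = 0"
  using moduleD(6)[of A M m 0 0] u_zero[of x l] u_in_elems[of x l] by simp

lemma mact_idem_u:
  assumes "right_module A M" "m \<in> mcar M"
  shows "mact M (mact M m (u x 0)) (u x l) = mact M m (u x l)"
  using moduleD(7)[OF assms u_in_elems u_in_elems] by (simp add: u_mult)

text \<open>For \<open>y = f x\<close> the annihilation condition of \<open>mod_hom_gen\<close>
  concerns only paths that are zero in \<open>A\<close>, so a preimage of the image of the generator
  defines a lift.\<close>

lemma projective_J: "projective_module A (J x (f x))"
  unfolding projective_module_def
proof (intro conjI allI impI)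
  show "right_module A (J x (f x))" by (rule right_module_J) simp
  fix M N :: "('k, 'a) rmod" and h g
  assume M: "right_module A M" and N: "right_module A N" and h: "mod_hom A M N h" "h ` mcar M = mcar N"
    and g: "mod_hom A (J x (f x)) N g"
  have sx: "sng x \<in> mcar (J x (f x))" using f_gt by (simp add: single_in_Itv)
  obtain m0 where m0: "m0 \<in> mcar M" "h m0 = g (sng x)" using h(2) mod_homD(1)[OF g sx] by force
  \<comment> \<open>Multiplying by the idempotent at \<open>x\<close> keeps \<open>m0\<close> a
    preimage, since \<open>sng x\<close> is fixed by that idempotent.\<close>
  define m where "m = mact M m0 (u x 0)"
  have m: "m \<in> mcar M" unfolding m_def using M m0 u_in_elems by (simp add: moduleD(2))
  have sx0: "act (f x) (sng x) (u x 0) = sng x" using f_gt p_pos by (simp add: act_sng_u)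
  have hm: "h m = g (sng x)"
    using mod_homD(4)[OF h(1) m0(1) u_in_elems, of x 0] mod_homD(4)[OF g sx u_in_elems, of x 0] m0(2) sx0
    by (simp add: m_def)
  have k: "mod_hom A (J x (f x)) M (gen M m x)"
    by (rule mod_hom_gen[OF M m]) (auto simp: f_def intro!: mact_u_zero[OF M m])
  have "h (gen M m x v) = g v" if "v \<in> mcar (J x (f x))" for v
    using that
  proof (induction rule: Itv_induct)
    case zero
    then show ?case using mod_hom_zero[OF h(1) m] mod_hom_zero[OF g sx] by (simp add: gen_zero)
  next
    case (step c i w)
    have si: "sng i \<in> mcar (J x (f x))" using step by (simp add: single_in_Itv)
    have "h (gen M m x (sng i)) = mact N (h m) (u x (i - x))"
      by (simp add: gen_sng mod_homD(4)[OF h(1) m] u_in_elems)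
    also have "\<dots> = g (act (f x) (sng x) (u x (i - x)))"
      using mod_homD(4)[OF g sx u_in_elems] hm by simp
    also have "act (f x) (sng x) (u x (i - x)) = sng i"
    proof -
      have "i - x < p x" using step(1,2) by (simp add: f_def)
      then show ?thesis using step(1,2) by (simp add: act_sng_u)
    qed
    finally have "h (gen M m x (sng i)) = g (sng i)" .
    moreover have "scale_pm c (sng i) \<in> mcar (J x (f x))" using step by (simp add: single_in_Itv)
    ultimately show ?case
      using step si mod_homD(1)[OF k] module_closed(3)[OF M]
      by (simp add: gen_add gen_scale mod_homD[OF h(1)] mod_homD[OF g] del: scale_pm_single)
  qed
  with k show "\<exists>k. mod_hom A (J x (f x)) M k \<and> (\<forall>v\<in>mcar (J x (f x)). h (k v) = g v)" by blast
qed

text \<open>A zero module in interval form; it fills a resolution after its last nonzero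
  term.\<close>

lemma projective_zero: "projective_module A (J x x)"
  unfolding projective_module_def
proof (intro conjI allI impI)
  show R: "right_module A (J x x)" using f_gt less_imp_le by (blast intro: right_module_J)
  fix M N :: "('k, 'a) rmod" and h g
  assume M: "right_module A M" and h: "mod_hom A M N h" and g: "mod_hom A (J x x) N g"
  have "g 0 = 0" "h 0 = 0"
    using mod_hom_zero[OF g module_closed(1)[OF R]] mod_hom_zero[OF h module_closed(1)[OF M]] .
  then show "\<exists>k. mod_hom A (J x x) M k \<and> (\<forall>v\<in>mcar (J x x). h (k v) = g v)"
    by (intro exI[of _ "\<lambda>_. 0"])
      (auto simp: mod_hom_def mcar_J_empty module_closed[OF M] mact_zero[OF M])
qed

section \<open>Truncation: quotients and inclusions of intervals\<close>

definition trunc :: "nat \<Rightarrow> 'k uvec \<Rightarrow> 'k uvec" where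
  "trunc y v = Abs_poly_mapping (\<lambda>j. if j < y then lkp v j else 0)"

lemma lookup_trunc: "lkp (trunc y v) j = (if j < y then lkp v j else 0)"
proof -
  have "finite {j. (if j < y then lkp v j else 0) \<noteq> 0}"
    by (rule finite_subset[of _ "{..<y}"]) (auto split: if_splits)
  then show ?thesis by (simp add: trunc_def)
qed

lemma trunc_act: "y \<le> y' \<Longrightarrow> trunc y (act y' v w) = act y (trunc y v) w"
  by (rule poly_mapping_eqI) (auto simp: lookup_trunc lookup_act intro!: sum.cong)

text \<open>Cutting off the positions from \<open>y\<close> on projects \<open>J x y'\<close> onto
  \<open>J x y\<close>; the inequality \<open>x' \<le> x\<close> then includes the result in an
  interval with the same upper end. The differentials of positive degree below have this
  form.\<close>

lemma mod_hom_trunc: "x' \<le> x \<Longrightarrow> y \<le> y' \<Longrightarrow> mod_hom A (J x y') (J x' y) (trunc y)"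
  unfolding mod_hom_def
proof (intro conjI ballI allI)
  assume x: "x' \<le> x" and y: "y \<le> y'"
  show "trunc y v \<in> mcar (J x' y)" if "v \<in> mcar (J x y')" for v
    using that x by (simp add: in_Itv_iff lookup_trunc) (meson le_trans)
  show "trunc y (mact (J x y') v w) = mact (J x' y) (trunc y v) w" for v w
    using y by (simp add: trunc_act)
qed (auto simp: lookup_trunc lookup_add lookup_scale_pm intro!: poly_mapping_eqI)

lemma trunc_id: "v \<in> mcar (Itv V x y) \<Longrightarrow> trunc y v = v"
  by (rule poly_mapping_eqI) (auto simp: lookup_trunc in_Itv_iff)

lemma trunc_image: "y \<le> y' \<Longrightarrow> trunc y ` mcar (J x y') = mcar (J x y)"
proof
  assume y: "y \<le> y'"
  show "trunc y ` mcar (J x y') \<subseteq> mcar (J x y)" using mod_homD(1)[OF mod_hom_trunc[of x x y y']] y by auto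
  show "mcar (J x y) \<subseteq> trunc y ` mcar (J x y')"
  proof
    fix v assume v: "v \<in> mcar (J x y)"
    then have "v \<in> mcar (J x y')" using y by (auto simp: in_Itv_iff)
    then show "v \<in> trunc y ` mcar (J x y')" using trunc_id[OF v] by (metis imageI)
  qed
qed

lemma trunc_kernel: "x \<le> y \<Longrightarrow> y \<le> y' \<Longrightarrow> {v \<in> mcar (J x y'). trunc y v = 0} = mcar (J y y')"
proof -
  assume "x \<le> y"
  moreover have "trunc y v = 0 \<longleftrightarrow> (\<forall>j<y. lkp v j = 0)" for v
    by (auto simp: poly_mapping_eq_iff fun_eq_iff lookup_trunc)
  ultimately have "v \<in> mcar (J x y') \<and> trunc y v = 0 \<longleftrightarrow> v \<in> mcar (J y y')" for v
    by (simp add: in_Itv_iff) (meson not_le le_trans)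
  then show ?thesis by blast
qed

section \<open>Simple modules and composition factors\<close>

lemma simple_J: "simple_module A (J x (Suc x))"
  unfolding simple_module_def
proof (intro conjI allI impI)
  have y: "Suc x \<le> f x" using f_gt by (simp add: Suc_leI)
  show "right_module A (J x (Suc x))" by (rule right_module_J[OF y])
  have "sng x \<in> mcar (J x (Suc x))" by (simp add: single_in_Itv)
  moreover have "sng x \<noteq> (0 :: 'k uvec)" by simp
  ultimately show "mcar (J x (Suc x)) \<noteq> {0}" by blast
  fix L assume L: "submodule A L (J x (Suc x))"
  show "L = {0} \<or> L = mcar (J x (Suc x))"
  proof (cases "L \<subseteq> {0}")
    case True
    then show ?thesis using L pm.subspace_0[of L] by (auto simp: submodule_def)
  next
    case False
    then obtain v where v: "v \<in> L" "v \<noteq> 0" by auto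
    then have "v \<in> mcar (J x (Suc x))" using L by (auto simp: submodule_def)
    then have "lkp v i = 0" if "i \<noteq> x" for i using that by (auto simp: in_Itv_iff)
    then have "lkp v x \<noteq> 0" using v(2) by (metis lookup_zero poly_mapping_eqI)
    then show ?thesis using submodule_J_eq_top[OF L y v(1)] by simp
  qed
qed

lemma act_idem_J: "act (Suc x) (sng x) (idem A (vt n x)) = sng x"
  using p_pos by (simp add: idem_vt act_sng_u)

text \<open>The element \<open>m\<close> gives a nonzero map from the projective module at
  \<open>x\<close> to \<open>S\<close>. The image of the radical is a proper submodule of
  \<open>S\<close>, hence zero, so the map factors through \<open>J x (Suc x)\<close> and Schur's
  lemma applies.\<close>

lemma simple_iso_J:
  assumes S: "simple_module A S" and v: "v \<in> mcar S" "mact S v (idem A (vt n x)) \<noteq> 0"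
  shows "mod_iso A (J x (Suc x)) S"
proof -
  have rS: "right_module A S" using S by (simp add: simple_module_def)
  define m where "m = mact S v (u x 0)"
  have m: "m \<in> mcar S" unfolding m_def using moduleD(2)[OF rS v(1) u_in_elems] .
  have m0: "m \<noteq> 0" using v(2) by (simp add: m_def idem_vt)
  have mm: "mact S m (u x 0) = m" unfolding m_def by (rule mact_idem_u[OF rS v(1)])
  have fx: "Suc x \<le> f x" using f_gt by (simp add: Suc_leI)
  have rP: "right_module A (J x (f x))" by (rule right_module_J) simp
  let ?h = "gen S m x"
  have h: "mod_hom A (J x (f x)) S ?h"
    by (rule mod_hom_gen[OF rS m]) (auto simp: f_def intro!: mact_u_zero[OF rS m])
  have hx: "?h (sng x) = m" by (simp add: gen_sng mm)
  have sx: "sng x \<in> mcar (J x (f x))" using f_gt by (simp add: single_in_Itv)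
  let ?T = "?h ` mcar (J (Suc x) (f x))"
  have tail: "submodule A (mcar (J (Suc x) (f x))) (J x (f x))" by (rule submodule_J) simp_all
  have "submodule A ?T S" by (rule submodule_image[OF rP rS h tail])
  moreover have "?T \<noteq> mcar S"
  proof
    assume "?T = mcar S"
    \<comment> \<open>If the radical were mapped onto \<open>S\<close>, some \<open>t\<close> in it
      would have the same image as the generator. Then \<open>sng x - t\<close> lies in the kernel,
      and being nonzero at \<open>x\<close> it forces the kernel to be everything.\<close>
    then obtain t where t: "t \<in> mcar (J (Suc x) (f x))" "?h t = m" using m by force
    have t': "t \<in> mcar (J x (f x))" using t(1) tail by (auto simp: submodule_def)
    have "?h (sng x - t) = 0"
      using mod_hom_diff[OF h moduleD(1)[OF rP] sx t'] hx t(2) by simp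
    then have "sng x - t \<in> mod_ker (J x (f x)) ?h"
      using module_closed(4)[OF rP sx t'] by (simp add: mod_ker_def)
    moreover have "lkp t x = 0" using t(1) by (auto simp: in_Itv_iff)
    then have "lkp (sng x - t) x \<noteq> 0" by (simp add: lookup_minus)
    ultimately have "mod_ker (J x (f x)) ?h = mcar (J x (f x))"
      using submodule_J_eq_top[OF submodule_ker[OF rP rS h]] by blast
    then have "sng x \<in> mod_ker (J x (f x)) ?h" using sx by blast
    then show False using hx m0 by (simp add: mod_ker_def)
  qed
  ultimately have T0: "?T = {0}" using S unfolding simple_module_def by blast
  have ann: "mact S m (u x l) = 0" if "Suc x \<le> x + l" for l
  proof (cases "l < p x")
    case True
    then have "sng (x + l) \<in> mcar (J (Suc x) (f x))" using that by (intro single_in_Itv) (simp_all add: f_def)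
    then have "?h (sng (x + l)) = 0" using T0 by blast
    then show ?thesis by (simp add: gen_sng)
  qed (simp add: mact_u_zero[OF rS m])
  have h': "mod_hom A (J x (Suc x)) S ?h" by (rule mod_hom_gen[OF rS m fx ann])
  have "bij_betw ?h (mcar (J x (Suc x))) (mcar S)"
    by (rule Schur_bij[OF simple_J S h', of "sng x"]) (simp_all add: single_in_Itv hx m0)
  then show ?thesis using h' unfolding mod_iso_def by blast
qed

lemma simple_at_spec:
  "simple_module A (simple_at A (vt n x)) \<and> (\<exists>v\<in>mcar (simple_at A (vt n x)). mact (simple_at A (vt n x)) v (idem A (vt n x)) \<noteq> 0)"
  unfolding simple_at_def
proof (rule someI)
  have "sng x \<noteq> (0 :: 'k uvec)" by simp
  moreover have "sng x \<in> mcar (J x (Suc x))" by (simp add: single_in_Itv)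
  ultimately show "simple_module A (J x (Suc x)) \<and> (\<exists>v\<in>mcar (J x (Suc x)). mact (J x (Suc x)) v (idem A (vt n x)) \<noteq> 0)"
    using simple_J by (metis mact_Itv act_idem_J)
qed

lemma right_module_simple_at: "right_module A (simple_at A (vt n x))"
  using simple_at_spec by (auto simp: simple_module_def)

lemma J_iso_simple_at: "mod_iso A (J x (Suc x)) (simple_at A (vt n x))"
  using simple_at_spec simple_iso_J by blast

lemma mod_iso_simple_at_J: "mod_iso A (simple_at A (vt n x)) (J x (Suc x))"
  by (rule mod_iso_sym[OF _ J_iso_simple_at]) (simp add: right_module_J Suc_leI f_gt)

text \<open>One direction applies the idempotent at \<open>b\<close>, which picks out the positions
  over \<open>b\<close>. The other uses the chain of tails, whose successive quotients are the
  simple modules of single positions.\<close>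

lemma composition_factor_J:
  assumes y: "y \<le> f x" and b: "b \<in> {1..n}"
  shows "composition_factor A (simple_at A b) (J x y) \<longleftrightarrow> (\<exists>j. x \<le> j \<and> j < y \<and> vt n j = b)"
proof
  have "vt n b = b" using b by (rule vt_id)
  then have S: "right_module A (simple_at A b)"
    and "\<exists>v\<in>mcar (simple_at A b). mact (simple_at A b) v (idem A b) \<noteq> 0"
    using right_module_simple_at[of b] simple_at_spec[of b] by simp_all
  then obtain w where w: "w \<in> mcar (simple_at A b)" "mact (simple_at A b) w (idem A b) \<noteq> 0" by blast
  have eb: "idem A b = u b 0" using b by (rule idem_A)
  assume "composition_factor A (simple_at A b) (J x y)"
  from composition_factor_act[OF right_module_J[OF y] S this w]
  obtain v where v: "v \<in> mcar (J x y)" "act y v (u b 0) \<noteq> 0" by (auto simp: eb u_in_elems)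
  then obtain j where "lkp (act y v (u b 0)) j \<noteq> 0" by (metis lookup_zero poly_mapping_eqI)
  then have "j < y" "vt n j = vt n b" "lkp v j \<noteq> 0" by (auto simp: lookup_act_u split: if_splits)
  then show "\<exists>j. x \<le> j \<and> j < y \<and> vt n j = b" using v(1) \<open>vt n b = b\<close> by (auto simp: in_Itv_iff)
next
  assume "\<exists>j. x \<le> j \<and> j < y \<and> vt n j = b"
  then obtain j where j: "x \<le> j" "j < y" "vt n j = b" by blast
  \<comment> \<open>Indexed by length, so that the factor between \<open>i\<close> and
    \<open>Suc i\<close> sits at position \<open>y - Suc i\<close>; position \<open>j\<close>
    therefore occurs at index \<open>y - Suc j\<close>.\<close>
  let ?L = "\<lambda>i. mcar (J (y - i) y)"
  have quot: "is_subquotient A (J x y) (mcar (J (Suc k) y)) (mcar (J k y)) (J k (Suc k))" if "x \<le> k" "k < y" for k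
    unfolding is_subquotient_def
  proof (intro exI[of _ "trunc (Suc k)"] conjI)
    show "mod_hom A (J x y\<lparr>mcar := mcar (J k y)\<rparr>) (J k (Suc k)) (trunc (Suc k))"
      using mod_hom_trunc[of k k "Suc k" y] that by simp
    show "trunc (Suc k) ` mcar (J k y) = mcar (J k (Suc k))" using trunc_image[of "Suc k" y k] that by simp
    show "mod_ker (J x y\<lparr>mcar := mcar (J k y)\<rparr>) (trunc (Suc k)) = mcar (J (Suc k) y)"
      using trunc_kernel[of k "Suc k" y] that by (simp add: mod_ker_def)
  qed
  have "composition_series A (J x y) (y - x) ?L"
    unfolding composition_series_def
  proof (intro conjI allI impI)
    show "?L 0 = {0}" by (simp add: mcar_J_empty)
    show "?L (y - x) = mcar (J x y)" using j by simp
  next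
    fix i assume "i \<le> y - x"
    then show "submodule A (?L i) (J x y)" using j y by (intro submodule_J) auto
  next
    fix i assume i: "i < y - x"
    then have "y - i = Suc (y - Suc i)" by simp
    then show "?L i \<subseteq> ?L (Suc i)" by (intro Itv_mono) simp
    have "is_subquotient A (J x y) (?L i) (?L (Suc i)) (J (y - Suc i) (Suc (y - Suc i)))"
      using quot[of "y - Suc i"] \<open>y - i = _\<close> i by simp
    then show "\<exists>T. simple_module A T \<and> is_subquotient A (J x y) (?L i) (?L (Suc i)) T"
      using simple_J by blast
  qed
  moreover have "is_subquotient A (J x y) (?L (y - Suc j)) (?L (Suc (y - Suc j))) (simple_at A b)"
  proof -
    have e: "y - (y - Suc j) = Suc j" "y - Suc (y - Suc j) = j" using j by auto
    obtain h where h: "mod_hom A (J x y\<lparr>mcar := mcar (J j y)\<rparr>) (J j (Suc j)) h" "h ` mcar (J j y) = mcar (J j (Suc j))"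
      "mod_ker (J x y\<lparr>mcar := mcar (J j y)\<rparr>) h = mcar (J (Suc j) y)"
      using quot[OF j(1,2)] by (auto simp: is_subquotient_def)
    obtain g where g: "mod_hom A (J j (Suc j)) (simple_at A b) g" "bij_betw g (mcar (J j (Suc j))) (mcar (simple_at A b))"
      using J_iso_simple_at[of j] j(3) by (auto simp: mod_iso_def)
    have rJ: "right_module A (J j (Suc j))" using simple_J by (simp add: simple_module_def)
    have g0: "g v = 0 \<longleftrightarrow> v = 0" if "v \<in> mcar (J j (Suc j))" for v
      using mod_hom_bij_eq_0_iff[OF g rJ that] .
    have hm: "h v \<in> mcar (J j (Suc j))" if "v \<in> mcar (J j y)" for v using h(2) that by auto
    show ?thesis
      unfolding is_subquotient_def e
    proof (intro exI[of _ "\<lambda>v. g (h v)"] conjI)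
      show "mod_hom A (J x y\<lparr>mcar := mcar (J j y)\<rparr>) (simple_at A b) (\<lambda>v. g (h v))"
        by (rule mod_hom_comp[OF h(1) g(1)])
      show "(\<lambda>v. g (h v)) ` mcar (J j y) = mcar (simple_at A b)"
        using h(2) g(2) by (metis bij_betw_def image_image)
      show "mod_ker (J x y\<lparr>mcar := mcar (J j y)\<rparr>) (\<lambda>v. g (h v)) = mcar (J (Suc j) y)"
        using h(3) g0 hm by (auto simp: mod_ker_def)
    qed
  qed
  moreover have "y - Suc j < y - x" using j by auto
  ultimately show "composition_factor A (simple_at A b) (J x y)"
    unfolding composition_factor_def by blast
qed

end

section \<open>Minimal projective resolutions\<close>

lemma projective_lift:
  assumes P: "projective_module A P" and "right_module A M" "right_module A N"
    and "mod_hom A M N g" "g ` mcar M = mcar N" "mod_hom A P N k"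
  obtains h where "mod_hom A P M h" "\<And>v. v \<in> mcar P \<Longrightarrow> g (h v) = k v"
proof -
  have "\<forall>M N f g. right_module A M \<longrightarrow> right_module A N \<longrightarrow> mod_hom A M N f \<longrightarrow> f ` mcar M = mcar N \<longrightarrow>
        mod_hom A P N g \<longrightarrow> (\<exists>h. mod_hom A P M h \<and> (\<forall>v\<in>mcar P. f (h v) = g v))"
    using P by (simp add: projective_module_def)
  from this[rule_format, OF assms(2-6)] that show ?thesis by auto
qed

lemma projective_right_module: "projective_module A P \<Longrightarrow> right_module A P"
  by (simp add: projective_module_def)

lemma minimal_resolutionD:
  assumes "minimal_projective_resolution A M P d"
  shows "projective_module A (P i)" "mod_hom A (P 0) M (d 0)" "d 0 ` mcar (P 0) = mcar M"
    "mod_hom A (P (Suc i)) (P i) (d (Suc i))" "d (Suc i) ` mcar (P (Suc i)) = mod_ker (P i) (d i)"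
    "superfluous A (mod_ker (P i) (d i)) (P i)"
  using assms by (simp_all add: minimal_projective_resolution_def projective_resolution_def)

lemma projective_cover_kernel_iso:
  fixes A :: "('k::field, 'a::ring) vertex_algebra"
  assumes P: "projective_module A P" and P': "projective_module A P'"
    and X: "right_module A X" and X': "right_module A X'"
    and d: "mod_hom A P X d" "d ` mcar P = mcar X"
    and d': "mod_hom A P' X' d'" "d' ` mcar P' = mcar X'"
    and min: "superfluous A (mod_ker P d) P" and min': "superfluous A (mod_ker P' d') P'"
    and iso: "mod_iso A X X'"
  shows "mod_iso A (P\<lparr>mcar := mod_ker P d\<rparr>) (P'\<lparr>mcar := mod_ker P' d'\<rparr>)"
proof -
  have rP: "right_module A P" and rP': "right_module A P'"
    using P P' by (simp_all add: projective_right_module)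
  obtain \<theta> where \<theta>: "mod_hom A X X' \<theta>" "bij_betw \<theta> (mcar X) (mcar X')"
    using iso by (auto simp: mod_iso_def)
  have \<theta>0: "x = 0" if "x \<in> mcar X" "\<theta> x = 0" for x
    using mod_hom_bij_eq_0_iff[OF \<theta> X that(1)] that(2) by simp
  have \<theta>d: "mod_hom A P X' (\<lambda>v. \<theta> (d v))" using d(1) \<theta>(1) by (rule mod_hom_comp)
  obtain \<alpha> where \<alpha>: "mod_hom A P P' \<alpha>" and comm: "\<And>v. v \<in> mcar P \<Longrightarrow> d' (\<alpha> v) = \<theta> (d v)"
    by (rule projective_lift[OF P rP' X' d' \<theta>d]) blast
  note cP = module_closed[OF rP] and cP' = module_closed[OF rP']
  note sP = moduleD(1)[OF rP] and sP' = moduleD(1)[OF rP']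
  have onto: "\<alpha> ` mcar P = mcar P'"
  proof -
    have "mcar P' \<subseteq> {x + y | x y. x \<in> \<alpha> ` mcar P \<and> y \<in> mod_ker P' d'}"
    proof
      fix w assume w: "w \<in> mcar P'"
      have "d' w \<in> \<theta> ` d ` mcar P" using w mod_homD(1)[OF d'(1)] \<theta>(2) d(2) by (simp add: bij_betw_def)
      then obtain v where v: "v \<in> mcar P" "d' w = \<theta> (d v)" by auto
      have av: "\<alpha> v \<in> mcar P'" using v mod_homD(1)[OF \<alpha>] by simp
      have "d' (w - \<alpha> v) = 0" using mod_hom_diff[OF d'(1) sP' w av] v comm by simp
      then have "w - \<alpha> v \<in> mod_ker P' d'" using cP'(4)[OF w av] by (simp add: mod_ker_def)
      moreover have "w = \<alpha> v + (w - \<alpha> v)" by simp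
      ultimately show "w \<in> {x + y | x y. x \<in> \<alpha> ` mcar P \<and> y \<in> mod_ker P' d'}" using v(1) by blast
    qed
    moreover have "{x + y | x y. x \<in> \<alpha> ` mcar P \<and> y \<in> mod_ker P' d'} \<subseteq> mcar P'"
      using mod_homD(1)[OF \<alpha>] cP'(2) by (auto simp: mod_ker_def)
    ultimately show ?thesis
      using min' submodule_image[OF rP rP' \<alpha> submodule_mcar[OF rP]] unfolding superfluous_def by blast
  qed
  have id: "mod_hom A P' P' (\<lambda>v. v)" by (simp add: mod_hom_def)
  obtain s where s: "mod_hom A P' P s" and \<alpha>s: "\<And>v. v \<in> mcar P' \<Longrightarrow> \<alpha> (s v) = v"
    by (rule projective_lift[OF P' rP rP' \<alpha> onto id]) blast
  have onto_s: "s ` mcar P' = mcar P"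
  proof -
    have "mcar P \<subseteq> {x + y | x y. x \<in> s ` mcar P' \<and> y \<in> mod_ker P d}"
    proof
      fix v assume v: "v \<in> mcar P"
      have av: "\<alpha> v \<in> mcar P'" using v mod_homD(1)[OF \<alpha>] by simp
      have sav: "s (\<alpha> v) \<in> mcar P" using av mod_homD(1)[OF s] by simp
      have vs: "v - s (\<alpha> v) \<in> mcar P" using cP(4)[OF v sav] .
      have "\<alpha> (v - s (\<alpha> v)) = 0" using mod_hom_diff[OF \<alpha> sP v sav] \<alpha>s[OF av] by simp
      then have "\<theta> (d (v - s (\<alpha> v))) = d' 0" using comm[OF vs] by simp
      also have "d' 0 = 0" using mod_hom_zero[OF d'(1) av] .
      finally have "d (v - s (\<alpha> v)) = 0" using \<theta>0 mod_homD(1)[OF d(1) vs] by blast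
      then have "v - s (\<alpha> v) \<in> mod_ker P d" using vs by (simp add: mod_ker_def)
      moreover have "v = s (\<alpha> v) + (v - s (\<alpha> v))" by simp
      ultimately show "v \<in> {x + y | x y. x \<in> s ` mcar P' \<and> y \<in> mod_ker P d}" using av by blast
    qed
    moreover have "{x + y | x y. x \<in> s ` mcar P' \<and> y \<in> mod_ker P d} \<subseteq> mcar P"
      using mod_homD(1)[OF s] cP(2) by (auto simp: mod_ker_def)
    ultimately show ?thesis
      using min submodule_image[OF rP' rP s submodule_mcar[OF rP']] unfolding superfluous_def by blast
  qed
  have inj: "inj_on \<alpha> (mcar P)"
  proof (rule inj_onI)
    fix v w assume vw: "v \<in> mcar P" "w \<in> mcar P" "\<alpha> v = \<alpha> w"
    obtain v' w' where "v' \<in> mcar P'" "w' \<in> mcar P'" "v = s v'" "w = s w'" using vw(1,2) onto_s by blast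
    then show "v = w" using \<alpha>s vw(3) by metis
  qed
  have "\<alpha> ` mod_ker P d = mod_ker P' d'"
  proof
    show "\<alpha> ` mod_ker P d \<subseteq> mod_ker P' d'"
    proof clarify
      fix v assume "v \<in> mod_ker P d"
      then have v: "v \<in> mcar P" "d v = 0" by (simp_all add: mod_ker_def)
      have "\<theta> 0 = 0" using mod_hom_zero[OF \<theta>(1) module_closed(1)[OF X]] .
      then show "\<alpha> v \<in> mod_ker P' d'" using v comm mod_homD(1)[OF \<alpha>] by (simp add: mod_ker_def)
    qed
    show "mod_ker P' d' \<subseteq> \<alpha> ` mod_ker P d"
    proof
      fix w assume "w \<in> mod_ker P' d'"
      then have w: "w \<in> mcar P'" "d' w = 0" by (simp_all add: mod_ker_def)
      then obtain v where v: "v \<in> mcar P" "w = \<alpha> v" using onto by blast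
      then have "d v = 0" using comm w \<theta>0 mod_homD(1)[OF d(1)] by metis
      then show "w \<in> \<alpha> ` mod_ker P d" using v by (simp add: mod_ker_def)
    qed
  qed
  moreover have "inj_on \<alpha> (mod_ker P d)" using inj by (rule inj_on_subset) (auto simp: mod_ker_def)
  moreover have "mod_hom A (P\<lparr>mcar := mod_ker P d\<rparr>) (P'\<lparr>mcar := mod_ker P' d'\<rparr>) \<alpha>"
    using calculation(1) by (intro mod_hom_restrict[OF \<alpha>]) (auto simp: mod_ker_def)
  ultimately show ?thesis unfolding mod_iso_def bij_betw_def by (intro exI[of _ \<alpha>]) simp
qed

text \<open>The definition of \<open>syzygy\<close> picks an arbitrary minimal resolution; this
  makes any other one usable in its place. In the induction the kernel at stage \<open>i\<close> is
  the module covered at stage \<open>Suc i\<close>.\<close>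

lemma minimal_resolution_kernel_iso:
  fixes A :: "('k::field, 'a::ring) vertex_algebra"
  assumes M: "right_module A M"
    and R: "minimal_projective_resolution A M P d" and R': "minimal_projective_resolution A M P' d'"
  shows "mod_iso A ((P i)\<lparr>mcar := mod_ker (P i) (d i)\<rparr>) ((P' i)\<lparr>mcar := mod_ker (P' i) (d' i)\<rparr>)"
proof (induction i)
  case 0
  show ?case
    by (rule projective_cover_kernel_iso[OF minimal_resolutionD(1)[OF R] minimal_resolutionD(1)[OF R'] M M
          minimal_resolutionD(2,3)[OF R] minimal_resolutionD(2,3)[OF R'] minimal_resolutionD(6)[OF R]
          minimal_resolutionD(6)[OF R'] mod_iso_refl])
next
  case (Suc i)
  have *: "right_module A ((P i)\<lparr>mcar := mod_ker (P i) (d i)\<rparr>) \<and>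
      mod_hom A (P (Suc i)) ((P i)\<lparr>mcar := mod_ker (P i) (d i)\<rparr>) (d (Suc i)) \<and>
      d (Suc i) ` mcar (P (Suc i)) = mcar ((P i)\<lparr>mcar := mod_ker (P i) (d i)\<rparr>)"
    if R: "minimal_projective_resolution A M P d" for P d
  proof -
    note D = minimal_resolutionD[OF R]
    have rP: "right_module A (P j)" for j by (rule projective_right_module[OF D(1)])
    have "submodule A (mod_ker (P i) (d i)) (P i)"
    proof (cases i)
      case 0
      then show ?thesis using submodule_ker[OF rP M D(2)] by simp
    next
      case (Suc j)
      then show ?thesis using submodule_ker[OF rP rP D(4)] by simp
    qed
    moreover have "mod_hom A (P (Suc i)\<lparr>mcar := mcar (P (Suc i))\<rparr>) ((P i)\<lparr>mcar := mod_ker (P i) (d i)\<rparr>) (d (Suc i))"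
      using D(5) by (intro mod_hom_restrict[OF D(4)]) auto
    ultimately show ?thesis using submodule_right_module[OF rP] D(5) by simp
  qed
  note 1 = *[OF R, THEN conjunct1] *[OF R, THEN conjunct2, THEN conjunct1] *[OF R, THEN conjunct2, THEN conjunct2]
  note 2 = *[OF R', THEN conjunct1] *[OF R', THEN conjunct2, THEN conjunct1] *[OF R', THEN conjunct2, THEN conjunct2]
  show ?case
    by (rule projective_cover_kernel_iso[OF minimal_resolutionD(1)[OF R] minimal_resolutionD(1)[OF R'] 1(1) 2(1)
          1(2,3) 2(2,3) minimal_resolutionD(6)[OF R] minimal_resolutionD(6)[OF R'] Suc.IH])
qed

section \<open>The minimal resolution of a simple module\<close>

context nakayama
begin

text \<open>The syzygy of degree \<open>i\<close> of the simple module at \<open>a\<close> is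
  \<open>J (zs a i) (zs a (Suc i))\<close>. The sequence interleaves the iterates of
  \<open>f\<close> at \<open>a\<close> and at \<open>Suc a\<close>. It is frozen as soon as such an
  interval is empty, because applying \<open>f\<close> further would create nonzero modules beyond
  the end of the resolution.\<close>

fun zs :: "nat \<Rightarrow> nat \<Rightarrow> nat" where
  "zs a 0 = a"
| "zs a (Suc 0) = Suc a"
| "zs a (Suc (Suc i)) = (if zs a i < zs a (Suc i) then f (zs a i) else zs a (Suc i))"

lemma zs_bounds: "zs a i \<le> zs a (Suc i) \<and> zs a (Suc i) \<le> f (zs a i)"
proof (induction i)
  case 0
  then show ?case using f_gt by (simp add: Suc_leI)
next
  case (Suc i)
  then show ?case using f_mono[of "zs a i" "zs a (Suc i)"] f_gt[of "zs a (Suc i)"] by auto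
qed

lemma zs_mono: "zs a i \<le> zs a (Suc i)"
  using zs_bounds by blast

lemma zs_stationary:
  assumes "zs a i = zs a (Suc i)"
  shows "i \<le> j \<Longrightarrow> zs a j = zs a i \<and> zs a (Suc j) = zs a i"
proof (induction j rule: dec_induct)
  case base
  then show ?case using assms by simp
next
  case (step j)
  then show ?case by simp
qed

text \<open>The projective cover of the \<open>i\<close>-th syzygy: its upper end is
  \<open>f (zs a i)\<close> as long as the syzygy is nonzero, and afterwards the interval is
  empty.\<close>

definition simple_res :: "nat \<Rightarrow> nat \<Rightarrow> ('k, 'a) rmod" where
  "simple_res a i = J (zs a i) (zs a (Suc (Suc i)))"

text \<open>In degree 0 the projection is followed by a chosen isomorphism \<open>\<theta>\<close>
  to the simple module, which is known only up to isomorphism. In higher degree the truncation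
  projects onto the syzygy, which is a tail of the preceding term.\<close>

definition simple_res_map :: "nat \<Rightarrow> ('k uvec \<Rightarrow> 'k uvec) \<Rightarrow> nat \<Rightarrow> 'k uvec \<Rightarrow> 'k uvec" where
  "simple_res_map a \<theta> i = (case i of 0 \<Rightarrow> (\<lambda>v. \<theta> (trunc (Suc a) v)) | Suc j \<Rightarrow> trunc (zs a (Suc i)))"

lemma projective_simple_res: "projective_module A (simple_res a i)"
proof (cases "zs a i < zs a (Suc i)")
  case True
  then show ?thesis using projective_J by (simp add: simple_res_def)
next
  case False
  then have "zs a (Suc i) = zs a i" using zs_mono[of a i] by simp
  then show ?thesis using projective_zero by (simp add: simple_res_def)
qed

lemma minimal_resolution_simple:
  assumes S: "right_module A S" and \<theta>: "mod_hom A (J a (Suc a)) S \<theta>" "bij_betw \<theta> (mcar (J a (Suc a))) (mcar S)"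
  shows "minimal_projective_resolution A S (simple_res a) (simple_res_map a \<theta>)"
    and "mod_ker (simple_res a i) (simple_res_map a \<theta> i) = mcar (J (zs a (Suc i)) (zs a (Suc (Suc i))))"
proof -
  let ?P = "simple_res a" and ?d = "simple_res_map a \<theta>"
  have "right_module A (J a (Suc a))" using simple_J by (simp add: simple_module_def)
  note \<theta>0 = mod_hom_bij_eq_0_iff[OF \<theta> this]
  have mono: "zs a i \<le> zs a (Suc i)" "zs a (Suc i) \<le> zs a (Suc (Suc i))" for i by (rule zs_mono)+
  have tr0: "mod_hom A (?P 0) (J a (Suc a)) (trunc (Suc a))"
    unfolding simple_res_def using mod_hom_trunc[of a a "Suc a" "zs a (Suc (Suc 0))"] mono[of 0] by simp
  have ker: "mod_ker (?P i) (?d i) = mcar (J (zs a (Suc i)) (zs a (Suc (Suc i))))" for i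
  proof (cases i)
    case 0
    have "mod_ker (?P 0) (?d 0) = {v \<in> mcar (?P 0). trunc (Suc a) v = 0}"
      using \<theta>0 mod_homD(1)[OF tr0] by (auto simp: mod_ker_def simple_res_map_def)
    then show ?thesis
      using 0 trunc_kernel[of a "Suc a" "zs a (Suc (Suc 0))"] mono[of 0] by (simp add: simple_res_def)
  next
    case (Suc j)
    then show ?thesis
      using trunc_kernel[of "zs a i" "zs a (Suc i)" "zs a (Suc (Suc i))"] mono[of i]
      by (simp add: simple_res_def simple_res_map_def mod_ker_def del: zs.simps)
  qed
  then show "mod_ker (?P i) (?d i) = mcar (J (zs a (Suc i)) (zs a (Suc (Suc i))))" .
  have res: "projective_resolution A S ?P ?d"
    unfolding projective_resolution_def
  proof (intro conjI allI)
    fix i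
    show "projective_module A (?P i)" by (rule projective_simple_res)
    show "mod_hom A (?P 0) S (?d 0)"
      using mod_hom_comp[OF tr0 \<theta>(1)] by (simp add: simple_res_map_def)
    have "trunc (Suc a) ` mcar (?P 0) = mcar (J a (Suc a))"
      unfolding simple_res_def using trunc_image[of "Suc a" "zs a (Suc (Suc 0))" a] mono[of 0] by simp
    then show "?d 0 ` mcar (?P 0) = mcar S"
      using \<theta>(2) by (simp add: simple_res_map_def bij_betw_def flip: image_image)
    let ?z = "zs a (Suc (Suc i))"
    have d: "?d (Suc i) = trunc ?z" by (simp add: simple_res_map_def del: zs.simps)
    show "mod_hom A (?P (Suc i)) (?P i) (?d (Suc i))"
      unfolding d simple_res_def using mono[of i] mono[of "Suc i"] by (intro mod_hom_trunc)
    show "?d (Suc i) ` mcar (?P (Suc i)) = mod_ker (?P i) (?d i)"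
      unfolding d ker using mono[of "Suc i"] trunc_image[of ?z "zs a (Suc (Suc (Suc i)))" "zs a (Suc i)"]
      by (simp add: simple_res_def del: zs.simps)
  qed
  have "superfluous A (mod_ker (?P i) (?d i)) (?P i)" for i
    unfolding superfluous_def ker
  proof (intro allI impI)
    fix L assume L: "submodule A L (?P i)"
      and sum: "{x + y | x y. x \<in> L \<and> y \<in> mcar (J (zs a (Suc i)) (zs a (Suc (Suc i))))} = mcar (?P i)"
    show "L = mcar (?P i)"
    proof (cases "zs a i < zs a (Suc i)")
      case True
      let ?x = "zs a i"
      have P: "?P i = J ?x (f ?x)" using True by (simp add: simple_res_def)
      have "sng ?x \<in> mcar (?P i)" unfolding P using f_gt by (simp add: single_in_Itv)
      \<comment> \<open>The kernel has no coordinate at the top position, so the summand from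
        \<open>L\<close> must supply it and thereby generates the whole term.\<close>
      then obtain v w where vw: "sng ?x = v + w" "v \<in> L" "w \<in> mcar (J (zs a (Suc i)) (zs a (Suc (Suc i))))"
        unfolding sum[symmetric] by blast
      have "lkp w ?x = 0" using vw(3) True by (auto simp: in_Itv_iff)
      then have "lkp v ?x = lkp (sng ?x) ?x" using vw(1) by (simp add: lookup_add)
      then have "lkp v ?x \<noteq> 0" by simp
      then show ?thesis using submodule_J_eq_top[OF L[unfolded P] _ vw(2)] P by simp
    next
      case False
      then have "zs a (Suc i) = zs a i" using zs_mono[of a i] by simp
      then have "mcar (?P i) = {0}" by (simp add: simple_res_def mcar_J_empty)
      then show ?thesis using L pm.subspace_0[of L] by (auto simp: submodule_def)
    qed
  qed
  then show "minimal_projective_resolution A S ?P ?d"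
    using res by (simp add: minimal_projective_resolution_def)
qed

lemma syzygy_simple:
  "mod_iso A (syzygy A (Suc i) (simple_at A (vt n a))) (J (zs a (Suc i)) (zs a (Suc (Suc i))))"
proof -
  let ?S = "simple_at A (vt n a)"
  have S: "right_module A ?S" by (rule right_module_simple_at)
  obtain \<theta> where \<theta>: "mod_hom A (J a (Suc a)) ?S \<theta>" "bij_betw \<theta> (mcar (J a (Suc a))) (mcar ?S)"
    using J_iso_simple_at[of a] by (auto simp: mod_iso_def)
  note res = minimal_resolution_simple[OF S \<theta>]
  define Pd where "Pd = (SOME (P, d). minimal_projective_resolution A ?S P d)"
  have "\<exists>Pd. case Pd of (P, d) \<Rightarrow> minimal_projective_resolution A ?S P d"
    using res(1) by (intro exI[of _ "(simple_res a, simple_res_map a \<theta>)"]) simp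
  then have "case Pd of (P, d) \<Rightarrow> minimal_projective_resolution A ?S P d"
    unfolding Pd_def by (rule someI_ex)
  then obtain P d where Pd: "Pd = (P, d)" "minimal_projective_resolution A ?S P d" by (cases Pd) auto
  have "syzygy A (Suc i) ?S = (P i)\<lparr>mcar := mod_ker (P i) (d i)\<rparr>"
    using Pd(1) by (simp add: Pd_def)
  moreover have "(simple_res a i)\<lparr>mcar := mod_ker (simple_res a i) (simple_res_map a \<theta> i)\<rparr> =
      J (zs a (Suc i)) (zs a (Suc (Suc i)))"
    unfolding res(2) by (simp add: simple_res_def del: zs.simps)
  ultimately show ?thesis using minimal_resolution_kernel_iso[OF S Pd(2) res(1), of i] by simp
qed

text \<open>Once an interval in the sequence is empty, all terms from degree \<open>i\<close> on are
  zero. In contrapositive form, projective dimension at least \<open>2 * m\<close> keeps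
  \<open>zs\<close> strictly increasing through step \<open>2 * m\<close>.\<close>

lemma proj_dim_simple_less:
  assumes "zs a i = zs a (Suc i)" "i > 0"
  shows "proj_dim A (simple_at A (vt n a)) \<le> enat (i - 1)"
proof -
  let ?S = "simple_at A (vt n a)"
  obtain \<theta> where \<theta>: "mod_hom A (J a (Suc a)) ?S \<theta>" "bij_betw \<theta> (mcar (J a (Suc a))) (mcar ?S)"
    using J_iso_simple_at[of a] by (auto simp: mod_iso_def)
  have "projective_resolution A ?S (simple_res a) (simple_res_map a \<theta>)"
    using minimal_resolution_simple(1)[OF right_module_simple_at \<theta>] by (simp add: minimal_projective_resolution_def)
  moreover have "mcar (simple_res a j) = {0}" if "j > i - 1" for j
  proof -
    have "i \<le> j" "i \<le> Suc j" using that assms(2) by simp_all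
    then have "zs a j = zs a i" "zs a (Suc (Suc j)) = zs a i"
      using zs_stationary[OF assms(1)] by blast+
    then show ?thesis by (simp add: simple_res_def mcar_J_empty del: zs.simps)
  qed
  ultimately show ?thesis unfolding proj_dim_def by (intro Inf_lower CollectI exI[of _ "i - 1"]) blast
qed

lemma zs_iterate:
  assumes "\<And>i. i \<le> 2 * m \<Longrightarrow> zs a i < zs a (Suc i)"
  shows "k \<le> m \<Longrightarrow> zs a (2 * k) = (f ^^ k) a \<and> zs a (Suc (2 * k)) = (f ^^ k) (Suc a)"
proof (induction k)
  case (Suc k)
  have IH: "zs a (2 * k) = (f ^^ k) a" "zs a (Suc (2 * k)) = (f ^^ k) (Suc a)" using Suc by simp_all
  have "zs a (2 * k) < zs a (Suc (2 * k))" "zs a (Suc (2 * k)) < zs a (Suc (Suc (2 * k)))"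
    using assms[of "2 * k"] assms[of "Suc (2 * k)"] Suc.prems by linarith+
  then show ?case unfolding IH[symmetric] funpow.simps o_apply by simp
qed simp

lemma syzygy_simple_even:
  assumes m: "m > 0" and pd: "proj_dim A (simple_at A (vt n a)) \<ge> enat (2 * m)"
  shows "mod_iso A (syzygy A (2 * m) (simple_at A (vt n a))) (J ((f ^^ m) a) ((f ^^ m) (Suc a)))"
    and "(f ^^ m) a < (f ^^ m) (Suc a)"
proof -
  have lt: "zs a i < zs a (Suc i)" if "i \<le> 2 * m" for i
  proof (rule ccontr)
    assume "\<not> zs a i < zs a (Suc i)"
    then have e: "zs a i = zs a (Suc i)" using zs_mono[of a i] by simp
    \<comment> \<open>Step 0 never degenerates, as it goes from \<open>a\<close> to
      \<open>Suc a\<close>.\<close>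
    have "i > 0" by (rule ccontr) (use e in simp)
    then have "enat (2 * m) \<le> enat (i - 1)" using proj_dim_simple_less[OF e] pd by (metis order_trans)
    then show False using \<open>i > 0\<close> that by simp
  qed
  have z: "zs a (2 * m) = (f ^^ m) a" "zs a (Suc (2 * m)) = (f ^^ m) (Suc a)"
    using zs_iterate[OF lt, of m m] by simp_all
  show "(f ^^ m) a < (f ^^ m) (Suc a)" using lt[of "2 * m"] z by (simp del: zs.simps)
  obtain k where "2 * m = Suc k" using m by (cases "2 * m") auto
  then show "mod_iso A (syzygy A (2 * m) (simple_at A (vt n a))) (J ((f ^^ m) a) ((f ^^ m) (Suc a)))"
    using syzygy_simple[of k a] z by (simp del: zs.simps syzygy.simps)
qed

end

section \<open>Injective envelopes\<close>

lemma injective_lift: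
  assumes I: "injective_module A I" and "right_module A M" "right_module A N"
    and "mod_hom A M N g" "inj_on g (mcar M)" "mod_hom A M I k"
  obtains h where "mod_hom A N I h" "\<And>v. v \<in> mcar M \<Longrightarrow> h (g v) = k v"
proof -
  have "\<forall>M N f g. right_module A M \<longrightarrow> right_module A N \<longrightarrow> mod_hom A M N f \<longrightarrow> inj_on f (mcar M) \<longrightarrow>
        mod_hom A M I g \<longrightarrow> (\<exists>h. mod_hom A N I h \<and> (\<forall>v\<in>mcar M. h (f v) = g v))"
    using I by (simp add: injective_module_def)
  from this[rule_format, OF assms(2-6)] that show ?thesis by auto
qed

text \<open>The image of \<open>g\<close> is essential, so a nonzero kernel of \<open>h\<close>
  would meet it in a nonzero element, which the condition on \<open>h\<close> excludes.\<close>

lemma essential_extension_injective: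
  assumes S: "right_module A S" and I: "right_module A I" and I': "right_module A I'"
    and g: "\<And>L. submodule A L I \<Longrightarrow> L \<noteq> {0} \<Longrightarrow> L \<inter> g ` mcar S \<noteq> {0}" "mod_hom A S I g"
    and h: "mod_hom A I I' h" "\<And>v. v \<in> mcar S \<Longrightarrow> h (g v) = 0 \<Longrightarrow> g v = 0"
  shows "inj_on h (mcar I)"
proof -
  have "mod_ker I h = {0}"
  proof (rule ccontr)
    assume "mod_ker I h \<noteq> {0}"
    then have "mod_ker I h \<inter> g ` mcar S \<noteq> {0}" using submodule_ker[OF I I' h(1)] g(1) by blast
    moreover have "mod_ker I h \<inter> g ` mcar S \<subseteq> {0}" using h(2) by (auto simp: mod_ker_def)
    moreover have "g 0 = 0" "h 0 = 0"
      using mod_hom_zero[OF g(2) module_closed(1)[OF S]] mod_hom_zero[OF h(1) module_closed(1)[OF I]] .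
    then have "0 \<in> mod_ker I h \<inter> g ` mcar S"
      using module_closed(1)[OF S] module_closed(1)[OF I]
      by (auto simp: mod_ker_def intro!: rev_image_eqI[of 0])
    ultimately show False by blast
  qed
  then show ?thesis by (intro inj_on_ker[OF I h(1)]) (auto simp: mod_ker_def)
qed

text \<open>The number \<open>q_a\<close> is read off from an arbitrarily chosen envelope, so its
  value must not depend on the choice. Extending both embeddings gives \<open>h\<close> and
  \<open>k\<close> with \<open>k\<close> after \<open>h\<close> the identity; essentiality makes
  \<open>k\<close> injective, hence \<open>h\<close> is onto.\<close>

lemma injective_envelope_dim:
  assumes S: "right_module A S" and I: "is_injective_envelope A S I" and I': "is_injective_envelope A S I'"
  shows "pm.dim (mcar I') = pm.dim (mcar I)"
proof -
  obtain g where g: "injective_module A I" "mod_hom A S I g" "inj_on g (mcar S)"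
    "\<And>L. submodule A L I \<Longrightarrow> L \<noteq> {0} \<Longrightarrow> L \<inter> g ` mcar S \<noteq> {0}"
    using I unfolding is_injective_envelope_def by auto
  obtain g' where g': "injective_module A I'" "mod_hom A S I' g'" "inj_on g' (mcar S)"
    "\<And>L. submodule A L I' \<Longrightarrow> L \<noteq> {0} \<Longrightarrow> L \<inter> g' ` mcar S \<noteq> {0}"
    using I' unfolding is_injective_envelope_def by auto
  have r: "right_module A I" "right_module A I'" using g(1) g'(1) by (simp_all add: injective_module_def)
  have S0: "0 \<in> mcar S" using module_closed(1)[OF S] .
  have g0: "g 0 = 0" "g' 0 = 0" using mod_hom_zero[OF g(2) S0] mod_hom_zero[OF g'(2) S0] .
  have gz: "v = 0" if "v \<in> mcar S" "g v = 0 \<or> g' v = 0" for v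
    using that S0 g0 inj_onD[OF g(3), of v 0] inj_onD[OF g'(3), of v 0] by auto
  obtain h where h: "mod_hom A I I' h" "\<And>v. v \<in> mcar S \<Longrightarrow> h (g v) = g' v"
    by (rule injective_lift[OF g'(1) S r(1) g(2,3) g'(2)]) blast
  have inj_h: "inj_on h (mcar I)"
    by (rule essential_extension_injective[OF S r g(4) g(2) h(1)]) (use h(2) gz g0 in force)+
  have id: "mod_hom A I I (\<lambda>v. v)" by (simp add: mod_hom_def)
  obtain k where k: "mod_hom A I' I k" "\<And>v. v \<in> mcar I \<Longrightarrow> k (h v) = v"
    by (rule injective_lift[OF g(1) r h(1) inj_h id]) blast
  have kg: "k (g' v) = g v" if "v \<in> mcar S" for v
    using k(2)[OF mod_homD(1)[OF g(2) that]] h(2)[OF that] by simp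
  have inj_k: "inj_on k (mcar I')"
    by (rule essential_extension_injective[OF S r(2,1) g'(4) g'(2) k(1)]) (use kg gz g0 in force)+
  have "w \<in> h ` mcar I" if w: "w \<in> mcar I'" for w
  proof -
    have kw: "k w \<in> mcar I" using mod_homD(1)[OF k(1) w] .
    then have "k (h (k w)) = k w" by (rule k(2))
    then have "h (k w) = w" using inj_onD[OF inj_k] mod_homD(1)[OF h(1) kw] w by blast
    then show ?thesis using kw by (metis imageI)
  qed
  then have "h ` mcar I = mcar I'" using mod_homD(1)[OF h(1)] by blast
  then have "bij_betw h (mcar I) (mcar I')" using inj_h by (simp add: bij_betw_def)
  then show ?thesis
    by (intro dim_bij_linear[of "mcar I" h]) (simp_all add: moduleD(1)[OF r(1)] mod_homD[OF h(1)])
qed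

section \<open>Injective envelopes of simple modules as intervals\<close>

context nakayama
begin

text \<open>Every linear functional \<open>\<kappa>\<close> on \<open>M e\<^sub>b\<close> comes from a homomorphism \<open>M \<rightarrow> J (Suc c) (Suc b)\<close>: this is the
  duality between right modules and left modules, with the interval module as the dual of \<open>A e\<^sub>b\<close>.\<close>

definition cogen :: "('k, 'a) rmod \<Rightarrow> ('k uvec \<Rightarrow> 'k) \<Rightarrow> nat \<Rightarrow> nat \<Rightarrow> 'k uvec \<Rightarrow> 'k uvec" where
  "cogen M \<kappa> c b v = Abs_poly_mapping (\<lambda>j. if c < j \<and> j \<le> b then \<kappa> (mact M v (u j (b - j))) else 0)"

lemma lookup_cogen: "lkp (cogen M \<kappa> c b v) j = (if c < j \<and> j \<le> b then \<kappa> (mact M v (u j (b - j))) else 0)"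
proof -
  have "finite {j. (if c < j \<and> j \<le> b then \<kappa> (mact M v (u j (b - j))) else 0) \<noteq> 0}"
    by (rule finite_subset[of _ "{..b}"]) (auto split: if_splits)
  then show ?thesis by (simp add: cogen_def)
qed

text \<open>The path of length \<open>l\<close> into position \<open>j\<close> starts at
  \<open>j - l\<close>, which is at most \<open>c\<close>. Continued up to \<open>b\<close> it is
  zero, because monotonicity gives \<open>f (j - l) \<le> f c \<le> b\<close>.\<close>

lemma u_into_zero:
  assumes b: "f c \<le> b" and j: "j \<le> b" and s: "vt n (s + l) = vt n j" and le: "j \<le> c + l"
  shows "u s (l + (b - j)) = 0"
proof -
  \<comment> \<open>The position \<open>j - l\<close> can be negative, so it is translated by the
    multiple \<open>l * n\<close> of the period.\<close>
  define i where "i = j + l * n - l"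
  have ln: "l \<le> l * n" by (simp add: Suc_leI)
  then have i: "i + l = j + l * n" unfolding i_def by linarith
  have "vt n (i + l) = vt n (s + l)" using s i by simp
  then have "vt n i = vt n s" by (simp add: vt_add_cancel)
  then have "p s = p i" using p_eq by metis
  have "i \<le> c + l * n" using i le by linarith
  then have "f i \<le> f (c + l * n)" by (rule f_mono)
  also have "\<dots> \<le> b + l * n" using b by (simp add: f_add_mult)
  finally have "i + p i \<le> b + l * n" by (simp add: f_def)
  then have "p i \<le> l + (b - j)" using i j by linarith
  then show ?thesis using \<open>p s = p i\<close> by (simp add: u_zero)
qed

text \<open>The bounds say that \<open>c\<close> is the last position below \<open>b\<close> from
  which the path to \<open>b\<close> is zero, so the interval consists of the positions with a
  nonzero path to \<open>b\<close>.\<close>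

lemma mod_hom_cogen:
  assumes M: "right_module A M" and \<kappa>: "Vector_Spaces.linear scale_pm (*) \<kappa>"
    and b: "f c \<le> b" "b < f (Suc c)"
  shows "mod_hom A M (J (Suc c) (Suc b)) (cogen M \<kappa> c b)"
proof -
  interpret \<kappa>: Vector_Spaces.linear scale_pm "(*)" \<kappa> by (rule \<kappa>)
  note Md = moduleD[OF M]
  show ?thesis
  proof (rule mod_hom_basisI_full[OF M right_module_J])
    fix v :: "'k uvec" and s l assume v: "v \<in> mcar M" and l: "l < p s"
    show "cogen M \<kappa> c b (mact M v (u s l)) = mact (J (Suc c) (Suc b)) (cogen M \<kappa> c b v) (u s l)"
    proof (rule poly_mapping_eqI)
      fix j
      have act: "mact M (mact M v (u s l)) (u j k) = mact M v (u s l * u j k)" for k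
        by (rule Md(7)[OF v u_in_elems u_in_elems])
      have zero: "\<kappa> (mact M v 0) = 0"
        using mact_u_zero[OF M v order_refl, of s] u_zero[OF order_refl, of s] \<kappa>.zero by simp
      \<comment> \<open>The coordinate at \<open>j\<close> depends on the path into
        \<open>j\<close>: it may end at another vertex (\<open>ne\<close>), start below the interval
        (\<open>low\<close>, where \<open>u_into_zero\<close> makes the algebra side vanish too), or
        run inside the interval (\<open>high\<close>).\<close>
      consider (out) "\<not> (c < j \<and> j \<le> b)" | (ne) "c < j" "j \<le> b" "vt n (s + l) \<noteq> vt n j"
        | (low) "c < j" "j \<le> b" "vt n (s + l) = vt n j" "j \<le> c + l"
        | (high) "c < j" "j \<le> b" "vt n (s + l) = vt n j" "c + l < j" by linarith
      then show "lkp (cogen M \<kappa> c b (mact M v (u s l))) j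
          = lkp (mact (J (Suc c) (Suc b)) (cogen M \<kappa> c b v) (u s l)) j"
      proof cases
        case out
        then show ?thesis by (auto simp: lookup_cogen lookup_act_u)
      next
        case ne
        have "vt n (j - l) \<noteq> vt n s" if "l \<le> j"
          using ne(3) that vt_add_cancel[OF n_pos, of "j - l" l s] by auto
        then show ?thesis using ne by (auto simp: lookup_cogen lookup_act_u act u_mult zero)
      next
        case low
        then have "u s (l + (b - j)) = 0" by (intro u_into_zero[OF b(1)])
        then show ?thesis using low by (auto simp: lookup_cogen lookup_act_u act u_mult zero)
      next
        case high
        then have "l \<le> j" by simp
        then have e: "vt n (j - l) = vt n s"
          using high(3) vt_add_cancel[OF n_pos, of "j - l" l s] by simp
        have "b - (j - l) = l + (b - j)" using high \<open>l \<le> j\<close> by simp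
        then have "u (j - l) (b - (j - l)) = u s (l + (b - j))" using u_eq[OF e] by simp
        moreover have "c < j - l" "j - l \<le> b" using high by simp_all
        ultimately show ?thesis using high e l \<open>l \<le> j\<close>
          by (simp add: lookup_cogen lookup_act_u act u_mult)
      qed
    qed
  qed (use b in \<open>auto simp: in_Itv_iff lookup_cogen lookup_add lookup_scale_pm Md u_in_elems \<kappa>.add \<kappa>.scale
         intro!: poly_mapping_eqI split: if_splits\<close>)
qed

text \<open>A map \<open>g\<close> into this interval is determined by its coordinate at the socle
  position \<open>b\<close>: the coordinate of \<open>g v\<close> at \<open>j\<close> is that of
  \<open>g (mact M v (u j (b - j)))\<close> at \<open>b\<close>. It therefore suffices to extend one
  linear functional from the image of \<open>h\<close> to \<open>N\<close>.\<close>

lemma injective_J: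
  assumes b: "f c \<le> b" "b < f (Suc c)"
  shows "injective_module A (J (Suc c) (Suc b))"
  unfolding injective_module_def
proof (intro conjI allI impI)
  show rI: "right_module A (J (Suc c) (Suc b))" using b by (intro right_module_J) simp
  fix M N :: "('k, 'a) rmod" and h g
  assume M: "right_module A M" and N: "right_module A N" and h: "mod_hom A M N h" "inj_on h (mcar M)"
    and g: "mod_hom A M (J (Suc c) (Suc b)) g"
  let ?K = "h ` mcar M" and ?\<mu> = "\<lambda>w. lkp (g (inv_into (mcar M) h w)) b"
  have inv: "inv_into (mcar M) h (h v) = v" if "v \<in> mcar M" for v using h(2) that by simp
  note Mc = module_closed[OF M]
  have subK: "pm.subspace ?K"
    using submodule_image[OF M N h(1) submodule_mcar[OF M]] by (simp add: submodule_def)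
  have add: "?\<mu> (x + y) = ?\<mu> x + ?\<mu> y" if xy: "x \<in> ?K" "y \<in> ?K" for x y
  proof -
    obtain v w where vw: "v \<in> mcar M" "x = h v" "w \<in> mcar M" "y = h w" using xy by auto
    then have "x + y = h (v + w)" using mod_homD(2)[OF h(1)] by simp
    then show ?thesis using vw inv Mc(2) by (simp add: mod_homD(2)[OF g] lookup_add)
  qed
  have scale: "?\<mu> (scale_pm r x) = r * ?\<mu> x" if x: "x \<in> ?K" for r x
  proof -
    obtain v where v: "v \<in> mcar M" "x = h v" using x by auto
    then have "scale_pm r x = h (scale_pm r v)" using mod_homD(3)[OF h(1)] by simp
    then show ?thesis using v inv Mc(3) by (simp add: mod_homD(3)[OF g] lookup_scale_pm)
  qed
  obtain \<kappa> where \<kappa>: "Vector_Spaces.linear scale_pm (*) \<kappa>" "\<And>w. w \<in> ?K \<Longrightarrow> \<kappa> w = ?\<mu> w"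
    by (rule linear_extend_from_subspace[of scale_pm "(*)" ?K ?\<mu>])
      (use subK add scale pm.vector_space_axioms vector_space_mult in blast)+
  have "cogen N \<kappa> c b (h v) = g v" if v: "v \<in> mcar M" for v
  proof (rule poly_mapping_eqI)
    fix j
    have gv: "g v \<in> mcar (J (Suc c) (Suc b))" using mod_homD(1)[OF g v] .
    show "lkp (cogen N \<kappa> c b (h v)) j = lkp (g v) j"
    proof (cases "c < j \<and> j \<le> b")
      case True
      let ?v = "mact M v (u j (b - j))"
      have v': "?v \<in> mcar M" using moduleD(2)[OF M v u_in_elems] .
      have "mact N (h v) (u j (b - j)) = h ?v" using mod_homD(4)[OF h(1) v u_in_elems] by simp
      then have "\<kappa> (mact N (h v) (u j (b - j))) = lkp (g ?v) b" using \<kappa>(2) v' inv by simp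
      also have "g ?v = act (Suc b) (g v) (u j (b - j))" using mod_homD(4)[OF g v u_in_elems] by simp
      also have "lkp \<dots> b = lkp (g v) j"
      proof -
        have "f (Suc c) \<le> f j" using True by (intro f_mono) simp
        then have "b < j + p j" using b(2) by (simp add: f_def)
        then have "b - j < p j" using True by linarith
        then show ?thesis using True by (simp add: lookup_act_u)
      qed
      finally show ?thesis using True by (simp add: lookup_cogen)
    next
      case False
      then have "lkp (g v) j = 0" using gv by (auto simp: in_Itv_iff)
      then show ?thesis using False by (auto simp: lookup_cogen)
    qed
  qed
  then show "\<exists>k. mod_hom A N (J (Suc c) (Suc b)) k \<and> (\<forall>v\<in>mcar M. k (h v) = g v)"
    using mod_hom_cogen[OF N \<kappa>(1) b] by blast
qed

text \<open>The socle is simple: a nonzero submodule contains the tail from its lowest position on,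
  hence the last position \<open>b\<close>, where the simple module is embedded.\<close>

lemma injective_envelope_J:
  assumes b: "f c \<le> b" "b < f (Suc c)"
  shows "is_injective_envelope A (simple_at A (vt n b)) (J (Suc c) (Suc b))"
proof -
  let ?S = "simple_at A (vt n b)"
  obtain \<theta> where \<theta>: "mod_hom A ?S (J b (Suc b)) \<theta>" "bij_betw \<theta> (mcar ?S) (mcar (J b (Suc b)))"
    using mod_iso_simple_at_J by (auto simp: mod_iso_def)
  have cb: "Suc c \<le> b" using b(1) f_gt[of c] by simp
  have y: "Suc b \<le> f (Suc c)" using b by simp
  have sub: "submodule A (mcar (J b (Suc b))) (J (Suc c) (Suc b))" using cb y by (rule submodule_J)
  have "mod_hom A (J b (Suc b)) (J (Suc c) (Suc b)) (\<lambda>v. v)"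
    using sub by (auto simp: mod_hom_def submodule_def)
  then have hom: "mod_hom A ?S (J (Suc c) (Suc b)) \<theta>" using mod_hom_comp[OF \<theta>(1)] by blast
  have "L \<inter> \<theta> ` mcar ?S \<noteq> {0}" if L: "submodule A L (J (Suc c) (Suc b))" "L \<noteq> {0}" for L
  proof -
    have "0 \<in> L" using L(1) pm.subspace_0 by (auto simp: submodule_def)
    then obtain v where v: "v \<in> L" "v \<noteq> 0" using L(2) by blast
    obtain i where i: "lkp v i \<noteq> 0" "\<And>j. j < i \<Longrightarrow> lkp v j = 0" using lowest_position[OF v(2)] by blast
    have "i \<le> b" using i(1) v(1) L(1) by (fastforce simp: submodule_def in_Itv_iff)
    then have "sng b \<in> mcar (J i (Suc b))" by (simp add: single_in_Itv)
    then have "sng b \<in> L" using submodule_contains_tail[OF L(1) y v(1) i] by blast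
    moreover have "sng b \<in> \<theta> ` mcar ?S" using \<theta>(2) by (simp add: bij_betw_def single_in_Itv)
    moreover have "sng b \<noteq> (0 :: 'k uvec)" by (rule sng_nonzero)
    ultimately show ?thesis by blast
  qed
  then show ?thesis
    unfolding is_injective_envelope_def using injective_J[OF b] hom \<theta>(2)
    by (intro conjI exI[of _ \<theta>]) (simp_all add: bij_betw_def)
qed

lemma inj_dimension:
  assumes b: "f c \<le> b" "b < f (Suc c)"
  shows "inj_dimension_at A (vt n b) = b - c"
proof -
  have "is_injective_envelope A (simple_at A (vt n b)) (injective_at A (vt n b))"
    unfolding injective_at_def using injective_envelope_J[OF b] by (rule someI)
  then have "inj_dimension_at A (vt n b) = pm.dim (mcar (J (Suc c) (Suc b)))"
    unfolding inj_dimension_at_def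
    by (intro injective_envelope_dim[OF right_module_simple_at injective_envelope_J[OF b]])
  also have "\<dots> = card {Suc c..<Suc b}" unfolding mcar_J by (rule dim_keys_subset)
  finally show ?thesis by simp
qed

section \<open>The map \<open>psi\<close> on lifted vertices\<close>

lemma cyc_pred_vt: "inv_into {1..n} (cyc_succ {1..n}) (vt n (Suc i)) = vt n i"
proof -
  have "inj_on (cyc_succ {1..n}) {1..n}"
  proof (rule inj_onI)
    fix a b assume ab: "a \<in> {1..n}" "b \<in> {1..n}" "cyc_succ {1..n} a = cyc_succ {1..n} b"
    then have "vt n (Suc a) = vt n (Suc b)"
      using cyc_succ_vt[OF n_pos, of a] cyc_succ_vt[OF n_pos, of b] vt_id by metis
    then have "vt n a = vt n b" using vt_add_cancel[OF n_pos, of a 1 b] by simp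
    then show "a = b" using ab vt_id by metis
  qed
  then have "inv_into {1..n} (cyc_succ {1..n}) (cyc_succ {1..n} (vt n i)) = vt n i"
    by (rule inv_into_f_f) (rule vt_in[OF n_pos])
  then show ?thesis by (simp only: cyc_succ_vt[OF n_pos])
qed

lemma cyc_pred_funpow_vt: "(inv_into {1..n} (cyc_succ {1..n}) ^^ l) (vt n (i + l)) = vt n i"
proof (induction l arbitrary: i)
  case (Suc l)
  have "(inv_into {1..n} (cyc_succ {1..n}) ^^ Suc l) (vt n (i + Suc l)) =
     inv_into {1..n} (cyc_succ {1..n}) ((inv_into {1..n} (cyc_succ {1..n}) ^^ l) (vt n (Suc i + l)))"
    by simp
  then show ?case by (simp only: Suc.IH cyc_pred_vt)
qed simp

lemma psi_vt:
  assumes b: "f c \<le> b" "b < f (Suc c)"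
  shows "psi A (vt n b) = vt n c"
proof -
  have "c \<le> b" using b(1) f_gt[of c] by simp
  then show ?thesis
    using cyc_pred_funpow_vt[of "b - c" c] by (simp only: psi_def inj_dimension[OF b] vert_A le_add_diff_inverse)
qed


section \<open>The corner algebras \<open>\<epsilon>\<^sup>m(A)\<close>\<close>

text \<open>Translates the successor defined by the order on \<open>V\<close> into steps along the
  cycle: it is the first vertex of \<open>V\<close> met when walking on from
  \<open>a\<close>.\<close>

lemma cyc_succ_corner:
  assumes a: "a \<in> {1..n}" and V: "V \<subseteq> {1..n}" and d: "d > 0" "vt n (a + d) \<in> V"
    and least: "\<And>e. 0 < e \<Longrightarrow> e < d \<Longrightarrow> vt n (a + e) \<notin> V"
  shows "cyc_succ V a = vt n (a + d)"
proof -
  have fin: "finite V" using V finite_subset by blast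
  have vV: "vt n b = b" if "b \<in> V" for b using that V vt_id by blast
  have le: "d \<le> e" if "0 < e" "vt n (a + e) \<in> V" for e
    using least[of e] that not_le by blast
  show ?thesis
  proof (cases "\<exists>b\<in>V. a < b")
    case True
    define b where "b = Min {b \<in> V. a < b}"
    have "b \<in> {b \<in> V. a < b}" unfolding b_def using True fin by (intro Min_in) auto
    then have b: "b \<in> V" "a < b" by simp_all
    then have "d \<le> b - a" using vV by (intro le) simp_all
    moreover have "b \<le> n" using b(1) V by auto
    ultimately have ad: "a + d \<le> b" "a + d \<in> {1..n}" using b a by auto
    then have "a + d \<in> {b \<in> V. a < b}" using d vt_id by auto
    then have "b \<le> a + d" unfolding b_def using fin by (intro Min_le) simp_all
    then have "b = vt n (a + d)" using ad vt_id by simp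
    then show ?thesis using True by (simp add: cyc_succ_def b_def)
  next
    case False
    \<comment> \<open>The walk wraps around: no vertex of \<open>V\<close> lies above
      \<open>a\<close>, so the least one is reached after \<open>n - a + b\<close> steps.\<close>
    define b where "b = Min V"
    have b: "b \<in> V" unfolding b_def using fin d(2) by (intro Min_in) auto
    have an: "a \<le> n" using a by simp
    have "vt n (a + (n - a + b)) = b" using an vV[OF b] vt_add_mult[OF n_pos, of b 1] by (simp add: add.commute)
    moreover have "b > 0" using b V by auto
    ultimately have "d \<le> n - a + b" using b by (intro le) simp_all
    then have ad: "a + d \<le> n + b" using an by simp
    have "\<not> a + d \<le> n"
    proof
      assume "a + d \<le> n"
      then have "a + d \<in> {1..n}" using a by simp
      then have "a + d \<in> V" using d(2) vt_id by metis
      then show False using False d(1) by auto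
    qed
    then obtain r where r: "a + d = r + n" "r > 0" by (metis add.commute less_imp_add_positive not_le)
    have "b \<le> n" using b V by auto
    then have "r \<in> {1..n}" using r ad by simp
    then have e: "vt n (a + d) = r" using r(1) vt_add_mult[OF n_pos, of r 1] vt_id by simp
    then have "b \<le> r" unfolding b_def using fin d(2) by (intro Min_le) simp_all
    then have "b = r" using r(1) ad by simp
    then show ?thesis using False e by (auto simp: cyc_succ_def b_def)
  qed
qed

text \<open>Walking \<open>m\<close> arrows of the full cycle amounts to one corner step for every
  position over \<open>V\<close> before the end. The induction goes back to the last such position,
  from which \<open>cyc_succ_corner\<close> leads to the end.\<close>

lemma cyc_succ_funpow_corner:
  assumes V: "V \<subseteq> {1..n}" and a: "a \<in> V"
  shows "vt n (a + m) \<in> V \<Longrightarrow> (cyc_succ V ^^ card {l. l < m \<and> vt n (a + l) \<in> V}) a = vt n (a + m)"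
proof (induction m rule: less_induct)
  case (less m)
  have va: "vt n a = a" using a V vt_id by blast
  show ?case
  proof (cases "m = 0")
    case True
    then show ?thesis using va by simp
  next
    case False
    define K where "K = {l. l < m \<and> vt n (a + l) \<in> V}"
    have fin: "finite K" by (simp add: K_def)
    have "0 \<in> K" using False a va by (simp add: K_def)
    define k where "k = Max K"
    have kK: "k \<in> K" unfolding k_def using fin \<open>0 \<in> K\<close> by (intro Max_in) auto
    then have k: "k < m" "vt n (a + k) \<in> V" by (simp_all add: K_def)
    have top: "l \<le> k" if "l \<in> K" for l unfolding k_def using fin that by (rule Max_ge)
    have "K = insert k {l. l < k \<and> vt n (a + l) \<in> V}"
    proof (intro equalityI subsetI)
      fix l assume "l \<in> K"
      then show "l \<in> insert k {l. l < k \<and> vt n (a + l) \<in> V}" using top[of l] by (auto simp: K_def)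
    next
      fix l assume "l \<in> insert k {l. l < k \<and> vt n (a + l) \<in> V}"
      then show "l \<in> K" using k by (auto simp: K_def)
    qed
    then have card: "card K = Suc (card {l. l < k \<and> vt n (a + l) \<in> V})" by simp
    have e: "vt n (vt n (a + k) + i) = vt n (a + (k + i))" for i by (simp add: add.assoc)
    have "cyc_succ V (vt n (a + k)) = vt n (vt n (a + k) + (m - k))"
    proof (rule cyc_succ_corner[OF vt_in[OF n_pos] V])
      show "m - k > 0" using k by simp
      show "vt n (vt n (a + k) + (m - k)) \<in> V" unfolding e using k less.prems by simp
      fix i assume "0 < i" "i < m - k"
      then have "k + i \<notin> K" using top[of "k + i"] by auto
      then show "vt n (vt n (a + k) + i) \<notin> V" unfolding e using \<open>i < m - k\<close> by (auto simp: K_def)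
    qed
    also have "\<dots> = vt n (a + m)" unfolding e using k by simp
    finally show ?thesis
      using less.IH[OF k] card by (simp add: K_def)
  qed
qed

section \<open>Idempotents of corners and the vertex sets \<open>Im gamma^m\<close>\<close>

abbreviation E :: "nat set \<Rightarrow> 'a" where "E V \<equiv> \<Sum>a\<in>V. u a 0"

lemma E_mult_u: "V \<subseteq> {1..n} \<Longrightarrow> E V * u s l = (if vt n s \<in> V then u s l else 0)"
proof -
  assume V: "V \<subseteq> {1..n}"
  have "E V * u s l = (\<Sum>a\<in>V. if a = vt n s then u s l else 0)"
    unfolding sum_distrib_right
  proof (rule sum.cong[OF refl])
    fix a assume "a \<in> V"
    then have "vt n a = a" using V vt_id by blast
    then show "u a 0 * u s l = (if a = vt n s then u s l else 0)" by (simp add: u_mult)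
  qed
  then show ?thesis using finite_vertices[OF V] by simp
qed

lemma u_mult_E: "V \<subseteq> {1..n} \<Longrightarrow> u s l * E V = (if vt n (s + l) \<in> V then u s l else 0)"
proof -
  assume V: "V \<subseteq> {1..n}"
  have "u s l * E V = (\<Sum>a\<in>V. if a = vt n (s + l) then u s l else 0)"
    unfolding sum_distrib_left
  proof (rule sum.cong[OF refl])
    fix a assume "a \<in> V"
    then have "vt n a = a" using V vt_id by blast
    then show "u s l * u a 0 = (if a = vt n (s + l) then u s l else 0)" by (simp add: u_mult)
  qed
  then show ?thesis using finite_vertices[OF V] by simp
qed

lemma linear_mult_left: "Vector_Spaces.linear (smul A) (smul A) (\<lambda>x. a * x)"
  by (rule Vector_Spaces.linear_iff[THEN iffD2])
    (simp add: vs.vector_space_axioms distrib_left smul_mult_right)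

lemma linear_mult_right: "Vector_Spaces.linear (smul A) (smul A) (\<lambda>x. x * a)"
  by (rule Vector_Spaces.linear_iff[THEN iffD2])
    (simp add: vs.vector_space_axioms distrib_right smul_mult_left)

lemma span_linear_image:
  assumes "Vector_Spaces.linear (smul A) (smul A) g" "g ` X \<subseteq> insert 0 Y" "Y \<subseteq> g ` X"
  shows "g ` vs.span X = vs.span Y"
proof -
  interpret g: Vector_Spaces.linear "smul A" "smul A" g by fact
  have "g ` vs.span X = vs.span (g ` X)" by (rule g.span_image[symmetric])
  also have "\<dots> = vs.span Y"
  proof
    show "vs.span (g ` X) \<subseteq> vs.span Y" using vs.span_mono[OF assms(2)] by simp
    show "vs.span Y \<subseteq> vs.span (g ` X)" using assms(3) by (rule vs.span_mono)
  qed
  finally show ?thesis .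
qed

lemma proj_dimension_corner:
  assumes V: "V \<subseteq> {1..n}" and a: "a \<in> V"
  shows "proj_dimension_at (cor V) a = card {l. l < p a \<and> vt n (a + l) \<in> V}"
proof -
  let ?L = "{l. l < p a \<and> vt n (a + l) \<in> V}" and ?e = "u a 0"
  have aV: "a \<in> {1..n}" "vt n a = a" using a V vt_id by blast+
  have "{?e * x | x. x \<in> Sp V} = (\<lambda>x. ?e * x) ` Sp V" by auto
  also have "\<dots> = vs.span (u a ` ?L)"
  proof (rule span_linear_image[OF linear_mult_left])
    show "(\<lambda>x. ?e * x) ` basis V \<subseteq> insert 0 (u a ` ?L)"
    proof clarify
      fix x assume x: "x \<in> basis V" and nz: "?e * x \<notin> u a ` ?L"
      obtain s l where sl: "x = u s l" "s \<in> V" "l < p s" "vt n (s + l) \<in> V" using x by (auto simp: basis_def)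
      have "vt n s = s" using sl V vt_id by blast
      then show "?e * x = 0" using nz sl aV(2) by (auto simp: u_mult split: if_splits)
    qed
    show "u a ` ?L \<subseteq> (\<lambda>x. ?e * x) ` basis V"
    proof clarify
      fix l assume "l < p a" "vt n (a + l) \<in> V"
      then have "u a l \<in> basis V" using a aV by (intro u_in_basis) simp_all
      moreover have "u a l = ?e * u a l" by (simp add: u_mult)
      ultimately show "u a l \<in> (\<lambda>x. ?e * x) ` basis V" by blast
    qed
  qed
  finally have "proj_dimension_at (cor V) a = vs.dim (vs.span (u a ` ?L))"
    using idem_A[OF aV(1)] by (simp add: proj_dimension_at_def)
  also have "vs.independent (u a ` ?L)"
  proof (rule vs.independent_mono[OF indep_basis])
    show "u a ` ?L \<subseteq> basis {1..n}"
    proof clarify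
      fix l assume "l < p a"
      then show "u a l \<in> basis {1..n}" by (intro u_in_basis vt_in n_pos)
    qed
  qed
  then have "vs.dim (vs.span (u a ` ?L)) = card (u a ` ?L)" by (rule vs.dim_span_eq_card_independent)
  also have "\<dots> = card ?L" by (rule card_image) (auto intro!: inj_onI dest: u_inj)
  finally show ?thesis .
qed

definition gm :: "nat \<Rightarrow> nat" where "gm a = vt n (f a)"

lemma gm_vt [simp]: "gm (vt n i) = vt n (f i)"
  by (simp add: gm_def f_def)

text \<open>The corner projective at \<open>a\<close> has as basis the paths from \<open>a\<close>
  of length \<open>l < p a\<close> that end in \<open>V\<close>, and the same number counts the
  corner steps contained in \<open>p a\<close> arrows. So \<open>gamma\<close> of the corner agrees
  with that of \<open>A\<close>.\<close>

lemma gamma_corner: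
  assumes V: "V \<subseteq> {1..n}" and a: "a \<in> V" "gm a \<in> V"
  shows "gamma (cor V) a = gm a"
  using cyc_succ_funpow_corner[OF V a(1), of "p a"] a(2)
  by (simp add: gamma_def proj_dimension_corner[OF V a(1)] gm_def f_def)

lemma gamma_eq_gm: "a \<in> full \<Longrightarrow> gamma A a = gm a"
  using gamma_corner[OF full_subset] by (simp add: gm_def)

text \<open>This is \<open>Im gamma^m\<close>, obtained by iterating the map of \<open>A\<close>
  itself, which the corners inherit by restriction.\<close>

definition VV :: "nat \<Rightarrow> nat set" where "VV m = (gm ^^ m) ` full"

lemma VV_0 [simp]: "VV 0 = full"
  by (simp add: VV_def)

lemma VV_Suc: "VV (Suc m) = gm ` VV m"
  by (simp add: VV_def image_image)

lemma VV_Suc_subset: "VV (Suc m) \<subseteq> VV m"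
  unfolding VV_def funpow_Suc_right by (auto simp: gm_def)

lemma VV_subset_full: "VV m \<subseteq> full"
  by (induction m) (use VV_Suc_subset in auto)

lemma VV_subset: "VV m \<subseteq> {1..n}"
  using VV_subset_full full_subset by blast

lemma eps_corner:
  assumes V: "V \<subseteq> {1..n}" and gV: "gm ` V \<subseteq> V"
  shows "eps (cor V) = cor (gm ` V)"
proof -
  let ?V' = "gm ` V"
  have V': "?V' \<subseteq> {1..n}" using V gV by blast
  have g: "gamma (cor V) ` V = ?V'" using gV by (intro image_cong[OF refl] gamma_corner[OF V]) auto
  have "(\<Sum>a\<in>?V'. idem A a) = E ?V'" using V' by (intro sum.cong refl idem_A) blast
  moreover have "{E ?V' * x * E ?V' | x. x \<in> Sp V} = Sp ?V'"
  proof -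
    have lin: "Vector_Spaces.linear (smul A) (smul A) (\<lambda>x. E ?V' * x * E ?V')"
      using Vector_Spaces.linear_compose[OF linear_mult_left linear_mult_right] by (simp add: o_def)
    have 1: "E ?V' * u s l * E ?V' = (if vt n s \<in> ?V' \<and> vt n (s + l) \<in> ?V' then u s l else 0)" for s l
      by (simp add: E_mult_u[OF V'] u_mult_E[OF V'])
    have "(\<lambda>x. E ?V' * x * E ?V') ` Sp V = Sp ?V'"
    proof (rule span_linear_image[OF lin])
      show "(\<lambda>x. E ?V' * x * E ?V') ` basis V \<subseteq> insert 0 (basis ?V')"
      proof clarify
        fix x assume x: "x \<in> basis V" and nz: "E ?V' * x * E ?V' \<notin> basis ?V'"
        obtain s l where sl: "x = u s l" "s \<in> V" "l < p s" "vt n (s + l) \<in> V" using x by (auto simp: basis_def)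
        show "E ?V' * x * E ?V' = 0"
          using nz u_in_basis[of s ?V' l] sl unfolding sl(1) 1 by (auto split: if_splits)
      qed
      show "basis ?V' \<subseteq> (\<lambda>x. E ?V' * x * E ?V') ` basis V"
      proof
        fix x assume x: "x \<in> basis ?V'"
        then obtain s l where sl: "x = u s l" "s \<in> ?V'" "l < p s" "vt n (s + l) \<in> ?V'" by (auto simp: basis_def)
        have "vt n s = s" using sl(2) V' vt_id by blast
        then have "x = E ?V' * x * E ?V'" using sl unfolding sl(1) 1 by simp
        then show "x \<in> (\<lambda>x. E ?V' * x * E ?V') ` basis V" using x basis_mono[OF gV] by blast
      qed
    qed
    then show ?thesis by (simp add: setcompr_eq_image)
  qed
  ultimately show ?thesis
    unfolding eps_def Let_def cor_simps g by (simp add: cor_def)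
qed

lemma eps_VV: "eps (cor (VV m)) = cor (VV (Suc m))"
  using eps_corner[OF VV_subset] VV_Suc_subset by (simp add: VV_Suc)

lemma eps_iter: "(eps ^^ m) A = cor (VV m)"
  by (induction m) (simp_all add: eps_VV)

section \<open>The functor \<open>F\<close>\<close>

lemma E_in_span: "V' \<subseteq> V \<Longrightarrow> V \<subseteq> {1..n} \<Longrightarrow> E V' \<in> Sp V"
proof (intro vs.span_sum u_in_span)
  fix a assume "a \<in> V'" "V' \<subseteq> V" "V \<subseteq> {1..n}"
  moreover then have "vt n a = a" using vt_id by blast
  ultimately show "vt n a \<in> V" "vt n (a + 0) \<in> V" by auto
qed

lemma E_mult:
  assumes V: "V \<subseteq> {1..n}" and x: "x \<in> Sp V"
  shows "E V * x = x" "x * E V = x"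
proof -
  have v: "vt n s = s" if "s \<in> V" for s using that V vt_id by blast
  show "E V * x = x"
    using x
  proof (induction rule: basis_induct)
    case (base s l)
    then show ?case using v by (simp add: E_mult_u[OF V])
  qed (simp_all add: distrib_left smul_mult_right)
  show "x * E V = x"
    using x
  proof (induction rule: basis_induct)
    case (base s l)
    then show ?case by (simp add: u_mult_E[OF V])
  qed (simp_all add: distrib_right smul_mult_left)
qed

text \<open>Since \<open>E V'\<close> is idempotent, the image of its action is its set of fixed
  vectors, a description that passes to isomorphic modules at once.\<close>

lemma mcar_functor_F:
  assumes VV': "V \<subseteq> {1..n}" "V' \<subseteq> V" "eps (cor V) = cor V'" and M: "right_module (cor V) M"
  shows "mcar (functor_F (cor V) M) = {v \<in> mcar M. mact M v (E V') = v}"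
proof -
  have V': "V' \<subseteq> {1..n}" using VV' by blast
  have EV: "E V' \<in> Sp V" using VV' by (intro E_in_span)
  have EE: "E V' * E V' = E V'" using E_mult(1)[OF V' E_in_span[OF subset_refl V']] .
  note D = moduleD[OF M, simplified]
  have "mact M (mact M v (E V')) (E V') = mact M v (E V')" "mact M v (E V') \<in> mcar M" if "v \<in> mcar M" for v
    using D(7)[OF that EV EV] D(2)[OF that EV] EE by simp_all
  then show ?thesis unfolding functor_F_def VV'(3) alg_one_cor[OF V'] by (auto simp: image_iff) metis
qed

lemma mact_functor_F [simp]: "mact (functor_F B M) = mact M"
  by (simp add: functor_F_def)

lemma right_module_functor_F:
  assumes VV': "V \<subseteq> {1..n}" "V' \<subseteq> V" "eps (cor V) = cor V'" and M: "right_module (cor V) M"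
  shows "right_module (cor V') (functor_F (cor V) M)"
proof -
  have V': "V' \<subseteq> {1..n}" using VV' by blast
  note D = moduleD[OF M, simplified] and C = module_closed[OF M]
  note mc = mcar_functor_F[OF VV' M]
  have el: "w \<in> Sp V" if "w \<in> Sp V'" for w
    using that span_basis_mono[OF VV'(2)] by blast
  have EV: "E V' \<in> Sp V" using VV' by (intro E_in_span)
  obtain B where "finite B" "mcar M \<subseteq> pm.span B"
    using M unfolding right_module_def by blast
  then have fin: "\<exists>B. finite B \<and> mcar (functor_F (cor V) M) \<subseteq> pm.span B"
    unfolding mc by blast
  have sub: "pm.subspace (mcar (functor_F (cor V) M))"
    unfolding mc pm.subspace_def using C D(3)[OF _ _ EV] D(5)[OF _ EV] mact_zero[OF M] EV by simp
  have closed: "mact M v w \<in> mcar (functor_F (cor V) M)"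
    if "v \<in> mcar (functor_F (cor V) M)" "w \<in> Sp V'" for v w
    using that D(2) D(7)[OF _ _ EV] el E_mult(2)[OF V'] unfolding mc by simp
  show ?thesis
    unfolding right_module_def mact_functor_F cor_simps alg_one_cor[OF V']
    by (intro conjI ballI allI sub fin closed) (auto simp: mc el D)
qed

lemma mod_iso_functor_F:
  assumes VV': "V \<subseteq> {1..n}" "V' \<subseteq> V" "eps (cor V) = cor V'"
    and M: "right_module (cor V) M" and N: "right_module (cor V) N" and iso: "mod_iso (cor V) M N"
  shows "mod_iso (cor V') (functor_F (cor V) M) (functor_F (cor V) N)"
proof -
  obtain h where h: "mod_hom (cor V) M N h" "bij_betw h (mcar M) (mcar N)" using iso by (auto simp: mod_iso_def)
  note mc = mcar_functor_F[OF VV' M] mcar_functor_F[OF VV' N]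
  note hD = mod_homD[OF h(1), simplified]
  have EV: "E V' \<in> Sp V" using VV' by (intro E_in_span)
  have el: "w \<in> Sp V" if "w \<in> Sp V'" for w
    using that span_basis_mono[OF VV'(2)] by blast
  have inj: "inj_on h (mcar M)" and im: "h ` mcar M = mcar N" using h(2) by (auto simp: bij_betw_def)
  have fix_iff: "mact N (h v) (E V') = h v \<longleftrightarrow> mact M v (E V') = v" if "v \<in> mcar M" for v
    using hD(4)[OF that EV] inj moduleD(2)[OF M that] EV that by (auto simp: inj_on_eq_iff)
  have "bij_betw h (mcar (functor_F (cor V) M)) (mcar (functor_F (cor V) N))"
    unfolding bij_betw_def mc
  proof
    show "inj_on h {v \<in> mcar M. mact M v (E V') = v}" using inj by (rule inj_on_subset) auto
    show "h ` {v \<in> mcar M. mact M v (E V') = v} = {v \<in> mcar N. mact N v (E V') = v}"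
      unfolding im[symmetric] using fix_iff by blast
  qed
  moreover have "mod_hom (cor V') (functor_F (cor V) M) (functor_F (cor V) N) h"
    unfolding mod_hom_def mc mact_functor_F cor_simps using hD el fix_iff by simp
  ultimately show ?thesis unfolding mod_iso_def by blast
qed

text \<open>The idempotent \<open>E V'\<close> acts by deleting the positions that do not lie over
  \<open>V'\<close>.\<close>

lemma functor_F_Itv:
  assumes VV': "V \<subseteq> {1..n}" "V' \<subseteq> V" "eps (cor V) = cor V'" and y: "y \<le> f x"
  shows "functor_F (cor V) (Itv V x y) = Itv V' x y"
proof -
  have V': "V' \<subseteq> {1..n}" using VV' by blast
  have "v \<in> mcar (Itv V x y) \<and> act y v (E V') = v \<longleftrightarrow> v \<in> mcar (Itv V' x y)" for v
  proof
    assume "v \<in> mcar (Itv V x y) \<and> act y v (E V') = v"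
    then have v: "v \<in> mcar (Itv V x y)" "lkp v j = lkp (act y v (E V')) j" for j by simp_all
    have "vt n j \<in> V'" if "lkp v j \<noteq> 0" for j
      using v(2)[of j] that unfolding lookup_act_one[OF V'] by (cases "vt n j \<in> V'") simp_all
    then show "v \<in> mcar (Itv V' x y)" using v(1) by (simp add: in_Itv_iff)
  next
    assume v: "v \<in> mcar (Itv V' x y)"
    then have "v \<in> mcar (Itv V x y)" using VV'(2) unfolding in_Itv_iff by blast
    moreover have "act y v (E V') = v"
      by (rule poly_mapping_eqI) (use v in \<open>auto simp: lookup_act_one[OF V'] in_Itv_iff\<close>)
    ultimately show "v \<in> mcar (Itv V x y) \<and> act y v (E V') = v" ..
  qed
  then have "mcar (functor_F (cor V) (Itv V x y)) = mcar (Itv V' x y)"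
    using mcar_functor_F[OF VV' right_module_Itv[OF VV'(1) y]] by auto
  then show ?thesis by (simp add: functor_F_def Itv_def)
qed

lemma functor_F_iter_simple:
  "right_module (cor (VV m)) (functor_F_iter m A (simple_at A (vt n x)))
   \<and> mod_iso (cor (VV m)) (functor_F_iter m A (simple_at A (vt n x))) (Itv (VV m) x (Suc x))"
proof (induction m)
  case 0
  then show ?case using right_module_simple_at mod_iso_simple_at_J by simp
next
  case (Suc m)
  note VV' = VV_subset[of m] VV_Suc_subset[of m] eps_VV[of m]
  have y: "Suc x \<le> f x" using f_gt by (simp add: Suc_leI)
  show ?case
    using right_module_functor_F[OF VV'] mod_iso_functor_F[OF VV' _ right_module_Itv[OF VV_subset y]]
      functor_F_Itv[OF VV' y] Suc by (simp add: eps_iter)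
qed

end

section \<open>The functor \<open>G\<close>\<close>

text \<open>One step of the iteration: \<open>cor V\<close> takes the place of \<open>A\<close>, and
  \<open>cor V'\<close> that of \<open>eAe\<close>.\<close>

locale corner_pair = nakayama A n u p
  for A :: "('k::field, 'a::ring) vertex_algebra" and n u p +
  fixes V V' :: "nat set"
  assumes V: "V \<subseteq> {1..n}" and V'_subset: "V' \<subseteq> V" and eps: "eps (cor V) = cor V'"
begin

lemma V': "V' \<subseteq> {1..n}"
  using V V'_subset by blast

definition eA :: "'a set" where "eA = {w \<in> Sp V. E V' * w = w}"

lemma E_V': "E V' \<in> Sp V" "E V' \<in> Sp V'"
  using E_in_span[OF V'_subset V] E_in_span[OF subset_refl V'] .

lemma eA_eq: "{alg_one (eps (cor V)) * x | x. x \<in> elems (cor V)} = eA"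
proof -
  have "E V' * (E V' * x) = E V' * x" for x
    using E_mult(1)[OF V' E_V'(2)] by (simp add: mult.assoc[symmetric])
  moreover have "E V' * x \<in> Sp V" if "x \<in> Sp V" for x
    using span_basis_mult[OF V E_V'(1) that] .
  ultimately show ?thesis unfolding eps alg_one_cor[OF V'] cor_simps eA_def by (auto intro: exI sym)
qed

lemma eA_span: "w \<in> eA \<Longrightarrow> w \<in> Sp V"
  by (simp add: eA_def)

lemma eA_elems: "w \<in> eA \<Longrightarrow> w \<in> elems A"
  using span_basis_elems[OF V] by (simp add: eA_def)

lemma corner_elems: "w \<in> Sp V \<Longrightarrow> w \<in> elems A" "w \<in> Sp V' \<Longrightarrow> w \<in> elems A"
  "w \<in> Sp V' \<Longrightarrow> w \<in> Sp V"
  using span_basis_elems[OF V] span_basis_elems[OF V'] span_basis_mono[OF V'_subset] by auto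

lemma eA_closed:
  "x \<in> eA \<Longrightarrow> y \<in> eA \<Longrightarrow> x + y \<in> eA"
  "x \<in> eA \<Longrightarrow> smul A c x \<in> eA"
  "x \<in> eA \<Longrightarrow> y \<in> Sp V \<Longrightarrow> x * y \<in> eA"
  "b \<in> Sp V' \<Longrightarrow> x \<in> eA \<Longrightarrow> b * x \<in> eA"
  "0 \<in> eA"
proof -
  show "x \<in> eA \<Longrightarrow> y \<in> eA \<Longrightarrow> x + y \<in> eA" by (simp add: eA_def vs.span_add distrib_left)
  show "x \<in> eA \<Longrightarrow> smul A c x \<in> eA" by (simp add: eA_def vs.span_scale smul_mult_right)
  show "x \<in> eA \<Longrightarrow> y \<in> Sp V \<Longrightarrow> x * y \<in> eA"
    by (simp add: eA_def span_basis_mult[OF V] mult.assoc[symmetric])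
  show "b \<in> Sp V' \<Longrightarrow> x \<in> eA \<Longrightarrow> b * x \<in> eA"
    by (simp add: eA_def span_basis_mult[OF V] corner_elems(3) mult.assoc[symmetric] E_mult(1)[OF V'])
  show "0 \<in> eA" by (simp add: eA_def vs.span_zero)
qed

lemma eA_sum: "(\<And>k. g k \<in> eA) \<Longrightarrow> (\<Sum>k\<in>K. g k) \<in> eA"
  by (induction K rule: infinite_finite_induct) (simp_all add: eA_closed)

lemma u_in_eA: "vt n s \<in> V' \<Longrightarrow> vt n (s + l) \<in> V \<Longrightarrow> u s l \<in> eA"
  using V'_subset by (auto simp: eA_def E_mult_u[OF V'] intro!: u_in_span)

section \<open>The tensor product as a quotient of a free space\<close>

abbreviation t :: "'k uvec \<Rightarrow> 'a \<Rightarrow> (('k uvec \<times> 'a) \<Rightarrow>\<^sub>0 'k)" where "t v x \<equiv> sng (v, x)"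

definition Free :: "('k, 'a) rmod \<Rightarrow> (('k uvec \<times> 'a) \<Rightarrow>\<^sub>0 'k) set" where
  "Free N = {z. supp z \<subseteq> mcar N \<times> eA}"

abbreviation Rel :: "('k, 'a) rmod \<Rightarrow> (('k uvec \<times> 'a) \<Rightarrow>\<^sub>0 'k) set" where
  "Rel N \<equiv> tensor_relations (cor V) N"

lemma Free_span: "Free N = pm.span (sng ` (mcar N \<times> eA))"
  unfolding Free_def by (rule keys_subset_eq_span)

lemma subspace_Free: "pm.subspace (Free N)"
  unfolding Free_span by (rule pm.subspace_span)

lemma t_Free: "v \<in> mcar N \<Longrightarrow> x \<in> eA \<Longrightarrow> t v x \<in> Free N"
  by (simp add: Free_def)

lemma Free_induct [consumes 1, case_names zero step]:
  assumes "z \<in> Free N" "P 0"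
    and "\<And>c v x z. v \<in> mcar N \<Longrightarrow> x \<in> eA \<Longrightarrow> z \<in> Free N \<Longrightarrow> P z \<Longrightarrow> P (scale_pm c (t v x) + z)"
  shows "P z"
proof -
  have "z \<in> pm.span (sng ` (mcar N \<times> eA))" using assms(1) by (simp only: Free_span)
  then have "z \<in> Free N \<and> P z"
  proof (induction rule: pm.span_induct_alt)
    case base
    then show ?case using assms(2) pm.subspace_0[OF subspace_Free] by simp
  next
    case (step c w z)
    then obtain v x where vx: "w = t v x" "v \<in> mcar N" "x \<in> eA" by auto
    have "scale_pm c w + z \<in> Free N"
      unfolding vx(1) using step vx
      by (intro pm.subspace_add[OF subspace_Free] pm.subspace_scale[OF subspace_Free] t_Free) simp_all
    moreover have "P (scale_pm c w + z)" unfolding vx(1) using step vx by (intro assms(3)) simp_all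
    ultimately show ?case ..
  qed
  then show ?thesis ..
qed

lemma Rel_mem:
  "v \<in> mcar N \<Longrightarrow> w \<in> mcar N \<Longrightarrow> x \<in> eA \<Longrightarrow> t (v + w) x - t v x - t w x \<in> Rel N"
  "v \<in> mcar N \<Longrightarrow> x \<in> eA \<Longrightarrow> y \<in> eA \<Longrightarrow> t v (x + y) - t v x - t v y \<in> Rel N"
  "v \<in> mcar N \<Longrightarrow> x \<in> eA \<Longrightarrow> t (scale_pm c v) x - scale_pm c (t v x) \<in> Rel N"
  "v \<in> mcar N \<Longrightarrow> x \<in> eA \<Longrightarrow> t v (smul A c x) - scale_pm c (t v x) \<in> Rel N"
  "v \<in> mcar N \<Longrightarrow> b \<in> Sp V' \<Longrightarrow> x \<in> eA \<Longrightarrow> t (mact N v b) x - t v (b * x) \<in> Rel N"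
  unfolding tensor_relations_def Let_def eA_eq unfolding eps cor_simps by blast+

lemma Rel_subset:
  assumes "\<And>v w x. v \<in> mcar N \<Longrightarrow> w \<in> mcar N \<Longrightarrow> x \<in> eA \<Longrightarrow> t (v + w) x - t v x - t w x \<in> S"
    and "\<And>v x y. v \<in> mcar N \<Longrightarrow> x \<in> eA \<Longrightarrow> y \<in> eA \<Longrightarrow> t v (x + y) - t v x - t v y \<in> S"
    and "\<And>c v x. v \<in> mcar N \<Longrightarrow> x \<in> eA \<Longrightarrow> t (scale_pm c v) x - scale_pm c (t v x) \<in> S"
    and "\<And>c v x. v \<in> mcar N \<Longrightarrow> x \<in> eA \<Longrightarrow> t v (smul A c x) - scale_pm c (t v x) \<in> S"
    and "\<And>v b x. v \<in> mcar N \<Longrightarrow> b \<in> Sp V' \<Longrightarrow> x \<in> eA \<Longrightarrow> t (mact N v b) x - t v (b * x) \<in> S"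
  shows "Rel N \<subseteq> S"
  unfolding tensor_relations_def Let_def eA_eq unfolding eps cor_simps
  using assms by (intro Un_least subsetI) blast+

lemma Rel_Free: "right_module (cor V') N \<Longrightarrow> Rel N \<subseteq> Free N"
proof -
  assume N: "right_module (cor V') N"
  note c = module_closed[OF N] moduleD(2)[OF N, simplified]
  show ?thesis
    by (rule Rel_subset)
      (intro pm.subspace_diff[OF subspace_Free] pm.subspace_scale[OF subspace_Free] t_Free; simp add: c eA_closed)+
qed

definition tensor_map :: "('k, 'a) rmod \<Rightarrow> ('k, 'a) rmod \<Rightarrow> ((('k uvec \<times> 'a) \<Rightarrow>\<^sub>0 'k) \<Rightarrow> 'k uvec) \<Rightarrow> bool" where
  "tensor_map N T \<pi> \<longleftrightarrow> pm_linear \<pi> \<and> \<pi> ` Free N = mcar T \<and> {z \<in> Free N. \<pi> z = 0} = pm.span (Rel N) \<and>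
     (\<forall>v\<in>mcar N. \<forall>x\<in>eA. \<forall>y\<in>Sp V. mact T (\<pi> (t v x)) y = \<pi> (t v (x * y)))"

lemma tensor_mapD:
  assumes "tensor_map N T \<pi>"
  shows "pm_linear \<pi>" "\<pi> ` Free N = mcar T" "{z \<in> Free N. \<pi> z = 0} = pm.span (Rel N)"
    "v \<in> mcar N \<Longrightarrow> x \<in> eA \<Longrightarrow> y \<in> Sp V \<Longrightarrow> mact T (\<pi> (t v x)) y = \<pi> (t v (x * y))"
  using assms unfolding tensor_map_def by blast+

lemma is_tensor_product_cor:
  "is_tensor_product (cor V) N T \<longleftrightarrow> right_module (cor V) T \<and> (\<exists>\<pi>. tensor_map N T \<pi>)"
  unfolding is_tensor_product_def Let_def eA_eq unfolding tensor_map_def Free_def cor_simps ..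

definition fmap :: "('k uvec \<Rightarrow> 'k uvec) \<Rightarrow> (('k uvec \<times> 'a) \<Rightarrow>\<^sub>0 'k) \<Rightarrow> (('k uvec \<times> 'a) \<Rightarrow>\<^sub>0 'k)" where
  "fmap g = lin_ext (\<lambda>(v, x). t (g v) x)"

lemma fmap_t: "fmap g (t v x) = t (g v) x"
  by (simp add: fmap_def)

lemma linear_fmap: "pm_linear (fmap g)"
  unfolding fmap_def by (rule linear_lin_ext)

lemma fmap_Free:
  assumes "\<And>v. v \<in> mcar N \<Longrightarrow> g v \<in> mcar N'" "z \<in> Free N"
  shows "fmap g z \<in> Free N'"
proof -
  interpret g: Vector_Spaces.linear scale_pm scale_pm "fmap g" by (rule linear_fmap)
  show ?thesis
    using assms(2)
  proof (induction rule: Free_induct)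
    case zero
    then show ?case using pm.subspace_0[OF subspace_Free] by (simp add: g.zero)
  next
    case (step c v x z)
    then show ?case using assms(1)
      by (simp add: g.add g.scale fmap_t pm.subspace_add[OF subspace_Free] pm.subspace_scale[OF subspace_Free]
          t_Free del: scale_pm_single)
  qed
qed

lemma fmap_Rel:
  assumes g: "mod_hom (cor V') N N' g" and z: "z \<in> pm.span (Rel N)"
  shows "fmap g z \<in> pm.span (Rel N')"
proof -
  interpret g: Vector_Spaces.linear scale_pm scale_pm "fmap g" by (rule linear_fmap)
  note gD = mod_homD[OF g, simplified]
  have "Rel N \<subseteq> {z. fmap g z \<in> Rel N'}"
    by (rule Rel_subset) (simp_all add: g.diff g.scale fmap_t gD Rel_mem del: scale_pm_single)
  then have "fmap g ` Rel N \<subseteq> Rel N'" by blast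
  then have "pm.span (fmap g ` Rel N) \<subseteq> pm.span (Rel N')" by (rule pm.span_mono)
  moreover have "fmap g z \<in> pm.span (fmap g ` Rel N)" unfolding g.span_image using z by blast
  ultimately show ?thesis by blast
qed

lemma fmap_inverse:
  assumes "\<And>v. v \<in> mcar N \<Longrightarrow> k (g v) = v" "z \<in> Free N"
  shows "fmap k (fmap g z) = z"
proof -
  interpret g: Vector_Spaces.linear scale_pm scale_pm "fmap g" by (rule linear_fmap)
  interpret k: Vector_Spaces.linear scale_pm scale_pm "fmap k" by (rule linear_fmap)
  show ?thesis
    using assms(2)
    by (induction rule: Free_induct)
      (simp_all add: g.zero k.zero g.add k.add g.scale k.scale fmap_t assms(1) del: scale_pm_single)
qed

text \<open>The functor \<open>G\<close> meets modules known only up to isomorphism. Replacing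
  \<open>v\<close> by \<open>g v\<close> in the first factor carries the relations for
  \<open>N\<close> to those for \<open>N'\<close>, and its inverse carries them back, so the same
  \<open>T\<close> serves for both.\<close>

lemma is_tensor_product_iso:
  assumes N: "right_module (cor V') N" and N': "right_module (cor V') N'"
    and iso: "mod_iso (cor V') N N'" and T: "is_tensor_product (cor V) N' T"
  shows "is_tensor_product (cor V) N T"
proof -
  obtain g where g: "mod_hom (cor V') N N' g" "bij_betw g (mcar N) (mcar N')"
    using iso by (auto simp: mod_iso_def)
  define k where "k = inv_into (mcar N) g"
  have k: "mod_hom (cor V') N' N k" unfolding k_def by (rule mod_hom_inverse[OF N g])
  have kg: "k (g v) = v" if "v \<in> mcar N" for v using g(2) that by (simp add: k_def bij_betw_def)
  have gk: "g (k w) = w" if "w \<in> mcar N'" for w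
    using g(2) that by (simp add: k_def bij_betw_def f_inv_into_f)
  obtain \<pi> where rT: "right_module (cor V) T" and \<pi>T: "tensor_map N' T \<pi>"
    using T unfolding is_tensor_product_cor by blast
  note \<pi> = tensor_mapD[OF \<pi>T]
  have Fg: "fmap g z \<in> Free N'" if "z \<in> Free N" for z using fmap_Free[OF mod_homD(1)[OF g(1)] that] .
  have Fk: "fmap k z \<in> Free N" if "z \<in> Free N'" for z using fmap_Free[OF mod_homD(1)[OF k] that] .
  have "fmap g ` Free N = Free N'"
    using Fg Fk fmap_inverse[of N' g k, OF gk] by (force intro!: image_eqI)
  then have "(\<lambda>z. \<pi> (fmap g z)) ` Free N = mcar T" using \<pi>(2) by (metis image_image)
  moreover have "{z \<in> Free N. \<pi> (fmap g z) = 0} = pm.span (Rel N)"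
  proof (intro equalityI subsetI)
    fix z assume "z \<in> {z \<in> Free N. \<pi> (fmap g z) = 0}"
    then have z: "z \<in> Free N" "fmap g z \<in> pm.span (Rel N')" using \<pi>(3) Fg by blast+
    then have "fmap k (fmap g z) \<in> pm.span (Rel N)" using fmap_Rel[OF k] by blast
    then show "z \<in> pm.span (Rel N)" using fmap_inverse[of N k g, OF kg z(1)] by simp
  next
    fix z assume z: "z \<in> pm.span (Rel N)"
    have "pm.span (Rel N) \<subseteq> Free N" using Rel_Free[OF N] subspace_Free by (rule pm.span_minimal)
    moreover have "\<pi> (fmap g z) = 0" using fmap_Rel[OF g(1) z] \<pi>(3) by blast
    ultimately show "z \<in> {z \<in> Free N. \<pi> (fmap g z) = 0}" using z by blast
  qed
  moreover have "pm_linear (\<lambda>z. \<pi> (fmap g z))"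
    using Vector_Spaces.linear_compose[OF linear_fmap \<pi>(1)] by (simp add: o_def)
  moreover have "\<forall>v\<in>mcar N. \<forall>x\<in>eA. \<forall>y\<in>Sp V.
      mact T (\<pi> (fmap g (t v x))) y = \<pi> (fmap g (t v (x * y)))"
    using \<pi>(4) mod_homD(1)[OF g(1)] by (simp add: fmap_t)
  ultimately show ?thesis unfolding is_tensor_product_cor tensor_map_def using rT by blast
qed

text \<open>The action is prescribed only on pure tensors; by linearity it is induced by right
  multiplication in the second factor, an operation on the free space that does not depend on
  \<open>T\<close> or \<open>\<pi>\<close>.\<close>

lemma tensor_action:
  assumes T: "right_module (cor V) T" and map: "tensor_map N T \<pi>"
    and z: "z \<in> Free N" and y: "y \<in> Sp V"
  shows "mact T (\<pi> z) y = \<pi> (lin_ext (\<lambda>(v, x). t v (x * y)) z) \<and> lin_ext (\<lambda>(v, x). t v (x * y)) z \<in> Free N"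
proof -
  note \<pi> = tensor_mapD(1,2)[OF map] and act = tensor_mapD(4)[OF map]
  let ?\<rho> = "lin_ext (\<lambda>(v, x). t v (x * y)) :: (('k uvec \<times> 'a) \<Rightarrow>\<^sub>0 'k) \<Rightarrow> _"
  interpret \<pi>: Vector_Spaces.linear scale_pm scale_pm \<pi> by (rule \<pi>(1))
  interpret \<rho>: Vector_Spaces.linear scale_pm scale_pm ?\<rho> by (rule linear_lin_ext)
  have \<rho>t: "?\<rho> (t v x) = t v (x * y)" for v x by simp
  note D = moduleD[OF T, simplified] and C = module_closed[OF T]
  have mem: "\<pi> z \<in> mcar T" if "z \<in> Free N" for z using \<pi>(2) that by blast
  show ?thesis
    using z
  proof (induction rule: Free_induct)
    case zero
    then show ?case using mact_zero[OF T] y pm.subspace_0[OF subspace_Free] by (simp add: \<pi>.zero \<rho>.zero)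
  next
    case (step c v x z)
    have 1: "\<pi> (t v x) \<in> mcar T" "\<pi> z \<in> mcar T" using step t_Free mem by blast+
    have "mact T (\<pi> (scale_pm c (t v x) + z)) y = scale_pm c (\<pi> (t v (x * y))) + \<pi> (?\<rho> z)"
      using step 1 y by (simp add: \<pi>.add \<pi>.scale D C act del: scale_pm_single)
    moreover have "?\<rho> (scale_pm c (t v x) + z) = scale_pm c (t v (x * y)) + ?\<rho> z"
      by (simp only: \<rho>.add \<rho>.scale \<rho>t)
    moreover have "scale_pm c (t v (x * y)) + ?\<rho> z \<in> Free N"
      using step y by (intro pm.subspace_add[OF subspace_Free] pm.subspace_scale[OF subspace_Free] t_Free eA_closed) simp_all
    ultimately show ?case by (simp only: \<pi>.add \<pi>.scale)
  qed
qed

text \<open>Both quotient maps have the span of the relations as kernel, so sending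
  \<open>\<pi> z\<close> to \<open>\<pi>' z\<close> is well defined and injective.\<close>

lemma is_tensor_product_unique:
  assumes T: "is_tensor_product (cor V) N T" and T': "is_tensor_product (cor V) N T'"
  shows "mod_iso (cor V) T T'"
proof -
  obtain \<pi> where rT: "right_module (cor V) T" and \<pi>T: "tensor_map N T \<pi>"
    using T unfolding is_tensor_product_cor by blast
  note \<pi> = tensor_mapD[OF \<pi>T]
  obtain \<pi>' where rT': "right_module (cor V) T'" and \<pi>'T: "tensor_map N T' \<pi>'"
    using T' unfolding is_tensor_product_cor by blast
  note \<pi>' = tensor_mapD[OF \<pi>'T]
  interpret \<pi>: Vector_Spaces.linear scale_pm scale_pm \<pi> by (rule \<pi>(1))
  interpret \<pi>': Vector_Spaces.linear scale_pm scale_pm \<pi>' by (rule \<pi>'(1))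
  have ker: "\<pi> z = 0 \<longleftrightarrow> \<pi>' z = 0" if "z \<in> Free N" for z using \<pi>(3) \<pi>'(3) that by blast
  define h where "h s = \<pi>' (SOME z. z \<in> Free N \<and> \<pi> z = s)" for s
  have h: "h (\<pi> z) = \<pi>' z" if z: "z \<in> Free N" for z
  proof -
    define w where "w = (SOME w. w \<in> Free N \<and> \<pi> w = \<pi> z)"
    have w: "w \<in> Free N \<and> \<pi> w = \<pi> z" unfolding w_def by (rule someI) (use z in simp)
    then have "\<pi> (w - z) = 0" by (simp add: \<pi>.diff)
    then have "\<pi>' (w - z) = 0" using ker pm.subspace_diff[OF subspace_Free] w z by blast
    then show ?thesis by (simp add: h_def w_def \<pi>'.diff)
  qed
  have ex: "\<exists>z\<in>Free N. s = \<pi> z" if "s \<in> mcar T" for s using \<pi>(2) that by blast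
  have hom: "mod_hom (cor V) T T' h"
    unfolding mod_hom_def cor_simps
  proof (intro conjI ballI allI)
    fix s assume "s \<in> mcar T"
    then obtain z where z: "z \<in> Free N" "s = \<pi> z" using ex by blast
    then show "h s \<in> mcar T'" using h \<pi>'(2) by auto
    fix s' assume "s' \<in> mcar T"
    then obtain z' where z': "z' \<in> Free N" "s' = \<pi> z'" using ex by blast
    then show "h (s + s') = h s + h s'"
      using z h pm.subspace_add[OF subspace_Free z(1) z'(1)] by (simp add: \<pi>'.add flip: \<pi>.add)
  next
    fix c s assume "s \<in> mcar T"
    then obtain z where z: "z \<in> Free N" "s = \<pi> z" using ex by blast
    then show "h (scale_pm c s) = scale_pm c (h s)"
      using h pm.subspace_scale[OF subspace_Free z(1)] by (simp add: \<pi>'.scale flip: \<pi>.scale)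
  next
    fix s y assume "s \<in> mcar T" and y: "y \<in> Sp V"
    then obtain z where z: "z \<in> Free N" "s = \<pi> z" using ex by blast
    show "h (mact T s y) = mact T' (h s) y"
      using tensor_action[OF rT \<pi>T z(1) y] tensor_action[OF rT' \<pi>'T z(1) y] z h by simp
  qed
  have "inj_on h (mcar T)"
  proof (rule inj_on_ker[OF rT hom])
    fix s assume "s \<in> mcar T" "h s = 0"
    moreover obtain z where z: "z \<in> Free N" "s = \<pi> z" using ex calculation by blast
    ultimately show "s = 0" using h ker by simp
  qed
  moreover have "h ` mcar T = mcar T'"
    unfolding \<pi>(2)[symmetric] \<pi>'(2)[symmetric] image_image using h by (rule image_cong[OF refl])
  ultimately show ?thesis unfolding mod_iso_def bij_betw_def using hom by blast
qed

text \<open>Every tensor reduces to the form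
  \<open>v\<^sub>x \<otimes> y\<close> with \<open>v\<^sub>x\<close> the generator, and the part of \<open>y\<close> that kills \<open>v\<^sub>x\<close> factors through the path
  from \<open>x\<close> to \<open>Y\<close>, which lies in \<open>eAe\<close> because both end points are vertices of \<open>eAe\<close>.\<close>

lemma is_tensor_product_Itv:
  assumes xY: "x < Y" "Y \<le> f x" and x: "vt n x \<in> V'" and Y: "vt n Y \<in> V'"
  shows "is_tensor_product (cor V) (Itv V' x Y) (Itv V x Y)"
proof -
  let ?N = "Itv V' x Y" and ?T = "Itv V x Y"
  let ?v0 = "sng x :: 'k uvec"
  let ?W = "pm.span (Rel ?N)"
  have rT: "right_module (cor V) ?T" using V xY(2) by (rule right_module_Itv)
  have rN: "right_module (cor V') ?N" using V' xY(2) by (rule right_module_Itv)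
  have NT: "mcar ?N \<subseteq> mcar ?T" using V'_subset unfolding in_Itv_iff subset_iff by blast
  have v0: "?v0 \<in> mcar ?N" using xY x by (simp add: single_in_Itv)
  \<comment> \<open>The quotient map multiplies: a pure tensor goes to the result of letting its
    second factor act on its first inside the larger interval.\<close>
  define \<pi> where "\<pi> = lin_ext (\<lambda>(v, w). act Y v w)"
  have \<pi>t: "\<pi> (t v w) = act Y v w" for v w by (simp add: \<pi>_def)
  have lin: "pm_linear \<pi>" unfolding \<pi>_def by (rule linear_lin_ext)
  interpret \<pi>: Vector_Spaces.linear scale_pm scale_pm \<pi> by (rule lin)
  have vT: "v \<in> mcar ?T" if "v \<in> mcar ?N" for v using NT that by blast
  have sng_act: "act Y ?v0 (u x (i - x)) = sng i" if "x \<le> i" "i < Y" for i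
  proof -
    have "i - x < p x" using that xY by (simp add: f_def)
    then show ?thesis using that by (simp add: act_sng_u)
  qed
  have mem: "\<pi> z \<in> mcar ?T" if "z \<in> Free ?N" for z
    using that
  proof (induction rule: Free_induct)
    case zero
    then show ?case using module_closed(1)[OF rT] by (simp add: \<pi>.zero)
  next
    case (step c v w z)
    then have "act Y v w \<in> mcar ?T" using act_closed[OF vT eA_span V] by blast
    then show ?case using step module_closed[OF rT] by (simp add: \<pi>.add \<pi>.scale \<pi>t del: scale_pm_single)
  qed
  have image: "\<pi> ` Free ?N = mcar ?T"
  proof
    show "\<pi> ` Free ?N \<subseteq> mcar ?T" using mem by blast
    show "mcar ?T \<subseteq> \<pi> ` Free ?N"
    proof
      fix v assume v: "v \<in> mcar ?T"
      show "v \<in> \<pi> ` Free ?N"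
      proof (rule subspace_contains_keys)
        show "pm.subspace (\<pi> ` Free ?N)" by (rule \<pi>.subspace_image[OF subspace_Free])
        fix i assume "i \<in> supp v"
        then have i: "x \<le> i" "i < Y" "vt n i \<in> V" using v by (auto simp: mcar_Itv)
        then have "u x (i - x) \<in> eA" using x by (intro u_in_eA) simp_all
        then have "t ?v0 (u x (i - x)) \<in> Free ?N" using v0 t_Free by blast
        moreover have "\<pi> (t ?v0 (u x (i - x))) = sng i" using sng_act i by (simp add: \<pi>t)
        ultimately show "sng i \<in> \<pi> ` Free ?N" by (metis imageI)
      qed
    qed
  qed
  have actp: "act Y (act Y v w) w' = act Y v (w * w')" if "v \<in> mcar ?N" "w \<in> elems A" "w' \<in> elems A" for v w w'
    using act_act[OF that(1) xY(2) that(2,3)] .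
  have sub_ker: "pm.subspace {z \<in> Free ?N. \<pi> z = 0}"
    using subspace_Free[of ?N] unfolding pm.subspace_def by (simp add: \<pi>.zero \<pi>.add \<pi>.scale)
  have Rel_ker: "Rel ?N \<subseteq> {z \<in> Free ?N. \<pi> z = 0}"
  proof -
    have "Rel ?N \<subseteq> {z. \<pi> z = 0}"
      by (rule Rel_subset)
        (simp_all add: \<pi>.diff \<pi>.scale \<pi>t act_add_left act_add_right act_scale_left act_scale_right eA_elems
          actp corner_elems(2) del: scale_pm_single)
    then show ?thesis using Rel_Free[OF rN] by blast
  qed
  have W_eqI: "z \<in> ?W" if "z - w \<in> ?W" "w \<in> ?W" for z w
    using pm.span_add[OF that] by simp
  have R: "r \<in> Rel ?N \<Longrightarrow> r \<in> ?W" for r by (rule pm.span_base)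
  \<comment> \<open>The restricted interval is cyclic over \<open>eAe\<close>: the generator reaches
    a position over \<open>V'\<close> by a path with both ends in \<open>V'\<close>.\<close>
  have gen_v: "\<exists>b\<in>Sp V'. v = act Y ?v0 b" if v: "v \<in> mcar ?N" for v
    using v
  proof (induction rule: Itv_induct)
    case zero
    then show ?case using vs.span_zero by (metis act_zero(2))
  next
    case (step c i w)
    then obtain b where b: "b \<in> Sp V'" "w = act Y ?v0 b" by blast
    have ui: "u x (i - x) \<in> Sp V'" using step x by (intro u_in_span) simp_all
    have "scale_pm c (sng i) + w = act Y ?v0 (smul A c (u x (i - x)) + b)"
      using sng_act[OF step(1,2)] b corner_elems(2) ui vs.span_scale[OF ui]
      by (simp add: act_add_right act_scale_right del: scale_pm_single)
    then show ?case using ui b by (intro bexI[of _ "smul A c (u x (i - x)) + b"]) (simp_all add: vs.span_add vs.span_scale)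
  qed
  \<comment> \<open>If \<open>v\<close> is \<open>?v0\<close> times \<open>b\<close>, then
    \<open>b\<close> moves across the tensor sign; sums and scalars are absorbed into the second
    factor.\<close>
  have reduce: "\<exists>y\<in>eA. z - t ?v0 y \<in> ?W" if "z \<in> Free ?N" for z
    using that
  proof (induction rule: Free_induct)
    case zero
    have "t ?v0 (0 + 0) - t ?v0 0 - t ?v0 0 \<in> ?W" using Rel_mem(2)[OF v0 eA_closed(5) eA_closed(5)] by (rule R)
    then show ?case using eA_closed(5) by (intro bexI[of _ 0]) simp_all
  next
    case (step c v w z)
    obtain b where b: "b \<in> Sp V'" "v = act Y ?v0 b" using gen_v step(1) by blast
    obtain y where y: "y \<in> eA" "z - t ?v0 y \<in> ?W" using step by blast
    have bw: "b * w \<in> eA" using b step by (intro eA_closed)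
    have "t v w - t ?v0 (b * w) \<in> ?W" using Rel_mem(5)[OF v0 b(1) step(2)] b(2) by (intro R) simp
    then have 1: "scale_pm c (t v w) - scale_pm c (t ?v0 (b * w)) \<in> ?W"
      by (simp only: pm.scale_right_diff_distrib[symmetric] pm.span_scale)
    have 2: "t ?v0 (smul A c (b * w)) - scale_pm c (t ?v0 (b * w)) \<in> ?W" using Rel_mem(4)[OF v0 bw] by (rule R)
    have 3: "t ?v0 (smul A c (b * w) + y) - t ?v0 (smul A c (b * w)) - t ?v0 y \<in> ?W"
      using Rel_mem(2)[OF v0 eA_closed(2)[OF bw] y(1)] by (rule R)
    have "(scale_pm c (t v w) - scale_pm c (t ?v0 (b * w))) + (z - t ?v0 y)
        - (t ?v0 (smul A c (b * w)) - scale_pm c (t ?v0 (b * w)))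
        - (t ?v0 (smul A c (b * w) + y) - t ?v0 (smul A c (b * w)) - t ?v0 y) \<in> ?W"
      by (rule pm.span_diff[OF pm.span_diff[OF pm.span_add[OF 1 y(2)] 2] 3])
    then have "scale_pm c (t v w) + z - t ?v0 (smul A c (b * w) + y) \<in> ?W"
      by (simp add: algebra_simps del: scale_pm_single)
    then show ?case using eA_closed(1)[OF eA_closed(2)[OF bw] y(1)] by blast
  qed
  have kill: "t ?v0 y \<in> ?W" if y: "y \<in> eA" and 0: "act Y ?v0 y = 0" for y
  proof -
    define l where "l = Y - x"
    let ?e = "u x 0" and ?r = "u x l"
    \<comment> \<open>Coefficients of \<open>y\<close> at paths from \<open>x\<close> of length
      below \<open>l\<close> vanish, being coordinates of \<open>act Y ?v0 y\<close>. The longer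
      paths begin with \<open>?r\<close>, and \<open>y'\<close> collects what remains after it; the
      test for \<open>V\<close> makes every summand an element of \<open>eA\<close>.\<close>
    define y' where "y' = (\<Sum>k<p x. smul A (if l \<le> k \<and> vt n (x + k) \<in> V then cf y x k else 0) (u Y (k - l)))"
    have cf0: "cf y x k = 0" if "k < l" for k
    proof -
      have "0 = lkp (act Y ?v0 y) (x + k)" using 0 by simp
      also have "\<dots> = (\<Sum>i\<le>x + k. lkp ?v0 i * cf y i (x + k - i))"
        using that by (simp add: lookup_act l_def)
      also have "\<dots> = (\<Sum>i\<le>x + k. if i = x then cf y x k else 0)"
        by (intro sum.cong refl) (auto simp: lookup_single when_def)
      finally show ?thesis by simp
    qed
    have cfV: "cf w x k = 0" if "vt n (x + k) \<notin> V" "w \<in> Sp V" for k w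
      using that(2)
    proof (induction rule: basis_induct)
      case (base s j)
      have "vt n (x + k) = vt n (s + k)" if "vt n x = vt n s" using that by (rule vt_add_cong[OF n_pos])
      then show ?case using base \<open>vt n (x + k) \<notin> V\<close> by (auto simp: cf_u)
    qed (simp_all add: cf_add cf_smul corner_elems(1))
    have y'_eA: "y' \<in> eA"
    proof -
      have "smul A (if l \<le> k \<and> vt n (x + k) \<in> V then cf y x k else 0) (u Y (k - l)) \<in> eA" for k
      proof (cases "l \<le> k \<and> vt n (x + k) \<in> V")
        case True
        then have "Y + (k - l) = x + k" using xY unfolding l_def by linarith
        then have "u Y (k - l) \<in> eA" using Y True by (intro u_in_eA) simp_all
        then show ?thesis by (rule eA_closed(2))
      next
        case False
        then show ?thesis using eA_closed(5) by (simp only: if_False vs.scale_zero_left)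
      qed
      then show ?thesis unfolding y'_def by (rule eA_sum)
    qed
    have r: "?r \<in> Sp V'" using x Y xY by (intro u_in_span) (simp_all add: l_def)
    have e: "?e \<in> Sp V'" using x by (intro u_in_span) simp_all
    have ey: "?e * y = ?r * y'"
    proof -
      have yA: "y \<in> elems A" using y by (rule eA_elems)
      have fin: "finite {1..n}" by simp
      have "?e * y = ?e * (\<Sum>s\<in>{1..n}. \<Sum>k<p s. smul A (cf y s k) (u s k))"
        by (subst expand_cf[OF yA]) (rule refl)
      also have "\<dots> = (\<Sum>s\<in>{1..n}. \<Sum>k<p s. smul A (cf y s k) (?e * u s k))"
        by (simp only: sum_distrib_left smul_mult_right)
      also have "\<dots> = (\<Sum>s\<in>{1..n}. if s = vt n x then \<Sum>k<p x. smul A (cf y x k) (u x k) else 0)"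
      proof (rule sum.cong[OF refl])
        fix s assume "s \<in> {1..n}"
        then have s: "vt n s = s" by (rule vt_id)
        show "(\<Sum>k<p s. smul A (cf y s k) (?e * u s k)) = (if s = vt n x then \<Sum>k<p x. smul A (cf y x k) (u x k) else 0)"
        proof (cases "s = vt n x")
          case True
          then have "vt n s = vt n x" using s by simp
          then have "p s = p x" "cf y s k = cf y x k" for k using p_eq cf_vt by blast+
          then show ?thesis using True s by (simp add: u_mult)
        qed (use s in \<open>simp add: u_mult\<close>)
      qed
      also have "\<dots> = (\<Sum>k<p x. smul A (cf y x k) (u x k))"
        using vt_in[OF n_pos, of x] by (simp only: sum.delta[OF fin] if_True)
      also have "\<dots> = (\<Sum>k<p x. ?r * smul A (if l \<le> k \<and> vt n (x + k) \<in> V then cf y x k else 0) (u Y (k - l)))"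
      proof (rule sum.cong[OF refl])
        fix k
        show "smul A (cf y x k) (u x k) = ?r * smul A (if l \<le> k \<and> vt n (x + k) \<in> V then cf y x k else 0) (u Y (k - l))"
        proof (cases "l \<le> k \<and> vt n (x + k) \<in> V")
          case True
          moreover have "vt n (x + l) = vt n Y" using xY by (simp add: l_def)
          ultimately show ?thesis by (simp add: smul_mult_right u_mult)
        next
          case False
          then have "cf y x k = 0" using cf0 cfV y eA_span by (cases "l \<le> k") auto
          then show ?thesis by (simp add: smul_mult_right)
        qed
      qed
      finally show ?thesis by (simp add: y'_def sum_distrib_left)
    qed
    \<comment> \<open>The chain is \<open>?v0 \<otimes> y = ?v0 \<otimes> (?e * y) = ?v0 \<otimes>
      (?r * y') = 0 \<otimes> y'\<close>. The last equality holds because \<open>?r\<close> moves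
      position \<open>x\<close> to \<open>Y\<close>, just outside the interval.\<close>
    have "act Y ?v0 ?e = ?v0" using xY p_pos by (simp add: act_sng_u)
    then have 1: "t ?v0 y - t ?v0 (?e * y) \<in> ?W" using Rel_mem(5)[OF v0 e y] by (intro R) simp
    have "act Y ?v0 ?r = 0" using xY by (simp add: act_sng_u l_def)
    then have 2: "t 0 y' - t ?v0 (?r * y') \<in> ?W" using Rel_mem(5)[OF v0 r y'_eA] by (intro R) simp
    have 3: "t 0 y' \<in> ?W" using R[OF Rel_mem(3)[OF v0 y'_eA, of 0]] by simp
    have "t ?v0 y - t ?v0 (?e * y) - (t 0 y' - t ?v0 (?r * y')) + t 0 y' \<in> ?W"
      by (rule pm.span_add[OF pm.span_diff[OF 1 2] 3])
    then show ?thesis using ey by simp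
  qed
  have "{z \<in> Free ?N. \<pi> z = 0} \<subseteq> ?W"
  proof clarify
    fix z assume z: "z \<in> Free ?N" "\<pi> z = 0"
    obtain y where y: "y \<in> eA" "z - t ?v0 y \<in> ?W" using reduce z(1) by blast
    have "?W \<subseteq> {z \<in> Free ?N. \<pi> z = 0}" using Rel_ker sub_ker by (rule pm.span_minimal)
    then have "\<pi> (z - t ?v0 y) = 0" using y(2) by blast
    then have "act Y ?v0 y = 0" using z(2) by (simp add: \<pi>.diff \<pi>t)
    then show "z \<in> ?W" using W_eqI[OF y(2)] kill[OF y(1)] by blast
  qed
  then have kernel: "{z \<in> Free ?N. \<pi> z = 0} = ?W"
    using pm.span_minimal[OF Rel_ker sub_ker] by (rule equalityI)
  have "mact ?T (\<pi> (t v w)) y = \<pi> (t v (w * y))" if "v \<in> mcar ?N" "w \<in> eA" "y \<in> Sp V" for v w y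
    using actp that eA_elems corner_elems(1) by (simp add: \<pi>t)
  then show ?thesis unfolding is_tensor_product_cor tensor_map_def using rT lin image kernel by blast
qed

lemma functor_G_Itv:
  assumes xY: "x < Y" "Y \<le> f x" and x: "vt n x \<in> V'" and Y: "vt n Y \<in> V'"
    and N: "right_module (cor V') N" and iso: "mod_iso (cor V') N (Itv V' x Y)"
  shows "right_module (cor V) (functor_G (cor V) N) \<and> mod_iso (cor V) (functor_G (cor V) N) (Itv V x Y)"
proof -
  have T: "is_tensor_product (cor V) N (Itv V x Y)"
    by (rule is_tensor_product_iso[OF N right_module_Itv[OF V' xY(2)] iso is_tensor_product_Itv[OF xY x Y]])
  then have G: "is_tensor_product (cor V) N (functor_G (cor V) N)"
    unfolding functor_G_def by (rule someI)
  show ?thesis using is_tensor_product_unique[OF G T] G by (simp add: is_tensor_product_def)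
qed

end

section \<open>The modules \<open>E_iter\<close> as intervals\<close>

context nakayama
begin

text \<open>The end points lie over \<open>VV m\<close> and hence over all the larger sets of the
  earlier stages, so every step of \<open>G\<close> keeps them and only enlarges the set of
  positions in between.\<close>

lemma functor_G_iter_Itv:
  assumes "x < Y" "Y \<le> f x"
  shows "vt n x \<in> VV m \<Longrightarrow> vt n Y \<in> VV m \<Longrightarrow> right_module (cor (VV m)) N \<Longrightarrow> mod_iso (cor (VV m)) N (Itv (VV m) x Y) \<Longrightarrow>
    right_module A (functor_G_iter m A N) \<and> mod_iso A (functor_G_iter m A N) (J x Y)"
proof (induction m arbitrary: N)
  case 0
  then show ?case by simp
next
  case (Suc m)
  interpret corner_pair A n u p "VV m" "VV (Suc m)"
    by unfold_locales (rule VV_subset VV_Suc_subset eps_VV)+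
  have "vt n x \<in> VV m" "vt n Y \<in> VV m" using Suc.prems VV_Suc_subset by blast+
  then show ?case
    using Suc.IH functor_G_Itv[OF assms Suc.prems(1,2,3,4)] by (simp add: eps_iter)
qed

text \<open>Over a corner, positions outside \<open>V\<close> are invisible. The interval of a
  single position can thereby be given an upper end over \<open>V\<close>, which the computation of
  the tensor product requires.\<close>

lemma Itv_shorten:
  assumes V: "V \<subseteq> {1..n}" and y: "x < y" "y \<le> Y" "Y \<le> f x" and gap: "\<And>j. y \<le> j \<Longrightarrow> j < Y \<Longrightarrow> vt n j \<notin> V"
  shows "mod_iso (cor V) (Itv V x y) (Itv V x Y)"
proof -
  have car: "mcar (Itv V x Y) = mcar (Itv V x y)"
    unfolding set_eq_iff in_Itv_iff using gap y by (meson less_le_trans not_le)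
  have "act y v w = act Y v w" if v: "v \<in> mcar (Itv V x y)" and w: "w \<in> Sp V" for v w
  proof (rule poly_mapping_eqI)
    fix j
    have "act Y v w \<in> mcar (Itv V x y)" using act_closed[OF _ w V, of v x Y] v unfolding car by blast
    then have "lkp (act Y v w) j = 0" if "\<not> j < y" using that by (auto simp: in_Itv_iff)
    then show "lkp (act y v w) j = lkp (act Y v w) j" using y by (cases "j < y") (auto simp: lookup_act)
  qed
  then have "mod_hom (cor V) (Itv V x y) (Itv V x Y) (\<lambda>v. v)"
    by (simp add: mod_hom_def car)
  then show ?thesis unfolding mod_iso_def using car by (intro exI[of _ "\<lambda>v. v"]) (simp add: bij_betw_def)
qed

lemma E_iter_J:
  assumes xY: "x < Y" "Y \<le> f x" and x: "vt n x \<in> VV m" and Y: "vt n Y \<in> VV m"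
    and gap: "\<And>j. x < j \<Longrightarrow> j < Y \<Longrightarrow> vt n j \<notin> VV m"
  shows "right_module A (E_iter m A (vt n x)) \<and> mod_iso A (E_iter m A (vt n x)) (J x Y)"
proof -
  have "mod_iso (cor (VV m)) (Itv (VV m) x (Suc x)) (Itv (VV m) x Y)"
    using xY gap by (intro Itv_shorten[OF VV_subset]) simp_all
  then show ?thesis
    unfolding E_iter_def using functor_F_iter_simple[of m x]
    by (intro functor_G_iter_Itv[OF xY x Y]) (auto intro: mod_iso_trans)
qed

end

section \<open>Iterating \<open>\<gamma>\<close> and \<open>\<psi>\<close>\<close>

text \<open>Discrete intermediate value property; with \<open>g = f ^^ m\<close> it produces the
  index \<open>c\<close> that \<open>psi_pow_vt\<close> asks for.\<close>

lemma mono_crossing: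
  fixes g :: "nat \<Rightarrow> nat"
  assumes "g lo \<le> b" "b < g hi" "lo \<le> hi"
  shows "\<exists>c. lo \<le> c \<and> c < hi \<and> g c \<le> b \<and> b < g (Suc c)"
  using assms(3,2)
proof (induction hi rule: dec_induct)
  case base
  then show ?case using assms(1) by simp
next
  case (step hi)
  then show ?case by (cases "b < g hi") (auto intro: less_SucI)
qed

context nakayama
begin

lemma f_pow_mono: "i \<le> j \<Longrightarrow> (f ^^ m) i \<le> (f ^^ m) j"
  by (induction m) (auto intro: f_mono)

lemma f_pow_ge: "i \<le> (f ^^ m) i"
proof (induction m)
  case (Suc m)
  then show ?case using f_gt[of "(f ^^ m) i"] by simp
qed simp

lemma f_pow_add_mult: "(f ^^ m) (i + k * n) = (f ^^ m) i + k * n"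
  by (induction m) (simp_all add: f_add_mult)

lemma gm_pow_vt: "(gm ^^ m) (vt n i) = vt n ((f ^^ m) i)"
  by (induction m) simp_all

lemma gamma_pow:
  assumes "a \<in> full"
  shows "(gamma A ^^ m) a = (gm ^^ m) a \<and> (gm ^^ m) a \<in> full"
proof (induction m)
  case (Suc m)
  then show ?case using gamma_eq_gm by (simp add: gm_def)
qed (use assms in simp)

text \<open>On lifts, \<open>\<psi>\<close> is the right adjoint of the monotone map \<^term>\<open>f\<close>: its value at \<open>b\<close> is the largest \<open>c\<close>
  with \<open>f c \<le> b\<close>. Adjoints compose, so the same description holds for the iterates.\<close>

lemma psi_pow_vt:
  "(f ^^ m) c \<le> b \<Longrightarrow> b < (f ^^ m) (Suc c) \<Longrightarrow> (psi A ^^ m) (vt n b) = vt n c"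
proof (induction m arbitrary: c)
  case 0
  then have "b = c" by simp
  then show ?case by simp
next
  case (Suc m)
  have "(f ^^ m) (f c) \<le> b" "b < (f ^^ m) (f (Suc c))"
    using Suc.prems by (simp_all add: funpow_swap1)
  \<comment> \<open>The intermediate \<open>d\<close> lifts the value of \<open>psi ^^ m\<close> at
    \<open>b\<close>; one more application of \<open>psi\<close> takes it to
    \<open>c\<close>.\<close>
  then obtain d where d: "f c \<le> d" "d < f (Suc c)" "(f ^^ m) d \<le> b" "b < (f ^^ m) (Suc d)"
    using mono_crossing[of "f ^^ m" "f c" b "f (Suc c)"] f_mono[of c "Suc c"] by auto
  then show ?case using Suc.IH psi_vt by simp
qed

text \<open>Vertices of \<open>Im gamma^m\<close> lift to values of \<open>f ^^ m\<close> up to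
  multiples of \<open>n\<close>. By monotonicity none of them falls strictly between
  \<open>(f ^^ m) c\<close> and \<open>(f ^^ m) (Suc c)\<close>, so the latter is the next vertex of
  the corner.\<close>

lemma E_iter_iso:
  assumes lt: "(f ^^ m) c < (f ^^ m) (Suc c)"
  shows "right_module A (E_iter m A (vt n ((f ^^ m) c)))"
    and "mod_iso A (E_iter m A (vt n ((f ^^ m) c))) (J ((f ^^ m) c) ((f ^^ m) (Suc c)))"
    and "(f ^^ m) (Suc c) \<le> f ((f ^^ m) c)"
proof -
  have vVV: "vt n ((f ^^ m) i) \<in> VV m" for i
    unfolding VV_def using gm_pow_vt[of m i] by (metis imageI vt_full)
  have "Suc c \<le> f c" using f_gt by (simp add: Suc_leI)
  then show Y: "(f ^^ m) (Suc c) \<le> f ((f ^^ m) c)" using f_pow_mono[of "Suc c" "f c" m] by (simp add: funpow_swap1)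
  have gap: "vt n j \<notin> VV m" if j: "(f ^^ m) c < j" "j < (f ^^ m) (Suc c)" for j
  proof
    assume "vt n j \<in> VV m"
    then obtain i where i: "vt n j = (gm ^^ m) i" "i \<in> full" by (auto simp: VV_def)
    have "vt n i = i" using i(2) unfolding full_def by (rule vt_id)
    then have "vt n j = vt n ((f ^^ m) i)" using i(1) gm_pow_vt[of m i] by simp
    then have "j mod n = (f ^^ m) i mod n" by (simp add: vt_eq_iff)
    \<comment> \<open>Congruent positions are made equal by adding multiples of \<open>n\<close> on
      both sides, which avoids negative translations.\<close>
    define k k' where "k = (f ^^ m) i div n" and "k' = j div n"
    have e: "j + k * n = (f ^^ m) i + k' * n"
      unfolding k_def k'_def using \<open>j mod n = _\<close> div_mult_mod_eq[of j n] div_mult_mod_eq[of "(f ^^ m) i" n]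
      by linarith
    have "(f ^^ m) (c + k * n) < (f ^^ m) (i + k' * n)" "(f ^^ m) (i + k' * n) < (f ^^ m) (Suc c + k * n)"
      unfolding f_pow_add_mult using j e by linarith+
    then have "\<not> i + k' * n \<le> c + k * n" "\<not> Suc c + k * n \<le> i + k' * n"
      using f_pow_mono not_le by metis+
    then show False by simp
  qed
  show "right_module A (E_iter m A (vt n ((f ^^ m) c)))"
    "mod_iso A (E_iter m A (vt n ((f ^^ m) c))) (J ((f ^^ m) c) ((f ^^ m) (Suc c)))"
    using E_iter_J[OF lt Y vVV vVV gap] by blast+
qed

lemma interval_iff_psi:
  assumes b: "b \<in> {1..n}"
  shows "(\<exists>j. (f ^^ m) c \<le> j \<and> j < (f ^^ m) (Suc c) \<and> vt n j = b) \<longleftrightarrow> (psi A ^^ m) b = vt n c"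
proof
  assume "\<exists>j. (f ^^ m) c \<le> j \<and> j < (f ^^ m) (Suc c) \<and> vt n j = b"
  then show "(psi A ^^ m) b = vt n c" using psi_pow_vt by blast
next
  assume psi: "(psi A ^^ m) b = vt n c"
  \<comment> \<open>A lift of \<open>b\<close> above \<open>(f ^^ m) c\<close>, since
    \<open>n\<close> is at least 1.\<close>
  define b' where "b' = b + (f ^^ m) c * n"
  have vb: "vt n b' = b" unfolding b'_def using vt_id[OF b] by simp
  have "(f ^^ m) c \<le> (f ^^ m) c * n" by (simp add: Suc_leI)
  then have lo: "(f ^^ m) c \<le> b'" unfolding b'_def by linarith
  then have "c \<le> b'" using f_pow_ge[of c m] by simp
  moreover have "b' < (f ^^ m) (Suc b')" using f_pow_ge[of "Suc b'" m] by simp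
  ultimately obtain d where d: "c \<le> d" "(f ^^ m) d \<le> b'" "b' < (f ^^ m) (Suc d)"
    using lo mono_crossing[of "f ^^ m" c b' "Suc b'"] by auto
  have "vt n d = vt n c" using psi_pow_vt[OF d(2,3)] psi vb by simp
  then have "d mod n = c mod n" by (simp add: vt_eq_iff)
  \<comment> \<open>The interval that contains \<open>b'\<close> belongs to a translate
    \<open>c + k * n\<close>; moving back by \<open>k * n\<close> puts a lift of \<open>b\<close>
    into the interval at \<open>c\<close>.\<close>
  then obtain k where k: "d = c + k * n"
    using d(1) by (metis add.commute mod_eq_dvd_iff_nat dvd_div_mult_self le_add_diff_inverse)
  have "(f ^^ m) c + k * n \<le> b'" "b' < (f ^^ m) (Suc c) + k * n"
    using d(2,3) f_pow_add_mult[of m c k] f_pow_add_mult[of m "Suc c" k] by (simp_all add: k)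
  moreover from this have "vt n (b' - k * n) = b"
    using vb vt_add_mult[OF n_pos, of "b' - k * n" k] by simp
  ultimately show "\<exists>j. (f ^^ m) c \<le> j \<and> j < (f ^^ m) (Suc c) \<and> vt n j = b"
    by (intro exI[of _ "b' - k * n"]) linarith
qed

lemma composition_factor_E_iter:
  assumes a: "a \<in> (gamma A ^^ m) ` full" and b: "b \<in> {1..n}"
  shows "composition_factor A (simple_at A b) (E_iter m A a) \<longleftrightarrow> (psi A ^^ m) b = (psi A ^^ m) a"
proof -
  obtain i where i: "i \<in> full" "a = (gamma A ^^ m) i" using a by blast
  have "vt n i = i" using i(1) unfolding full_def by (rule vt_id)
  then have ai: "a = vt n ((f ^^ m) i)" using i gamma_pow gm_pow_vt[of m i] by simp
  \<comment> \<open>\<open>f ^^ m\<close> may stay constant for a while, but translation by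
    \<open>n\<close> shows that its value changes. The last index \<open>c\<close> with the same
    value as \<open>i\<close> makes the interval nonempty.\<close>
  have "(f ^^ m) i < (f ^^ m) (i + 1 * n)" unfolding f_pow_add_mult by simp
  then obtain c where c: "i \<le> c" "(f ^^ m) c \<le> (f ^^ m) i" "(f ^^ m) i < (f ^^ m) (Suc c)"
    using mono_crossing[of "f ^^ m" i "(f ^^ m) i" "i + 1 * n"] by auto
  then have x: "(f ^^ m) c = (f ^^ m) i" using f_pow_mono[OF c(1), of m] by simp
  then have lt: "(f ^^ m) c < (f ^^ m) (Suc c)" and ac: "a = vt n ((f ^^ m) c)" using c ai by simp_all
  note E = E_iter_iso[OF lt, folded ac]
  have rJ: "right_module A (J ((f ^^ m) c) ((f ^^ m) (Suc c)))" using E(3) by (rule right_module_J)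
  have "composition_factor A (simple_at A b) (E_iter m A a)
      \<longleftrightarrow> composition_factor A (simple_at A b) (J ((f ^^ m) c) ((f ^^ m) (Suc c)))"
    using composition_factor_iso[OF E(1) rJ E(2)] composition_factor_iso[OF rJ E(1) mod_iso_sym[OF E(1,2)]] by blast
  also have "\<dots> \<longleftrightarrow> (psi A ^^ m) b = vt n c"
    unfolding composition_factor_J[OF E(3) b] by (rule interval_iff_psi[OF b])
  also have "vt n c = (psi A ^^ m) a" unfolding ac by (rule psi_pow_vt[OF order_refl lt, symmetric])
  finally show ?thesis .
qed

text \<open>Both sides are \<open>J ((f ^^ m) a) ((f ^^ m) (Suc a))\<close>. The bound on the
  projective dimension makes this interval nonempty, so that the description of
  \<open>E_iter\<close> applies with \<open>c = a\<close>.\<close>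

lemma syzygy_iso_E_iter:
  assumes m: "m > 0" and a: "a \<in> full" and pd: "proj_dim A (simple_at A a) \<ge> enat (2 * m)"
  shows "mod_iso A (syzygy A (2 * m) (simple_at A a)) (E_iter m A ((gamma A ^^ m) a))"
proof -
  have va: "vt n a = a" using a unfolding full_def by (rule vt_id)
  note S = syzygy_simple_even[OF m, of a, unfolded va, OF pd]
  have "(gamma A ^^ m) a = vt n ((f ^^ m) a)" using gamma_pow[OF a] gm_pow_vt[of m a] va by simp
  then show ?thesis
    using mod_iso_trans[OF S(1) mod_iso_sym[OF E_iter_iso(1,2)[OF S(2)]]] by simp
qed

end

theorem proposition3p5:
  fixes A :: "('k::field, 'a::ring) vertex_algebra"
    and n m a b :: nat
  assumes "nakayama_algebra n A"
    and "m > 0"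
    and "a \<in> {1..n}" and "b \<in> {1..n}"
  shows "(a \<in> (gamma A ^^ m) ` {1..n} \<longrightarrow>
            (composition_factor A (simple_at A b) (E_iter m A a) \<longleftrightarrow>
             (psi A ^^ m) b = (psi A ^^ m) a))
       \<and> (proj_dim A (simple_at A a) \<ge> enat (2 * m) \<longrightarrow>
            mod_iso A (syzygy A (2 * m) (simple_at A a)) (E_iter m A ((gamma A ^^ m) a)))"
proof -
  obtain u p where "nakayama A n u p"
    using nakayama_algebra_imp_nakayama[OF assms(1)] by blast
  then interpret nakayama A n u p .
  show ?thesis
    using composition_factor_E_iter[OF _ assms(4), of a m] syzygy_iso_E_iter[OF assms(2), of a] assms(3)
    unfolding full_def by blast
qed

end
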